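(* Let $n\ge 3$, $G=\mathrm{SL}(2n)$, $H=\mathrm{Sp}(2n)\subseteq G$, and let $P$ be the parabolic subgroup of $H$ corresponding to $I=\{\beta_1\}$. Then the extended weight monoid $\widetilde\Gamma(G/P)$ is freely generated by $$(\omega_{2i},0),\ 1\le i\le n-1,\qquad (\omega_{2j-1},-\varpi_1),\ 1\le j\le n.$$
   Context: Groups are over $\mathbb C$. Fix $T\subseteq B\subseteq G$ a maximal torus and Borel subgroup, and $T_H\subseteq B_H\subseteq H$ likewise, with $T_H\subseteq T$ and $B_H\subseteq B$; $B_H^-$ is the Borel subgroup of $H$ opposite to $B_H$. Simple roots $\alpha_1,\alpha_2,\dots$ of $G$ and $\beta_1,\beta_2,\dots$ of $H$ are numbered as in Bourbaki, with fundamental dominant weights $\omega_1,\omega_2,\dots$ of $G$ and $\varpi_1,\varpi_2,\dots$ of $H$. For a set $I$ of simple roots of $H$, the corresponding parabolic subgroup $P$ of $H$ contains $B_H^-$, and its Levi subgroup containing $T_H$ has as simple roots all simple roots of $H$ not in $I$. Characters of $P$ are identified with their restrictions to $T_H$. The extended weight monoid $\widetilde\Gamma(G/P)$ is the set of pairs $(\omega,\chi)$, with $\omega$ a character of $B$ (equivalently of $T$) and $\chi$ a character of $P$, for which there is a non-zero $f\in\mathbb C[G]$ with $f(b^{-1}gp)=\omega(b)f(g)\chi(p)$ for all $b\in B$, $g\in G$, $p\in P$. *)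

theory Defs
  imports "Jordan_Normal_Form.Determinant" "HOL-Algebra.Algebra"
    "HOL-Computational_Algebra.Polynomial"
begin

text \<open>
  Algebraic groups are Zariski-closed subgroups of \<open>GL(N)\<close>, given as sets of complex
  \<open>N\<close> by \<open>N\<close> matrices; products and inverses are taken in the group \<open>GL N\<close>.
\<close>

definition GL :: "nat \<Rightarrow> complex mat monoid" where
  "GL N = units_of (ring_mat TYPE(complex) N ())"

definition SL :: "nat \<Rightarrow> complex mat set" where
  "SL N = {A \<in> carrier (GL N). det A = 1}"

definition Sp :: "nat \<Rightarrow> complex mat \<Rightarrow> complex mat set" where
  "Sp N \<Omega> = {A \<in> carrier (GL N). transpose_mat A * \<Omega> * A = \<Omega>}"

text \<open>
  Gram matrix of the alternating form in Bourbaki's basis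
  \<open>e\<^sub>1, \<dots>, e\<^sub>n, e\<^sub>-\<^sub>n, \<dots>, e\<^sub>-\<^sub>1\<close>, where \<open>e\<^sub>i\<close> pairs with \<open>e\<^sub>-\<^sub>i\<close> to \<open>1\<close>.
\<close>

definition bourbaki_form :: "nat \<Rightarrow> complex mat" where
  "bourbaki_form n = mat (2 * n) (2 * n)
     (\<lambda>(i, j). if i + j = 2 * n - 1 then (if i < n then 1 else - 1) else 0)"

text \<open>
  A regular function on a closed subgroup of \<open>SL(N)\<close> is the restriction of a
  polynomial in the matrix entries (no inverse determinant is needed).
\<close>

inductive_set poly_funs :: "nat \<Rightarrow> (complex mat \<Rightarrow> complex) set" for N :: nat where
  const: "(\<lambda>_. c) \<in> poly_funs N"
| entry: "i < N \<Longrightarrow> j < N \<Longrightarrow> (\<lambda>A. A $$ (i, j)) \<in> poly_funs N"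
| add: "p \<in> poly_funs N \<Longrightarrow> q \<in> poly_funs N \<Longrightarrow> (\<lambda>A. p A + q A) \<in> poly_funs N"
| mult: "p \<in> poly_funs N \<Longrightarrow> q \<in> poly_funs N \<Longrightarrow> (\<lambda>A. p A * q A) \<in> poly_funs N"

definition regular_funs :: "nat \<Rightarrow> complex mat set \<Rightarrow> (complex mat \<Rightarrow> complex) set" where
  "regular_funs N K = {restrict p K | p. p \<in> poly_funs N}"

definition characters :: "nat \<Rightarrow> complex mat set \<Rightarrow> (complex mat \<Rightarrow> complex) set" where
  "characters N K = {\<phi> \<in> regular_funs N K.
     (\<forall>A\<in>K. \<phi> A \<noteq> 0) \<and> (\<forall>A\<in>K. \<forall>B\<in>K. \<phi> (A * B) = \<phi> A * \<phi> B)}"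

text \<open>
  Characters are written multiplicatively: the additive \<open>0\<close> and \<open>-\<chi>\<close> of the usual notation
  are the unit and the inverse of this group.
\<close>

definition char_group :: "nat \<Rightarrow> complex mat set \<Rightarrow> (complex mat \<Rightarrow> complex) monoid" where
  "char_group N K = \<lparr>carrier = characters N K,
     mult = (\<lambda>\<phi> \<psi>. \<lambda>A\<in>K. \<phi> A * \<psi> A), one = (\<lambda>A\<in>K. 1)\<rparr>"

text \<open>
  The columns of an invertible \<open>S\<close> form a basis of \<open>\<complex>\<^sup>N\<close>. For \<open>K\<close> the group \<open>SL(N)\<close>, and, if the
  Gram matrix in this basis is \<open>bourbaki_form\<close>, for \<open>K\<close> the symplectic group, the elements
  of \<open>K\<close> that are diagonal, upper triangular and lower triangular in this basis form a maximal
  torus, a Borel subgroup containing it, and the opposite Borel subgroup.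
\<close>

definition in_basis :: "nat \<Rightarrow> complex mat \<Rightarrow> complex mat \<Rightarrow> complex mat" where
  "in_basis N S A = inv\<^bsub>GL N\<^esub> S * A * S"

definition torus :: "nat \<Rightarrow> complex mat \<Rightarrow> complex mat set \<Rightarrow> complex mat set" where
  "torus N S K = {A \<in> K. diagonal_mat (in_basis N S A)}"

definition borel :: "nat \<Rightarrow> complex mat \<Rightarrow> complex mat set \<Rightarrow> complex mat set" where
  "borel N S K = {A \<in> K. upper_triangular (in_basis N S A)}"

definition opp_borel :: "nat \<Rightarrow> complex mat \<Rightarrow> complex mat set \<Rightarrow> complex mat set" where
  "opp_borel N S K = {A \<in> K. upper_triangular (transpose_mat (in_basis N S A))}"

text \<open>
  The coordinate character \<open>\<epsilon>\<^sub>k\<close> (\<open>1 \<le> k \<le> N\<close>) of the torus. In Bourbaki's plates for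
  the types A and C, the fundamental weights are \<open>\<epsilon>\<^sub>1 + \<dots> + \<epsilon>\<^sub>i\<close>, and the simple roots in
  type C are \<open>\<epsilon>\<^sub>i - \<epsilon>\<^sub>i\<^sub>+\<^sub>1\<close> for \<open>i < n\<close> and \<open>2\<epsilon>\<^sub>n\<close>.
\<close>

definition eps :: "nat \<Rightarrow> complex mat \<Rightarrow> nat \<Rightarrow> complex mat \<Rightarrow> complex" where
  "eps N S k t = in_basis N S t $$ (k - 1, k - 1)"

definition fund_weight ::
    "nat \<Rightarrow> complex mat \<Rightarrow> complex mat set \<Rightarrow> nat \<Rightarrow> complex mat \<Rightarrow> complex" where
  "fund_weight N S K i = (\<lambda>t\<in>torus N S K. \<Prod>k\<in>{1..i}. eps N S k t)"

definition simple_root_C ::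
    "nat \<Rightarrow> complex mat \<Rightarrow> complex mat set \<Rightarrow> nat \<Rightarrow> complex mat \<Rightarrow> complex" where
  "simple_root_C n S K i = (\<lambda>t\<in>torus (2 * n) S K.
     if i < n then eps (2 * n) S i t / eps (2 * n) S (i + 1) t else (eps (2 * n) S n t)\<^sup>2)"

definition root_subgroup ::
    "nat \<Rightarrow> complex mat set \<Rightarrow> complex mat set \<Rightarrow> (complex mat \<Rightarrow> complex) \<Rightarrow> complex mat set" where
  "root_subgroup N K T \<beta> = {A. \<exists>u :: complex \<Rightarrow> complex mat.
     A \<in> range u \<and> range u \<subseteq> K \<and>
     (\<forall>x y. u (x + y) = u x * u y) \<and>
     (\<forall>i<N. \<forall>j<N. \<exists>p. \<forall>x. u x $$ (i, j) = poly p x) \<and>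
     (\<forall>t\<in>T. \<forall>x. t * u x * inv\<^bsub>GL N\<^esub> t = u (\<beta> t * x))}"

text \<open>
  The parabolic subgroup containing the opposite Borel subgroup \<open>Bm\<close> whose Levi subgroup
  containing \<open>T\<close> has the set of simple roots \<open>\<Delta> - I\<close>.
\<close>

definition parabolic ::
    "nat \<Rightarrow> complex mat set \<Rightarrow> complex mat set \<Rightarrow> complex mat set \<Rightarrow>
     (complex mat \<Rightarrow> complex) set \<Rightarrow> (complex mat \<Rightarrow> complex) set \<Rightarrow> complex mat set" where
  "parabolic N K T Bm \<Delta> I = generate (GL N) (Bm \<union> (\<Union>\<beta>\<in>\<Delta> - I. root_subgroup N K T \<beta>))"

text \<open>
  Characters of \<open>B\<close> and of \<open>P\<close> are recorded by their restrictions to the maximal tori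
  \<open>T\<close> and \<open>TH\<close>.
\<close>

definition ext_weight_monoid ::
    "nat \<Rightarrow> complex mat set \<Rightarrow> complex mat set \<Rightarrow> complex mat set \<Rightarrow> complex mat set \<Rightarrow>
     complex mat set \<Rightarrow> ((complex mat \<Rightarrow> complex) \<times> (complex mat \<Rightarrow> complex)) set" where
  "ext_weight_monoid N G B T P TH = {(restrict \<omega> T, restrict \<chi> TH) | \<omega> \<chi>.
     \<omega> \<in> characters N B \<and> \<chi> \<in> characters N P \<and>
     (\<exists>f\<in>regular_funs N G. (\<exists>g\<in>G. f g \<noteq> 0) \<and>
        (\<forall>b\<in>B. \<forall>g\<in>G. \<forall>p\<in>P. f (inv\<^bsub>GL N\<^esub> b * g * p) = \<omega> b * f g * \<chi> p))}"

definition freely_generated_by :: "('a, 'b) monoid_scheme \<Rightarrow> 'a set \<Rightarrow> 'a set \<Rightarrow> bool" where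
  "freely_generated_by D M gens \<longleftrightarrow> finite gens \<and> gens \<subseteq> carrier D \<and>
     bij_betw (\<lambda>a. finprod D (\<lambda>x. x [^]\<^bsub>D\<^esub> (a x)) gens) (gens \<rightarrow>\<^sub>E (UNIV :: nat set)) M"

end

theory Submission
  imports Defs
begin

text \<open>
  Work in the basis given by \<open>S\<close>, so that \<open>G\<close> is \<open>SL(2n)\<close>, \<open>B\<close> is upper triangular, \<open>H\<close> preserves
  the form \<open>J\<close>, and \<open>P\<close> is the stabiliser in \<open>H\<close> of the line through the last basis vector (this needs
  a generation theorem, \<open>line_stab_generation\<close>: a symplectic matrix stabilising the line is brought to
  lower triangular form by the simple root subgroups that \<open>P\<close> contains).

  A function on \<open>G\<close> that is semi-invariant under \<open>B\<close> sees a matrix \<open>g\<close> through the flag of its last \<open>k\<close>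
  rows. Right multiplication by \<open>P\<close> preserves the form \<open>J\<close> on row vectors and rescales the linear form
  "last coordinate". Hence the Pfaffian of the Gram matrix of the last \<open>k\<close> rows (\<open>k\<close> even), and of
  the last \<open>k\<close> rows together with the vector representing the last coordinate (\<open>k\<close> odd), is semi-invariant;
  its weight is \<open>(\<omega>\<^sub>2\<^sub>n\<^sub>-\<^sub>k, 0)\<close> or \<open>(\<omega>\<^sub>2\<^sub>n\<^sub>-\<^sub>k, -\<varpi>\<^sub>1)\<close>
  (\<open>corner_pfaffian_upper\<close>, \<open>corner_pfaffian_line_stab\<close>). These are the generators.
  As polynomials on matrices have no zero divisors, products of semi-invariants give all
  non-negative combinations.

  Conversely let \<open>f\<close> be any nonzero semi-invariant of weight \<open>(\<omega>, \<chi>)\<close>. Restricting \<open>f\<close> to the orbits of the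
  subgroups \<open>SL(2)\<close> of the simple roots of \<open>G\<close> shows that \<open>\<omega>\<close> is dominant, so \<open>\<omega>\<close> is a product of powers
  \<open>a\<^sub>i\<close> of the fundamental weights (\<open>weight_dominant\<close>). Where no Pfaffian vanishes, symplectic
  Gram-Schmidt reduction puts \<open>g\<close> into a normal form, so these points form one orbit of \<open>B \<times> P\<close>
  (\<open>open_orbit\<close>), and by density \<open>f\<close> does not vanish on it. The base point \<open>h\<close> of the orbit is chosen
  such that \<open>b h = h p\<close> for \<open>b = diag(x, 1/x, x, 1/x, \<dots>)\<close> and \<open>p = diag(x, \<dots>, x, 1/x, \<dots>, 1/x)\<close>.
  So \<open>\<omega>(b) \<chi>(p) = 1\<close>, that is \<open>\<chi>(p) = x\<^sup>-\<^sup>a\<close> with \<open>a\<close> the sum of the \<open>a\<^sub>i\<close> over odd \<open>i\<close>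
  (\<open>stabilizer_relation\<close>). Since \<open>\<chi>\<close> is trivial on the torus of \<open>Sp(2n - 2)\<close>
  (\<open>torus_char_trivial\<close>), this determines \<open>\<chi>\<close>, and \<open>(\<omega>, \<chi>)\<close> is the combination of the
  generators with exponents \<open>a\<^sub>i\<close> (\<open>weights_of_semi_invariant\<close>). The exponents are unique because
  they can be read off at the coroots.
\<close>

section \<open>Polynomial functions on matrices\<close>

lemma index_mult_sum:
  assumes "A \<in> carrier_mat n m" "B \<in> carrier_mat m k" "i < n" "j < k"
  shows "(A * B) $$ (i, j) = (\<Sum>l<m. A $$ (i, l) * B $$ (l, j))"
  using assms by (auto simp: scalar_prod_def atLeast0LessThan intro!: sum.cong)

lemma poly_funs_sum:
  "finite I \<Longrightarrow> (\<And>i. i \<in> I \<Longrightarrow> F i \<in> poly_funs N) \<Longrightarrow> (\<lambda>A. \<Sum>i\<in>I. F i A) \<in> poly_funs N"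
proof (induction I rule: finite_induct)
  case empty
  then show ?case by (simp add: poly_funs.const)
next
  case (insert i I)
  then show ?case by (simp add: poly_funs.add)
qed

lemma poly_funs_prod:
  "finite I \<Longrightarrow> (\<And>i. i \<in> I \<Longrightarrow> F i \<in> poly_funs N) \<Longrightarrow> (\<lambda>A. \<Prod>i\<in>I. F i A) \<in> poly_funs N"
proof (induction I rule: finite_induct)
  case empty
  then show ?case by (simp add: poly_funs.const)
next
  case (insert i I)
  then show ?case by (simp add: poly_funs.mult)
qed

lemma poly_funs_power: "p \<in> poly_funs N \<Longrightarrow> (\<lambda>A. p A ^ k) \<in> poly_funs N"
proof (induction k)
  case 0
  then show ?case by (simp add: poly_funs.const)
next
  case (Suc k)
  then show ?case by (simp add: poly_funs.mult)
qed

lemma poly_funs_subst: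
  assumes "p \<in> poly_funs N"
    and "\<And>i j. i < N \<Longrightarrow> j < N \<Longrightarrow> \<exists>q\<in>poly_funs N. \<forall>A\<in>Z. F A $$ (i, j) = q A"
  shows "\<exists>q\<in>poly_funs N. \<forall>A\<in>Z. p (F A) = q A"
  using assms(1)
proof induction
  case (const c)
  show ?case by (rule bexI[of _ "\<lambda>_. c", OF _ poly_funs.const]) simp
next
  case (entry i j)
  show ?case by (rule assms(2)[OF entry])
next
  case (add p q)
  then obtain p' q' where p': "p' \<in> poly_funs N" "\<And>A. A \<in> Z \<Longrightarrow> p (F A) = p' A"
    and q': "q' \<in> poly_funs N" "\<And>A. A \<in> Z \<Longrightarrow> q (F A) = q' A" by blast
  show ?case
    by (rule bexI[of _ "\<lambda>A. p' A + q' A", OF _ poly_funs.add[OF p'(1) q'(1)]]) (simp add: p'(2) q'(2))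
next
  case (mult p q)
  then obtain p' q' where p': "p' \<in> poly_funs N" "\<And>A. A \<in> Z \<Longrightarrow> p (F A) = p' A"
    and q': "q' \<in> poly_funs N" "\<And>A. A \<in> Z \<Longrightarrow> q (F A) = q' A" by blast
  show ?case
    by (rule bexI[of _ "\<lambda>A. p' A * q' A", OF _ poly_funs.mult[OF p'(1) q'(1)]]) (simp add: p'(2) q'(2))
qed

lemma poly_funs_conj:
  assumes "p \<in> poly_funs N" "C \<in> carrier_mat N N" "D \<in> carrier_mat N N"
  shows "\<exists>q\<in>poly_funs N. \<forall>A\<in>carrier_mat N N. p (C * A * D) = q A"
proof (rule poly_funs_subst[OF assms(1)])
  fix i j assume ij: "i < N" "j < N"
  let ?q = "\<lambda>A. \<Sum>l<N. (\<Sum>k<N. C $$ (i, k) * A $$ (k, l)) * D $$ (l, j)"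
  have "?q \<in> poly_funs N"
    by (intro poly_funs_sum poly_funs.mult poly_funs.const poly_funs.entry) (use ij in auto)
  moreover have "\<forall>A\<in>carrier_mat N N. (C * A * D) $$ (i, j) = ?q A"
  proof
    fix A :: "complex mat" assume A: "A \<in> carrier_mat N N"
    have "(C * A * D) $$ (i, j) = (\<Sum>l<N. (C * A) $$ (i, l) * D $$ (l, j))"
      by (rule index_mult_sum) (use A assms ij in auto)
    also have "\<dots> = ?q A"
      by (intro sum.cong refl arg_cong2[where f = times] index_mult_sum[OF assms(2) A]) (use ij in auto)
    finally show "(C * A * D) $$ (i, j) = ?q A" .
  qed
  ultimately show "\<exists>q\<in>poly_funs N. \<forall>A\<in>carrier_mat N N. (C * A * D) $$ (i, j) = q A"
    by (intro bexI[of _ ?q])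
qed

lemma det_poly_fun:
  assumes "\<And>i j. i < k \<Longrightarrow> j < k \<Longrightarrow> (\<lambda>A. M A $$ (i, j)) \<in> poly_funs N"
    and "\<And>A. M A \<in> carrier_mat k k"
  shows "(\<lambda>A. det (M A)) \<in> poly_funs N"
proof -
  have "(\<lambda>A. det (M A)) = (\<lambda>A. \<Sum>p | p permutes {0..<k}. signof p * (\<Prod>i = 0..<k. M A $$ (i, p i)))"
    using det_def'[OF assms(2)] by auto
  also have "\<dots> \<in> poly_funs N"
    by (intro poly_funs_sum poly_funs_prod poly_funs.mult poly_funs.const assms)
      (auto simp: finite_permutations permutes_in_image)
  finally show ?thesis .
qed

definition det_poly :: "nat \<Rightarrow> complex mat \<Rightarrow> complex" where
  "det_poly N A = det (mat N N (\<lambda>ij. A $$ ij))"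

lemma det_poly_in [intro]: "det_poly N \<in> poly_funs N"
  unfolding det_poly_def by (rule det_poly_fun[where k = N]) (auto intro: poly_funs.entry)

lemma det_poly_eq: "A \<in> carrier_mat N N \<Longrightarrow> det_poly N A = det A"
  unfolding det_poly_def by (intro arg_cong[where f = det]) auto

lemma poly_funs_curve:
  assumes "p \<in> poly_funs N" "\<And>i j. i < N \<Longrightarrow> j < N \<Longrightarrow> \<exists>q. \<forall>x. A x $$ (i, j) = poly q x"
  shows "\<exists>q. \<forall>x. p (A x) = poly q x"
  using assms(1)
proof induction
  case (const c)
  show ?case by (rule exI[of _ "[:c:]"]) simp
next
  case (entry i j)
  then show ?case using assms(2) by auto
next
  case (add p q)
  then obtain r s where "\<forall>x. p (A x) = poly r x" "\<forall>x. q (A x) = poly s x" by auto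
  then show ?case by (intro exI[of _ "r + s"]) simp
next
  case (mult p q)
  then obtain r s where "\<forall>x. p (A x) = poly r x" "\<forall>x. q (A x) = poly s x" by auto
  then show ?case by (intro exI[of _ "r * s"]) simp
qed

text \<open>
  For one-parameter subgroups of the torus, whose entries are constants, \<open>x\<close> or \<open>1/x\<close>: the factor \<open>x\<close>
  clears the pole of an entry, and a polynomial in the entries has a pole of some order \<open>M\<close>.
\<close>

lemma poly_funs_laurent:
  assumes "p \<in> poly_funs N"
    "\<And>i j. i < N \<Longrightarrow> j < N \<Longrightarrow> \<exists>q. \<forall>x. x \<noteq> 0 \<longrightarrow> x * A x $$ (i, j) = poly q x"
  shows "\<exists>M q. \<forall>x. x \<noteq> 0 \<longrightarrow> x ^ M * p (A x) = poly q x"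
  using assms(1)
proof induction
  case (const c)
  show ?case by (rule exI[of _ 0], rule exI[of _ "[:c:]"]) simp
next
  case (entry i j)
  then obtain q where "\<forall>x. x \<noteq> 0 \<longrightarrow> x * A x $$ (i, j) = poly q x" using assms(2)[OF entry] by blast
  then show ?case by (intro exI[of _ 1] exI[of _ q]) simp
next
  case (add p q)
  then obtain M r L s where "\<forall>x. x \<noteq> 0 \<longrightarrow> x ^ M * p (A x) = poly r x"
    "\<forall>x. x \<noteq> 0 \<longrightarrow> x ^ L * q (A x) = poly s x" by auto
  moreover have "x ^ (M + L) * (p (A x) + q (A x)) = (x ^ M * p (A x)) * x ^ L + (x ^ L * q (A x)) * x ^ M" for x
    by (simp add: power_add algebra_simps)
  ultimately have "\<forall>x. x \<noteq> 0 \<longrightarrow>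
      x ^ (M + L) * (p (A x) + q (A x)) = poly (r * Polynomial.monom 1 L + s * Polynomial.monom 1 M) x"
    by (simp only: poly_mult poly_add Polynomial.poly_monom) simp
  then show ?case by blast
next
  case (mult p q)
  then obtain M r L s where "\<forall>x. x \<noteq> 0 \<longrightarrow> x ^ M * p (A x) = poly r x"
    "\<forall>x. x \<noteq> 0 \<longrightarrow> x ^ L * q (A x) = poly s x" by auto
  moreover have "x ^ (M + L) * (p (A x) * q (A x)) = (x ^ M * p (A x)) * (x ^ L * q (A x))" for x
    by (simp add: power_add mult_ac)
  ultimately have "\<forall>x. x \<noteq> 0 \<longrightarrow> x ^ (M + L) * (p (A x) * q (A x)) = poly (r * s) x"
    by (simp only: poly_mult) simp
  then show ?case by blast
qed

text \<open>
  The space of matrices is irreducible: along the line through \<open>A\<close> and \<open>B\<close> both functions are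
  nonzero polynomials in one variable, and some point of the line avoids the roots of both.
\<close>

lemma poly_funs_nonzero_mult:
  assumes "p \<in> poly_funs N" "q \<in> poly_funs N"
    and "A \<in> carrier_mat N N" "B \<in> carrier_mat N N" "p A \<noteq> 0" "q B \<noteq> 0"
  obtains C where "C \<in> carrier_mat N N" "p C \<noteq> 0" "q C \<noteq> 0"
proof -
  define L where "L x = mat N N (\<lambda>ij. A $$ ij + x * (B $$ ij - A $$ ij))" for x
  have L: "\<exists>q. \<forall>x. L x $$ (i, j) = poly q x" if "i < N" "j < N" for i j
    by (rule exI[of _ "[:A $$ (i, j), B $$ (i, j) - A $$ (i, j):]"]) (use that in \<open>auto simp: L_def\<close>)
  obtain P where P: "\<And>x. p (L x) = poly P x" using poly_funs_curve[of p N L] assms(1) L by blast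
  obtain Q where Q: "\<And>x. q (L x) = poly Q x" using poly_funs_curve[of q N L] assms(2) L by blast
  have "L 0 = A" "L 1 = B" unfolding L_def by (rule eq_matI; use assms in auto)+
  then have "P \<noteq> 0" "Q \<noteq> 0" using P[of 0] Q[of 1] assms by auto
  then have "finite ({x. poly P x = 0} \<union> {x. poly Q x = 0})" by (simp add: poly_roots_finite)
  then obtain x where "x \<notin> {x. poly P x = 0} \<union> {x. poly Q x = 0}"
    using ex_new_if_finite infinite_UNIV_char_0 by blast
  then show ?thesis using that[of "L x"] P[of x] Q[of x] by (auto simp: L_def)
qed

lemma poly_funs_nonzero_prod:
  assumes "finite I" "\<And>i. i \<in> I \<Longrightarrow> F i \<in> poly_funs N"
    and "\<And>i. i \<in> I \<Longrightarrow> \<exists>A\<in>carrier_mat N N. F i A \<noteq> 0"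
  shows "\<exists>A\<in>carrier_mat N N. \<forall>i\<in>I. F i A \<noteq> 0"
  using assms
proof (induction I rule: finite_induct)
  case empty
  show ?case by (rule bexI[of _ "1\<^sub>m N"]) auto
next
  case (insert i I)
  obtain A where A: "A \<in> carrier_mat N N" "\<forall>i\<in>I. F i A \<noteq> 0"
    using insert.IH[OF insert.prems] by auto
  obtain B where B: "B \<in> carrier_mat N N" "F i B \<noteq> 0" using insert.prems by auto
  have nz: "(\<Prod>i\<in>I. F i A) \<noteq> 0" using A insert.hyps(1) by simp
  have "(\<lambda>A. \<Prod>i\<in>I. F i A) \<in> poly_funs N" "F i \<in> poly_funs N"
    using insert by (auto intro: poly_funs_prod)
  from poly_funs_nonzero_mult[OF this A(1) B(1) nz B(2)]
  obtain C where C: "C \<in> carrier_mat N N" "(\<Prod>i\<in>I. F i C) \<noteq> 0" "F i C \<noteq> 0" .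
  then have "\<forall>j\<in>insert i I. F j C \<noteq> 0" using insert.hyps(1) by simp
  with C(1) show ?case ..
qed

text \<open>
  Rescaling the top row retracts the invertible matrices onto those of determinant one. It is left
  multiplication by a diagonal matrix, so it respects semi-invariance under upper triangular matrices,
  and it is what links density on the affine space of matrices with density on \<open>SL(N)\<close>.
\<close>

definition norm_top :: "complex mat \<Rightarrow> complex mat" where
  "norm_top A = multrow 0 (1 / det A) A"

lemma norm_top_carrier [simp]: "A \<in> carrier_mat N N \<Longrightarrow> norm_top A \<in> carrier_mat N N"
  by (simp add: norm_top_def)

lemma det_norm_top:
  assumes "A \<in> carrier_mat N N" "0 < N" "det A \<noteq> 0"
  shows "det (norm_top A) = 1"
  unfolding norm_top_def using det_multrow[of 0 N A "1 / det A"] assms by simp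

lemma norm_top_SL:
  assumes "A \<in> carrier_mat N N" "det A = 1"
  shows "norm_top A = A"
  unfolding norm_top_def by (rule eq_matI) (use assms in \<open>auto simp: mat_multrow_gen_def\<close>)

text \<open>
  A function that is only meaningful at determinant one extends to invertible matrices along \<open>norm_top\<close>;
  the power of the determinant clears the denominators, so that the extension is polynomial.
\<close>

lemma poly_funs_norm_top:
  assumes "p \<in> poly_funs N"
  shows "\<exists>M. \<exists>q\<in>poly_funs N. \<forall>A\<in>carrier_mat N N. det A \<noteq> 0 \<longrightarrow> q A = det A ^ M * p (norm_top A)"
  using assms
proof induction
  case (const c)
  show ?case by (rule exI[of _ 0], rule bexI[of _ "\<lambda>_. c"]) (auto intro: poly_funs.const)
next
  case (entry i j)
  show ?case
  proof (cases "i = 0")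
    case True
    show ?thesis using entry True
      by (intro exI[of _ 1] bexI[of _ "\<lambda>A. A $$ (i, j)"])
        (auto simp: norm_top_def mat_multrow_gen_def intro: poly_funs.entry)
  next
    case False
    show ?thesis using entry False
      by (intro exI[of _ 0] bexI[of _ "\<lambda>A. A $$ (i, j)"])
        (auto simp: norm_top_def mat_multrow_gen_def intro: poly_funs.entry)
  qed
next
  case (add p q)
  from add.IH(1) obtain M p' where p': "p' \<in> poly_funs N"
    "\<And>A. A \<in> carrier_mat N N \<Longrightarrow> det A \<noteq> 0 \<Longrightarrow> p' A = det A ^ M * p (norm_top A)" by blast
  from add.IH(2) obtain L q' where q': "q' \<in> poly_funs N"
    "\<And>A. A \<in> carrier_mat N N \<Longrightarrow> det A \<noteq> 0 \<Longrightarrow> q' A = det A ^ L * q (norm_top A)" by blast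
  have "(\<lambda>A. p' A * det_poly N A ^ L + q' A * det_poly N A ^ M) \<in> poly_funs N"
    by (rule poly_funs.add[OF poly_funs.mult[OF p'(1) poly_funs_power[OF det_poly_in]] poly_funs.mult[OF q'(1) poly_funs_power[OF det_poly_in]]])
  moreover have "(det A ^ M * p (norm_top A)) * det A ^ L + (det A ^ L * q (norm_top A)) * det A ^ M
        = det A ^ (M + L) * (p (norm_top A) + q (norm_top A))" for A
    unfolding power_add by (simp only: ring_distribs mult_ac)
  ultimately show ?case
    by (intro exI[of _ "M + L"] bexI[of _ "\<lambda>A. p' A * det_poly N A ^ L + q' A * det_poly N A ^ M"] ballI impI) (simp_all add: p'(2) q'(2) det_poly_eq)
next
  case (mult p q)
  from mult.IH(1) obtain M p' where p': "p' \<in> poly_funs N"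
    "\<And>A. A \<in> carrier_mat N N \<Longrightarrow> det A \<noteq> 0 \<Longrightarrow> p' A = det A ^ M * p (norm_top A)" by blast
  from mult.IH(2) obtain L q' where q': "q' \<in> poly_funs N"
    "\<And>A. A \<in> carrier_mat N N \<Longrightarrow> det A \<noteq> 0 \<Longrightarrow> q' A = det A ^ L * q (norm_top A)" by blast
  have "(\<lambda>A. p' A * q' A) \<in> poly_funs N"
    by (rule poly_funs.mult[OF p'(1) q'(1)])
  moreover have "(det A ^ M * p (norm_top A)) * (det A ^ L * q (norm_top A))
        = det A ^ (M + L) * (p (norm_top A) * q (norm_top A))" for A
    unfolding power_add by (simp only: mult_ac)
  ultimately show ?case
    by (intro exI[of _ "M + L"] bexI[of _ "\<lambda>A. p' A * q' A"] ballI impI) (simp_all add: p'(2) q'(2) det_poly_eq)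
qed

section \<open>Pfaffians\<close>

text \<open>
  For an antisymmetric matrix every perfect matching is counted \<open>2\<^sup>m m!\<close> times, so this is the usual Pfaffian
  up to a nonzero constant. Summing over all permutations lets congruence be computed by determinants.
\<close>

definition pfaffian :: "nat \<Rightarrow> complex mat \<Rightarrow> complex" where
  "pfaffian m M = (\<Sum>\<sigma> | \<sigma> permutes {0..<2 * m}. signof \<sigma> * (\<Prod>i<m. M $$ (\<sigma> (2 * i), \<sigma> (2 * i + 1))))"

lemma prod_pairs: "(\<Prod>r = 0..<2 * m. F r) = (\<Prod>i<m. F (2 * i) * F (2 * i + 1))" for F :: "nat \<Rightarrow> complex"
  by (induction m) (simp_all add: mult_ac)

text \<open>
  Expanding the entries of \<open>C M C\<^sup>T\<close> gives a sum over functions \<open>g\<close> that choose a pair of columns of \<open>C\<close> for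
  each factor. For fixed \<open>g\<close> the sum over permutations is the determinant of \<open>C\<close> times a 0/1 matrix that
  depends on \<open>g\<close> only. The same expansion for \<open>C = 1\<close> identifies the remaining factor.
\<close>

lemma pfaffian_congruence:
  assumes C: "C \<in> carrier_mat (2 * m) (2 * m)" and M: "M \<in> carrier_mat (2 * m) (2 * m)"
  shows "pfaffian m (C * M * transpose_mat C) = det C * pfaffian m M"
proof -
  define N where "N = 2 * m"
  define G where "G = ({..<m} \<rightarrow>\<^sub>E {..<N} \<times> {..<N})"
  define h :: "(nat \<Rightarrow> nat \<times> nat) \<Rightarrow> nat \<Rightarrow> nat" where
    "h g r = (if even r then fst (g (r div 2)) else snd (g (r div 2)))" for g r
  define \<Delta> :: "(nat \<Rightarrow> nat \<times> nat) \<Rightarrow> complex mat" where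
    "\<Delta> g = mat N N (\<lambda>(k, j). if k = h g j then 1 else 0)" for g
  define E where "E = (\<Sum>g\<in>G. (\<Prod>i<m. M $$ g i) * det (\<Delta> g))"
  have main: "pfaffian m (D * M * transpose_mat D) = det D * E" if D: "D \<in> carrier_mat N N" for D
  proof -
    have M': "M \<in> carrier_mat N N" using M by (simp add: N_def)
    have entry: "(D * M * transpose_mat D) $$ (a, b) =
        (\<Sum>x\<in>{..<N} \<times> {..<N}. D $$ (a, fst x) * M $$ x * D $$ (b, snd x))"
      if "a < N" "b < N" for a b
    proof -
      have "(D * M * transpose_mat D) $$ (a, b) = (\<Sum>l<N. (D * M) $$ (a, l) * transpose_mat D $$ (l, b))"
        by (rule index_mult_sum) (use D M' that in auto)
      also have "\<dots> = (\<Sum>l<N. (\<Sum>k<N. D $$ (a, k) * M $$ (k, l)) * D $$ (b, l))"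
        by (intro sum.cong refl arg_cong2[where f = times] index_mult_sum[OF D M']) (use that D in auto)
      also have "\<dots> = (\<Sum>k<N. \<Sum>l<N. D $$ (a, k) * M $$ (k, l) * D $$ (b, l))"
        by (subst sum.swap) (simp add: sum_distrib_right)
      finally show ?thesis by (simp add: sum.cartesian_product case_prod_beta)
    qed
    have expand: "(\<Prod>i<m. (D * M * transpose_mat D) $$ (\<sigma> (2 * i), \<sigma> (2 * i + 1))) =
        (\<Sum>g\<in>G. (\<Prod>i<m. M $$ g i) * (\<Prod>r = 0..<N. D $$ (\<sigma> r, h g r)))"
      if "\<sigma> permutes {0..<N}" for \<sigma>
    proof -
      have lt: "\<sigma> r < N" if "r < N" for r
        using permutes_in_image[OF \<open>\<sigma> permutes {0..<N}\<close>] that by simp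
      have "(\<Prod>i<m. (D * M * transpose_mat D) $$ (\<sigma> (2 * i), \<sigma> (2 * i + 1))) =
          (\<Prod>i<m. \<Sum>x\<in>{..<N} \<times> {..<N}.
             D $$ (\<sigma> (2 * i), fst x) * M $$ x * D $$ (\<sigma> (2 * i + 1), snd x))"
        by (intro prod.cong refl entry lt) (auto simp: N_def)
      also have "\<dots> = (\<Sum>g\<in>G. \<Prod>i<m.
             D $$ (\<sigma> (2 * i), fst (g i)) * M $$ g i * D $$ (\<sigma> (2 * i + 1), snd (g i)))"
        unfolding G_def by (rule prod_sum_PiE) auto
      also have "\<dots> = (\<Sum>g\<in>G. (\<Prod>i<m. M $$ g i) * (\<Prod>r = 0..<N. D $$ (\<sigma> r, h g r)))"
        unfolding N_def by (subst prod_pairs) (simp add: h_def prod.distrib mult_ac)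
      finally show ?thesis .
    qed
    have det_h: "(\<Sum>\<sigma> | \<sigma> permutes {0..<N}. signof \<sigma> * (\<Prod>r = 0..<N. D $$ (\<sigma> r, h g r))) =
        det D * det (\<Delta> g)" if "g \<in> G" for g
    proof -
      have hlt: "h g r < N" if "r < N" for r
      proof -
        have "g (r div 2) \<in> {..<N} \<times> {..<N}"
          by (rule PiE_mem[OF \<open>g \<in> G\<close>[unfolded G_def]]) (use that in \<open>auto simp: N_def\<close>)
        then show ?thesis by (simp add: h_def mem_Times_iff)
      qed
      have car: "\<Delta> g \<in> carrier_mat N N" by (simp add: \<Delta>_def)
      have ent: "(D * \<Delta> g) $$ (a, j) = D $$ (a, h g j)" if "a < N" "j < N" for a j
      proof -
        have "(D * \<Delta> g) $$ (a, j) = (\<Sum>l<N. D $$ (a, l) * \<Delta> g $$ (l, j))"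
          by (rule index_mult_sum[OF D car that])
        also have "\<dots> = (\<Sum>l<N. if l = h g j then D $$ (a, l) else 0)"
          by (intro sum.cong) (use that in \<open>auto simp: \<Delta>_def\<close>)
        finally show ?thesis using hlt[OF that(2)] by simp
      qed
      have "det D * det (\<Delta> g) = det (D * \<Delta> g)" using det_mult[OF D car] by simp
      also have "\<dots> = (\<Sum>\<sigma> | \<sigma> permutes {0..<N}. signof \<sigma> * (\<Prod>r = 0..<N. (D * \<Delta> g) $$ (\<sigma> r, r)))"
        using det_col[of "D * \<Delta> g" N] D car by (simp add: atLeast0LessThan)
      also have "\<dots> = (\<Sum>\<sigma> | \<sigma> permutes {0..<N}. signof \<sigma> * (\<Prod>r = 0..<N. D $$ (\<sigma> r, h g r)))"
        by (intro sum.cong refl arg_cong2[where f = times] prod.cong ent) (auto simp: permutes_in_image)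
      finally show ?thesis by simp
    qed
    have "pfaffian m (D * M * transpose_mat D) = (\<Sum>\<sigma> | \<sigma> permutes {0..<N}.
        \<Sum>g\<in>G. (\<Prod>i<m. M $$ g i) * (signof \<sigma> * (\<Prod>r = 0..<N. D $$ (\<sigma> r, h g r))))"
      unfolding pfaffian_def N_def[symmetric]
      by (intro sum.cong refl) (simp only: mem_Collect_eq expand sum_distrib_left mult.left_commute)
    also have "\<dots> = (\<Sum>g\<in>G. (\<Prod>i<m. M $$ g i) *
        (\<Sum>\<sigma> | \<sigma> permutes {0..<N}. signof \<sigma> * (\<Prod>r = 0..<N. D $$ (\<sigma> r, h g r))))"
      by (subst sum.swap) (simp add: sum_distrib_left)
    also have "\<dots> = det D * E"
      unfolding E_def sum_distrib_left[of "det D"]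
      by (intro sum.cong refl) (simp only: det_h mult.left_commute)
    finally show ?thesis .
  qed
  have "pfaffian m M = E" using main[of "1\<^sub>m N"] M by (simp add: N_def)
  then show ?thesis using main[of C] C by (simp add: N_def)
qed

text \<open>
  The Gram matrix of hyperbolic pairs in the positions \<open>(0, 1), (2, 3), \<dots>\<close>.
\<close>

definition hyp_form :: "nat \<Rightarrow> nat \<Rightarrow> complex" where
  "hyp_form r c = (if even r \<and> c = r + 1 then 1 else if even c \<and> r = c + 1 then - 1 else 0)"

lemma hyp_form_swap: "hyp_form c r = - hyp_form r c"
  by (auto simp: hyp_form_def)

text \<open>
  If \<open>s\<close> exchanges \<open>2i\<close> with \<open>2i + 1\<close> and \<open>A\<close> is the effect on even numbers, then the effect on odd numbers is
  \<open>s A s\<close>, and the signs of \<open>A\<close> and of its conjugate cancel.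
\<close>

lemma sign_even_matching_perm:
  fixes m :: nat
  assumes perm: "\<sigma> permutes {0..<2 * m}"
    and ev: "\<And>i. i < m \<Longrightarrow> even (\<sigma> (2 * i)) \<and> \<sigma> (2 * i + 1) = \<sigma> (2 * i) + 1"
  shows "sign \<sigma> = 1"
proof -
  define s :: "nat \<Rightarrow> nat" where "s r = (if r < 2 * m then (if even r then r + 1 else r - 1) else r)" for r
  define A :: "nat \<Rightarrow> nat" where "A r = (if even r then \<sigma> r else r)" for r
  have ss: "s (s r) = r" for r unfolding s_def by (cases "r < 2 * m"; cases "even r") (simp_all, presburger+)
  have s_perm: "s permutes {0..<2 * m}"
  proof (rule bij_imp_permutes)
    have "s r < 2 * m" if "r < 2 * m" for r
      using that unfolding s_def by (simp; presburger)
    then show "bij_betw s {0..<2 * m} {0..<2 * m}"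
      by (intro bij_betw_byWitness[of _ s]) (auto simp: ss)
  qed (auto simp: s_def)
  have lt: "\<sigma> r < 2 * m" if "r < 2 * m" for r using permutes_in_image[OF perm] that by simp
  have out: "\<sigma> r = r" if "\<not> r < 2 * m" for r using permutes_not_in[OF perm, of r] that by simp
  have evA: "even (\<sigma> r)" if "even r" for r
    using ev[of "r div 2"] out[of r] that by (cases "r < 2 * m") auto
  have oddA: "\<sigma> r = \<sigma> (r - 1) + 1" if "odd r" "r < 2 * m" for r
    using ev[of "r div 2"] that by (auto elim!: oddE)
  have A_perm: "A permutes {0..<2 * m}"
  proof (rule bij_imp_permutes)
    have "inj_on A {0..<2 * m}"
    proof (rule inj_onI)
      fix x y assume "A x = A y"
      then show "x = y"
        using injD[OF permutes_inj[OF perm], of x y] evA[of x] evA[of y]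
        by (cases "even x"; cases "even y") (auto simp: A_def)
    qed
    moreover have "A ` {0..<2 * m} \<subseteq> {0..<2 * m}" using lt by (auto simp: A_def)
    ultimately show "bij_betw A {0..<2 * m} {0..<2 * m}"
      by (simp add: bij_betw_def endo_inj_surj)
  qed (auto simp: A_def out)
  have "\<sigma> = A \<circ> (s \<circ> A \<circ> s)"
  proof
    fix r
    show "\<sigma> r = (A \<circ> (s \<circ> A \<circ> s)) r"
    proof (cases "r < 2 * m")
      case False
      then show ?thesis by (simp add: s_def A_def out)
    next
      case r: True
      show ?thesis
      proof (cases "even r")
        case True
        then have "odd (s r)" using r by (simp add: s_def)
        then have "A (s r) = s r" by (simp add: A_def)
        then show ?thesis using True by (simp add: ss A_def)
      next
        case False
        then have "s r = r - 1" "even (r - 1)" using r by (auto simp: s_def)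
        then have "A (s r) = \<sigma> (r - 1)" "even (\<sigma> (r - 1))" by (auto simp: A_def evA)
        moreover have "\<sigma> (r - 1) < 2 * m" using lt r by simp
        ultimately have "s (A (s r)) = \<sigma> r" using oddA[OF False r] by (simp add: s_def)
        moreover have "odd (\<sigma> r)" using oddA[OF False r] \<open>even (\<sigma> (r - 1))\<close> by simp
        ultimately show ?thesis by (simp add: A_def)
      qed
    qed
  qed
  moreover have "permutation A" "permutation s"
    using A_perm s_perm by (auto intro: permutes_imp_permutation[rotated])
  ultimately have "sign \<sigma> = sign A * (sign s * sign A * sign s)"
    by (simp add: sign_compose permutation_compose)
  also have "\<dots> = 1" by (simp add: sign_def)
  finally show ?thesis .
qed

text \<open>
  Every pair that \<open>\<sigma>\<close> reverses changes the sign of \<open>\<sigma>\<close> and of one factor; undoing the reversals one at a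
  time leads to the preceding lemma.
\<close>

lemma sign_matching_perm:
  assumes "\<sigma> permutes {0..<2 * m}"
    and "\<And>i. i < m \<Longrightarrow> hyp_form (\<sigma> (2 * i)) (\<sigma> (2 * i + 1)) \<noteq> 0"
  shows "signof \<sigma> * (\<Prod>i<m. hyp_form (\<sigma> (2 * i)) (\<sigma> (2 * i + 1))) = 1"
  using assms
proof (induction "card {i. i < m \<and> odd (\<sigma> (2 * i))}" arbitrary: \<sigma>)
  case 0
  then have evn: "even (\<sigma> (2 * i))" if "i < m" for i using that by auto
  have *: "even (\<sigma> (2 * i)) \<and> \<sigma> (2 * i + 1) = \<sigma> (2 * i) + 1" if "i < m" for i
  proof -
    have "even (\<sigma> (2 * i))" by (rule evn) fact
    with 0(3)[OF \<open>i < m\<close>] show ?thesis by (auto simp: hyp_form_def split: if_splits)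
  qed
  have "sign \<sigma> = 1" by (rule sign_even_matching_perm[OF 0(2) *])
  moreover have "(\<Prod>i<m. hyp_form (\<sigma> (2 * i)) (\<sigma> (2 * i + 1))) = 1"
    by (intro prod.neutral) (use * in \<open>auto simp: hyp_form_def\<close>)
  ultimately show ?case by simp
next
  case (Suc k)
  have "{i. i < m \<and> odd (\<sigma> (2 * i))} \<noteq> {}" using Suc(2) by (metis card.empty nat.distinct(1))
  then obtain i where i: "i < m" "odd (\<sigma> (2 * i))" by auto
  define \<tau> where "\<tau> = \<sigma> \<circ> transpose (2 * i) (2 * i + 1)"
  have tr: "transpose (2 * i) (2 * i + 1) permutes {0..<2 * m}"
    using i by (intro permutes_swap_id) auto
  have \<tau>_perm: "\<tau> permutes {0..<2 * m}"
    unfolding \<tau>_def by (rule permutes_compose[OF tr Suc(3)])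
  have ti: "\<tau> (2 * i) = \<sigma> (2 * i + 1)" "\<tau> (2 * i + 1) = \<sigma> (2 * i)"
    by (simp_all add: \<tau>_def)
  have tj: "\<tau> (2 * j) = \<sigma> (2 * j)" "\<tau> (2 * j + 1) = \<sigma> (2 * j + 1)" if "j \<noteq> i" for j
    using that by (simp_all add: \<tau>_def transpose_def)
  have nz: "hyp_form (\<tau> (2 * j)) (\<tau> (2 * j + 1)) \<noteq> 0" if "j < m" for j
    using Suc(4)[OF that] ti tj hyp_form_swap by (cases "j = i") (metis neg_equal_0_iff_equal)+
  have "even (\<tau> (2 * i))" using Suc(4)[OF i(1)] i(2) ti by (auto simp: hyp_form_def split: if_splits)
  then have "{j. j < m \<and> odd (\<tau> (2 * j))} = {j. j < m \<and> odd (\<sigma> (2 * j))} - {i}"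
    using tj by (auto; metis)
  then have "card {j. j < m \<and> odd (\<tau> (2 * j))} = k" using Suc(2) i by simp
  from Suc(1)[OF this[symmetric] \<tau>_perm nz]
  have IH: "signof \<tau> * (\<Prod>i<m. hyp_form (\<tau> (2 * i)) (\<tau> (2 * i + 1))) = 1" by simp
  have "sign \<tau> = - sign \<sigma>"
    unfolding \<tau>_def using Suc(3)
    by (subst sign_compose) (auto simp: sign_swap_id permutation_swap_id intro: permutes_imp_permutation[rotated])
  then have "signof \<tau> = (- signof \<sigma> :: complex)" by simp
  moreover have "(\<Prod>i<m. hyp_form (\<tau> (2 * i)) (\<tau> (2 * i + 1))) =
      - (\<Prod>i<m. hyp_form (\<sigma> (2 * i)) (\<sigma> (2 * i + 1)))"
  proof -
    have "(\<Prod>i<m. hyp_form (\<tau> (2 * i)) (\<tau> (2 * i + 1))) =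
        hyp_form (\<tau> (2 * i)) (\<tau> (2 * i + 1)) * (\<Prod>i\<in>{..<m} - {i}. hyp_form (\<tau> (2 * i)) (\<tau> (2 * i + 1)))"
      using i by (subst prod.remove[of _ i]) auto
    also have "\<dots> = - (hyp_form (\<sigma> (2 * i)) (\<sigma> (2 * i + 1)) *
        (\<Prod>i\<in>{..<m} - {i}. hyp_form (\<sigma> (2 * i)) (\<sigma> (2 * i + 1))))"
      using ti tj hyp_form_swap[of "\<sigma> (2 * i)" "\<sigma> (2 * i + 1)"] by simp
    also have "\<dots> = - (\<Prod>i<m. hyp_form (\<sigma> (2 * i)) (\<sigma> (2 * i + 1)))"
      using i by (subst (2) prod.remove[of _ i]) auto
    finally show ?thesis .
  qed
  ultimately show ?case using IH by simp
qed

text \<open>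
  Every nonzero term of the sum equals 1, so there is no cancellation.
\<close>

lemma pfaffian_hyp_form_nonzero:
  assumes "\<And>r c. r < 2 * m \<Longrightarrow> c < 2 * m \<Longrightarrow> M $$ (r, c) = hyp_form r c"
  shows "pfaffian m M \<noteq> 0"
proof -
  let ?P = "{\<sigma>. \<sigma> permutes {0..<2 * m}}"
  let ?t = "\<lambda>\<sigma>. signof \<sigma> * (\<Prod>i<m. hyp_form (\<sigma> (2 * i)) (\<sigma> (2 * i + 1)))"
  let ?Q = "{\<sigma> \<in> ?P. ?t \<sigma> \<noteq> 0}"
  have fin: "finite ?P" by (simp add: finite_permutations)
  have one: "?t \<sigma> = 1" if "\<sigma> \<in> ?Q" for \<sigma>
    using that by (intro sign_matching_perm) auto
  have "pfaffian m M = (\<Sum>\<sigma>\<in>?P. ?t \<sigma>)"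
    unfolding pfaffian_def
    by (intro sum.cong refl arg_cong2[where f = times] prod.cong assms) (auto simp: permutes_in_image[of _ "{0..<2 * m}", simplified])
  also have "\<dots> = (\<Sum>\<sigma>\<in>?Q. ?t \<sigma>)"
    by (rule sum.mono_neutral_right) (use fin in auto)
  also have "\<dots> = of_nat (card ?Q)" using one by simp
  finally have "pfaffian m M = of_nat (card ?Q)" .
  moreover have "id \<in> ?Q" by (auto simp: permutes_id hyp_form_def)
  then have "card ?Q \<noteq> 0" using fin by (metis (no_types, lifting) card_0_eq empty_iff finite_subset mem_Collect_eq subsetI)
  ultimately show ?thesis by simp
qed

lemma pfaffian_zero_row:
  assumes M: "\<And>c. c < 2 * m \<Longrightarrow> M $$ (r, c) = 0 \<and> M $$ (c, r) = 0" and r: "r < 2 * m"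
  shows "pfaffian m M = 0"
  unfolding pfaffian_def
proof (intro sum.neutral ballI)
  fix \<sigma> assume "\<sigma> \<in> {\<sigma>. \<sigma> permutes {0..<2 * m}}"
  then have perm: "\<sigma> permutes {0..<2 * m}" by simp
  obtain q where q: "q < 2 * m" "\<sigma> q = r"
    using permutes_image[OF perm] r by (metis atLeastLessThan_iff imageE zero_le)
  let ?i = "q div 2"
  have i: "?i < m" using q by simp
  then have "\<sigma> (2 * ?i) < 2 * m" "\<sigma> (2 * ?i + 1) < 2 * m" using permutes_in_image[OF perm] by auto
  moreover have "q = 2 * ?i \<or> q = 2 * ?i + 1" by presburger
  ultimately have "M $$ (\<sigma> (2 * ?i), \<sigma> (2 * ?i + 1)) = 0" using M q(2) by auto
  then have "(\<Prod>i<m. M $$ (\<sigma> (2 * i), \<sigma> (2 * i + 1))) = 0" using i by (auto intro!: prod_zero)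
  then show "signof \<sigma> * (\<Prod>i<m. M $$ (\<sigma> (2 * i), \<sigma> (2 * i + 1))) = 0" by simp
qed

lemma pfaffian_poly_fun:
  assumes "\<And>r c. r < 2 * m \<Longrightarrow> c < 2 * m \<Longrightarrow> (\<lambda>A. M A $$ (r, c)) \<in> poly_funs N"
  shows "(\<lambda>A. pfaffian m (M A)) \<in> poly_funs N"
  unfolding pfaffian_def
  by (intro poly_funs_sum poly_funs_prod poly_funs.mult poly_funs.const assms)
    (auto simp: finite_permutations permutes_in_image[of _ "{0..<2 * m}", simplified])

section \<open>The symplectic group in the standard basis\<close>

definition jsgn :: "nat \<Rightarrow> nat \<Rightarrow> complex" where
  "jsgn n a = (if a < n then 1 else - 1)"

lemma bourbaki_form_carrier [simp]: "bourbaki_form n \<in> carrier_mat (2 * n) (2 * n)"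
  and bourbaki_form_dim [simp]: "dim_row (bourbaki_form n) = 2 * n" "dim_col (bourbaki_form n) = 2 * n"
  by (simp_all add: bourbaki_form_def)

lemma bourbaki_form_index:
  "i < 2 * n \<Longrightarrow> j < 2 * n \<Longrightarrow>
    bourbaki_form n $$ (i, j) = (if j = 2 * n - 1 - i then jsgn n i else 0)"
  by (auto simp: bourbaki_form_def jsgn_def)

lemma bourbaki_form_mult:
  assumes "A \<in> carrier_mat (2 * n) k" "r < 2 * n" "c < k"
  shows "(bourbaki_form n * A) $$ (r, c) = jsgn n r * A $$ (2 * n - 1 - r, c)"
proof -
  have "(bourbaki_form n * A) $$ (r, c) = (\<Sum>l<2 * n. bourbaki_form n $$ (r, l) * A $$ (l, c))"
    by (rule index_mult_sum) (use assms in auto)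
  also have "\<dots> = (\<Sum>l<2 * n. if l = 2 * n - 1 - r then jsgn n r * A $$ (2 * n - 1 - r, c) else 0)"
    by (intro sum.cong) (use assms in \<open>auto simp: bourbaki_form_index\<close>)
  finally show ?thesis using assms by simp
qed

lemma gram_index:
  assumes "A \<in> carrier_mat k (2 * n)" "r < k" "c < k"
  shows "(A * bourbaki_form n * transpose_mat A) $$ (r, c) =
    (\<Sum>a<2 * n. jsgn n a * A $$ (r, a) * A $$ (c, 2 * n - 1 - a))"
proof -
  have "A * bourbaki_form n * transpose_mat A = A * (bourbaki_form n * transpose_mat A)"
    by (rule assoc_mult_mat) (use assms in auto)
  also have "\<dots> $$ (r, c) = (\<Sum>a<2 * n. A $$ (r, a) * (bourbaki_form n * transpose_mat A) $$ (a, c))"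
    by (rule index_mult_sum) (use assms in auto)
  also have "\<dots> = (\<Sum>a<2 * n. A $$ (r, a) * (jsgn n a * transpose_mat A $$ (2 * n - 1 - a, c)))"
    by (intro sum.cong refl arg_cong2[where f = times] bourbaki_form_mult) (use assms in auto)
  also have "\<dots> = (\<Sum>a<2 * n. jsgn n a * A $$ (r, a) * A $$ (c, 2 * n - 1 - a))"
    by (intro sum.cong) (use assms in auto)
  finally show ?thesis .
qed

lemma bourbaki_form_square: "bourbaki_form n * bourbaki_form n = - 1\<^sub>m (2 * n)"
proof (rule eq_matI)
  fix i j assume "i < dim_row (- 1\<^sub>m (2 * n) :: complex mat)" "j < dim_col (- 1\<^sub>m (2 * n) :: complex mat)"
  then have ij: "i < 2 * n" "j < 2 * n" by auto
  have "(bourbaki_form n * bourbaki_form n) $$ (i, j) =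
      jsgn n i * bourbaki_form n $$ (2 * n - 1 - i, j)"
    by (rule bourbaki_form_mult) (use ij in auto)
  also have "\<dots> = (- 1\<^sub>m (2 * n)) $$ (i, j)"
    using ij by (auto simp: bourbaki_form_index jsgn_def)
  finally show "(bourbaki_form n * bourbaki_form n) $$ (i, j) = (- 1\<^sub>m (2 * n)) $$ (i, j)" .
qed auto

lemma det_bourbaki_form: "det (bourbaki_form n) \<noteq> 0"
proof -
  have "det (bourbaki_form n) * det (bourbaki_form n) = det (bourbaki_form n * bourbaki_form n)"
    by (rule det_mult[symmetric]) auto
  also have "bourbaki_form n * bourbaki_form n = (- 1) \<cdot>\<^sub>m 1\<^sub>m (2 * n)"
    unfolding bourbaki_form_square by (rule eq_matI) auto
  also have "det \<dots> \<noteq> (0 :: complex)" by (simp add: det_smult)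
  finally show ?thesis by auto
qed

definition std_Sp :: "nat \<Rightarrow> complex mat set" where
  "std_Sp n = {A \<in> carrier_mat (2 * n) (2 * n). A * bourbaki_form n * transpose_mat A = bourbaki_form n}"

lemma std_Sp_carrier: "A \<in> std_Sp n \<Longrightarrow> A \<in> carrier_mat (2 * n) (2 * n)"
  by (simp add: std_Sp_def)

lemma gram_mult:
  assumes "A \<in> carrier_mat k l" "B \<in> carrier_mat l N" "M \<in> carrier_mat N N"
  shows "(A * B) * M * transpose_mat (A * B) = A * (B * M * transpose_mat B) * (transpose_mat A :: complex mat)"
proof -
  have t: "transpose_mat A \<in> carrier_mat l k" "transpose_mat B \<in> carrier_mat N l" using assms by auto
  have BM: "B * M \<in> carrier_mat l N" using assms by auto
  have "transpose_mat (A * B) = transpose_mat B * transpose_mat A"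
    by (rule transpose_mult[OF assms(1,2)])
  then have "(A * B) * M * transpose_mat (A * B) = (A * B) * M * (transpose_mat B * transpose_mat A)" by simp
  also have "\<dots> = A * (B * M) * (transpose_mat B * transpose_mat A)"
    by (simp only: assoc_mult_mat[OF assms])
  also have "\<dots> = A * (B * M) * transpose_mat B * transpose_mat A"
    by (rule assoc_mult_mat[symmetric]) (use assms t BM in auto)
  also have "A * (B * M) * transpose_mat B = A * (B * M * transpose_mat B)"
    by (rule assoc_mult_mat[OF assms(1) BM t(2)])
  finally show ?thesis .
qed

lemma std_Sp_mult: "A \<in> std_Sp n \<Longrightarrow> B \<in> std_Sp n \<Longrightarrow> A * B \<in> std_Sp n"
  unfolding std_Sp_def using gram_mult[of A "2 * n" "2 * n" B "2 * n" "bourbaki_form n"] by auto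

lemma std_Sp_one: "1\<^sub>m (2 * n) \<in> std_Sp n"
  unfolding std_Sp_def by auto

lemma std_Sp_det_nonzero: "A \<in> std_Sp n \<Longrightarrow> det A \<noteq> 0"
proof
  assume A: "A \<in> std_Sp n" "det A = 0"
  note c = std_Sp_carrier[OF A(1)]
  have "det (A * bourbaki_form n * transpose_mat A) = det (A * bourbaki_form n) * det (transpose_mat A)"
    by (rule det_mult) (use c in auto)
  then have "det (bourbaki_form n) = 0"
    using A det_transpose[OF c] by (simp add: std_Sp_def)
  then show False using det_bourbaki_form by simp
qed

definition sp_inv :: "nat \<Rightarrow> complex mat \<Rightarrow> complex mat" where
  "sp_inv n A = - (bourbaki_form n * transpose_mat A * bourbaki_form n)"

lemma sp_inv_carrier: "A \<in> carrier_mat (2 * n) (2 * n) \<Longrightarrow> sp_inv n A \<in> carrier_mat (2 * n) (2 * n)"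
  unfolding sp_inv_def by (metis bourbaki_form_carrier mult_carrier_mat transpose_carrier_mat uminus_carrier_mat)

lemma sp_inv_right:
  assumes "A \<in> std_Sp n"
  shows "A * sp_inv n A = 1\<^sub>m (2 * n)"
proof -
  let ?J = "bourbaki_form n" and ?N = "2 * n"
  note c = std_Sp_carrier[OF assms]
  have t: "transpose_mat A \<in> carrier_mat ?N ?N" using c by simp
  have "A * sp_inv n A = - (A * (?J * transpose_mat A * ?J))"
    unfolding sp_inv_def by (rule uminus_mult_right_mat) (use c in auto)
  also have "A * (?J * transpose_mat A * ?J) = A * ?J * transpose_mat A * ?J"
    using c t by (simp add: assoc_mult_mat[of _ ?N ?N _ ?N _ ?N] mult_carrier_mat[of _ ?N ?N _ ?N])
  also have "\<dots> = ?J * ?J" using assms by (simp add: std_Sp_def)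
  also have "- \<dots> = 1\<^sub>m ?N" unfolding bourbaki_form_square by (rule eq_matI) auto
  finally show ?thesis .
qed

lemma std_Sp_left_inverse:
  assumes "A \<in> std_Sp n" "B \<in> carrier_mat (2 * n) (2 * n)" "A * B = 1\<^sub>m (2 * n)"
  shows "B \<in> std_Sp n"
proof -
  let ?J = "bourbaki_form n" and ?N = "2 * n"
  note c = std_Sp_carrier[OF assms(1)]
  have "B * A = 1\<^sub>m ?N" by (rule mat_mult_left_right_inverse[OF c assms(2,3)])
  have "B * ?J * transpose_mat B = B * (A * ?J * transpose_mat A) * transpose_mat B"
    using assms by (simp add: std_Sp_def)
  also have "\<dots> = (B * A) * ?J * transpose_mat (B * A)"
    by (rule gram_mult[symmetric]) (use c assms in auto)
  also have "\<dots> = ?J" unfolding \<open>B * A = 1\<^sub>m ?N\<close> by simp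
  finally show ?thesis using assms(2) by (simp add: std_Sp_def)
qed

lemma sp_inv_std_Sp: "A \<in> std_Sp n \<Longrightarrow> sp_inv n A \<in> std_Sp n"
  by (rule std_Sp_left_inverse[OF _ sp_inv_carrier[OF std_Sp_carrier] sp_inv_right])

text \<open>
  The hypothesis makes \<open>- J A\<^sup>T J\<close> a left inverse of \<open>A\<close>; it is then a right inverse too.
\<close>

lemma std_Sp_transpose:
  assumes "A \<in> carrier_mat (2 * n) (2 * n)" "transpose_mat A * bourbaki_form n * A = bourbaki_form n"
  shows "A \<in> std_Sp n"
proof -
  let ?J = "bourbaki_form n" and ?N = "2 * n"
  let ?Z = "A * ?J * transpose_mat A"
  note c = assms(1)
  have t: "transpose_mat A \<in> carrier_mat ?N ?N" using c by simp
  have J: "?J \<in> carrier_mat ?N ?N" by simp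
  have Y: "- (?J * transpose_mat A * ?J) \<in> carrier_mat ?N ?N" using c by auto
  have Z: "?Z \<in> carrier_mat ?N ?N" using c t by (meson J mult_carrier_mat)
  have "- (?J * transpose_mat A * ?J) * A = - (?J * transpose_mat A * ?J * A)"
    by (rule uminus_mult_left_mat) (use c in auto)
  also have "?J * transpose_mat A * ?J * A = ?J * (transpose_mat A * ?J * A)"
    using c t by (simp add: assoc_mult_mat[of _ ?N ?N _ ?N _ ?N] mult_carrier_mat[of _ ?N ?N _ ?N])
  also have "- \<dots> = 1\<^sub>m ?N" unfolding assms(2) bourbaki_form_square by (rule eq_matI) auto
  finally have "A * - (?J * transpose_mat A * ?J) = 1\<^sub>m ?N"
    by (rule mat_mult_left_right_inverse[OF Y c])
  moreover have "A * - (?J * transpose_mat A * ?J) = - (A * (?J * transpose_mat A * ?J))"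
    by (rule uminus_mult_right_mat) (use c in auto)
  moreover have "A * (?J * transpose_mat A * ?J) = ?Z * ?J"
    using c t by (simp add: assoc_mult_mat[of _ ?N ?N _ ?N _ ?N] mult_carrier_mat[of _ ?N ?N _ ?N])
  ultimately have "- (?Z * ?J) = 1\<^sub>m ?N" by simp
  then have ZJ: "?Z * ?J = - 1\<^sub>m ?N" by (metis uminus_uminus_mat)
  have "- (?Z * 1\<^sub>m ?N) = ?Z * - 1\<^sub>m ?N"
    by (rule uminus_mult_right_mat[symmetric]) (use c in auto)
  also have "\<dots> = ?Z * (?J * ?J)" unfolding bourbaki_form_square ..
  also have "\<dots> = (?Z * ?J) * ?J" by (rule assoc_mult_mat[OF Z J J, symmetric])
  also have "\<dots> = - (1\<^sub>m ?N * ?J)" unfolding ZJ by (rule uminus_mult_left_mat) auto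
  finally have "- (?Z * 1\<^sub>m ?N) = - (1\<^sub>m ?N * ?J)" .
  then have "- ?Z = - ?J" by (simp only: right_mult_one_mat[OF Z] left_mult_one_mat[OF J])
  then have "?Z = ?J" by (metis uminus_uminus_mat)
  then show ?thesis using c by (simp add: std_Sp_def)
qed

lemma transpose_std_Sp:
  assumes "A \<in> std_Sp n"
  shows "transpose_mat A \<in> std_Sp n"
  using std_Sp_transpose[of "transpose_mat A" n] assms by (auto simp: std_Sp_def)

lemma std_Sp_iff:
  "A \<in> std_Sp n \<longleftrightarrow> A \<in> carrier_mat (2 * n) (2 * n) \<and> transpose_mat A * bourbaki_form n * A = bourbaki_form n"
  using std_Sp_transpose[of A n] transpose_std_Sp[of A n] by (auto simp: std_Sp_def)

lemma std_Sp_rows: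
  assumes "A \<in> std_Sp n" "r < 2 * n" "c < 2 * n"
  shows "(\<Sum>a<2 * n. jsgn n a * A $$ (r, a) * A $$ (c, 2 * n - 1 - a)) =
    (if c = 2 * n - 1 - r then jsgn n r else 0)"
  using gram_index[OF std_Sp_carrier[OF assms(1)] assms(2,3)] bourbaki_form_index[OF assms(2,3)] assms(1)
  by (simp add: std_Sp_def)

lemma std_Sp_cols:
  assumes "A \<in> std_Sp n" "r < 2 * n" "c < 2 * n"
  shows "(\<Sum>a<2 * n. jsgn n a * A $$ (a, r) * A $$ (2 * n - 1 - a, c)) =
    (if c = 2 * n - 1 - r then jsgn n r else 0)"
proof -
  have "(\<Sum>a<2 * n. jsgn n a * A $$ (a, r) * A $$ (2 * n - 1 - a, c)) =
      (\<Sum>a<2 * n. jsgn n a * transpose_mat A $$ (r, a) * transpose_mat A $$ (c, 2 * n - 1 - a))"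
    by (intro sum.cong) (use assms std_Sp_carrier[OF assms(1)] in auto)
  then show ?thesis using std_Sp_rows[OF transpose_std_Sp[OF assms(1)] assms(2,3)] by simp
qed

lemma sp_inv_index:
  assumes "A \<in> carrier_mat (2 * n) (2 * n)" "r < 2 * n" "c < 2 * n"
  shows "sp_inv n A $$ (r, c) = - jsgn n r * jsgn n (2 * n - 1 - c) * A $$ (2 * n - 1 - c, 2 * n - 1 - r)"
proof -
  let ?J = "bourbaki_form n" and ?N = "2 * n"
  have t: "transpose_mat A \<in> carrier_mat ?N ?N" using assms by simp
  have "(transpose_mat A * ?J) $$ (2 * n - 1 - r, c) =
      (\<Sum>l<?N. transpose_mat A $$ (2 * n - 1 - r, l) * ?J $$ (l, c))"
    by (rule index_mult_sum[OF t bourbaki_form_carrier]) (use assms in auto)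
  also have "\<dots> = (\<Sum>l<?N. if l = 2 * n - 1 - c then A $$ (2 * n - 1 - c, 2 * n - 1 - r) * jsgn n (2 * n - 1 - c) else 0)"
    by (intro sum.cong) (use assms in \<open>auto simp: bourbaki_form_index\<close>)
  finally have "(transpose_mat A * ?J) $$ (2 * n - 1 - r, c) = A $$ (2 * n - 1 - c, 2 * n - 1 - r) * jsgn n (2 * n - 1 - c)"
    using assms by simp
  moreover have "(?J * (transpose_mat A * ?J)) $$ (r, c) = jsgn n r * (transpose_mat A * ?J) $$ (2 * n - 1 - r, c)"
    by (rule bourbaki_form_mult) (use assms t in auto)
  moreover have "?J * transpose_mat A * ?J = ?J * (transpose_mat A * ?J)"
    using t by (simp add: assoc_mult_mat[of _ ?N ?N _ ?N _ ?N] mult_carrier_mat[of _ ?N ?N _ ?N])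
  ultimately show ?thesis using assms unfolding sp_inv_def by simp
qed

section \<open>Generators of the stabiliser of a line\<close>

text \<open>
  For \<open>j < n\<close> this is the root subgroup of the simple root \<open>\<beta>\<^sub>j\<^sub>+\<^sub>1\<close>. The indices \<open>j \<ge> n\<close> describe the same
  matrices, with \<open>-s\<close> for \<open>s\<close>, seen from the mirrored rows (\<open>root_elt_reflect\<close>), so that "add \<open>s\<close> times row
  \<open>j + 1\<close> to row \<open>j\<close>" is available for all \<open>j\<close>.
\<close>

definition root_elt :: "nat \<Rightarrow> nat \<Rightarrow> complex \<Rightarrow> complex mat" where
  "root_elt n j s = mat (2 * n) (2 * n) (\<lambda>(r, c).
     (if r = c then 1 else if r = j \<and> c = j + 1 then s
      else if j \<noteq> n - 1 \<and> r = 2 * n - 2 - j \<and> c = 2 * n - 1 - j then - s else 0))"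

lemma root_elt_carrier [simp]: "root_elt n j s \<in> carrier_mat (2 * n) (2 * n)"
  by (simp add: root_elt_def)

lemma if_mult_distrib:
  fixes s x :: complex
  shows "(if P then s else 0) * x = (if P then s * x else 0)"
    and "(if P then - s else 0) * x = - (if P then s * x else 0)"
  by simp_all

lemma if_zero: "(P \<Longrightarrow> x = (0 :: complex)) \<Longrightarrow> (if P then x else 0) = 0"
  by simp

lemma root_elt_index:
  assumes "r < 2 * n" "l < 2 * n" "j < 2 * n - 1"
  shows "root_elt n j s $$ (r, l) = (if l = r then 1 else 0)
    + ((if l = j + 1 then (if r = j then s else 0) else 0)
    + (if l = 2 * n - 1 - j then (if j \<noteq> n - 1 \<and> r = 2 * n - 2 - j then - s else 0) else 0))"
proof -
  have split: "(if e then 1 else if P then s else if R then - s else 0) =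
      (if e then 1 else 0) + ((if P then s else 0) + (if R then - s else 0))"
    if "e \<Longrightarrow> \<not> P \<and> \<not> R" "P \<Longrightarrow> \<not> R" for e P R
    using that by auto
  have merge: "(if P then (if R then x else 0) else 0) = (if R \<and> P then x else 0)" for P R and x :: complex
    by simp
  have "root_elt n j s $$ (r, l) = (if l = r then 1 else if r = j \<and> l = j + 1 then s
      else if (j \<noteq> n - 1 \<and> r = 2 * n - 2 - j) \<and> l = 2 * n - 1 - j then - s else 0)"
    using assms by (simp add: root_elt_def eq_commute[of l r])
  also have "\<dots> = (if l = r then 1 else 0) + ((if r = j \<and> l = j + 1 then s else 0)
      + (if (j \<noteq> n - 1 \<and> r = 2 * n - 2 - j) \<and> l = 2 * n - 1 - j then - s else 0))"
    by (rule split) (use assms in linarith)+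
  finally show ?thesis by (simp only: merge)
qed

lemma root_elt_mult:
  assumes "A \<in> carrier_mat (2 * n) k" "r < 2 * n" "c < k" "j < 2 * n - 1"
  shows "(root_elt n j s * A) $$ (r, c) = A $$ (r, c) + (if r = j then s * A $$ (j + 1, c) else 0)
    - (if j \<noteq> n - 1 \<and> r = 2 * n - 2 - j then s * A $$ (2 * n - 1 - j, c) else 0)"
proof -
  have j: "j + 1 < 2 * n" "2 * n - 1 - j < 2 * n" using assms(4) by linarith+
  have "(root_elt n j s * A) $$ (r, c) = (\<Sum>l<2 * n. root_elt n j s $$ (r, l) * A $$ (l, c))"
    by (rule index_mult_sum) (use assms in auto)
  also have "\<dots> = (\<Sum>l<2 * n. (if l = r then A $$ (l, c) else 0)
      + ((if l = j + 1 then (if r = j then s else 0) * A $$ (l, c) else 0)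
      + (if l = 2 * n - 1 - j then (if j \<noteq> n - 1 \<and> r = 2 * n - 2 - j then - s else 0) * A $$ (l, c) else 0)))"
    by (intro sum.cong refl) (simp only: lessThan_iff root_elt_index[OF assms(2) _ assms(4)]
        distrib_right if_distrib[of "\<lambda>x. x * _"] mult_1 mult_zero_left cong: if_cong)
  also have "\<dots> = A $$ (r, c) + ((if r = j then s else 0) * A $$ (j + 1, c)
      + (if j \<noteq> n - 1 \<and> r = 2 * n - 2 - j then - s else 0) * A $$ (2 * n - 1 - j, c))"
    unfolding sum.distrib using assms(2) j by (simp only: sum.delta finite_lessThan lessThan_iff if_True)
  finally show ?thesis by (simp only: if_mult_distrib(2))
      (simp only: if_mult_distrib(1) add.assoc[symmetric] diff_conv_add_uminus)
qed

definition opp_root_elt :: "nat \<Rightarrow> nat \<Rightarrow> complex \<Rightarrow> complex mat" where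
  "opp_root_elt n j s = transpose_mat (root_elt n j s)"

lemma opp_root_elt_carrier [simp]: "opp_root_elt n j s \<in> carrier_mat (2 * n) (2 * n)"
  by (simp add: opp_root_elt_def)

lemma opp_root_elt_index:
  assumes "r < 2 * n" "l < 2 * n" "j < 2 * n - 1"
  shows "opp_root_elt n j s $$ (r, l) = (if l = r then 1 else 0)
    + ((if l = j then (if r = j + 1 then s else 0) else 0)
    + (if l = 2 * n - 2 - j then (if j \<noteq> n - 1 \<and> r = 2 * n - 1 - j then - s else 0) else 0))"
proof -
  have gen: "(if p then if q then s else 0 else 0) = (if q then if p then s else 0 else 0)"
    "(if p then if u \<and> q then - s else 0 else 0) = (if q then if u \<and> p then - s else 0 else 0)" for p q u
    by simp_all
  have "opp_root_elt n j s $$ (r, l) = root_elt n j s $$ (l, r)"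
    unfolding opp_root_elt_def by (rule index_transpose_mat(1))
      (simp_all only: root_elt_carrier[THEN carrier_matD(1)] root_elt_carrier[THEN carrier_matD(2)] assms)
  also have "\<dots> = (if r = l then 1 else 0) + ((if r = j + 1 then if l = j then s else 0 else 0) +
      (if r = 2 * n - 1 - j then if j \<noteq> n - 1 \<and> l = 2 * n - 2 - j then - s else 0 else 0))"
    by (rule root_elt_index[OF assms(2,1,3)])
  finally show ?thesis by (simp only: gen[of "r = _"] eq_commute[of r l])
qed

lemma opp_root_elt_mult:
  assumes "A \<in> carrier_mat (2 * n) k" "r < 2 * n" "c < k" "j < 2 * n - 1"
  shows "(opp_root_elt n j s * A) $$ (r, c) = A $$ (r, c) + (if r = j + 1 then s * A $$ (j, c) else 0)
    - (if j \<noteq> n - 1 \<and> r = 2 * n - 1 - j then s * A $$ (2 * n - 2 - j, c) else 0)"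
proof -
  have j: "j < 2 * n" "2 * n - 2 - j < 2 * n" using assms(4) by linarith+
  have "(opp_root_elt n j s * A) $$ (r, c) = (\<Sum>l<2 * n. opp_root_elt n j s $$ (r, l) * A $$ (l, c))"
    by (rule index_mult_sum) (use assms in auto)
  also have "\<dots> = (\<Sum>l<2 * n. (if l = r then A $$ (l, c) else 0)
      + ((if l = j then (if r = j + 1 then s else 0) * A $$ (l, c) else 0)
      + (if l = 2 * n - 2 - j then (if j \<noteq> n - 1 \<and> r = 2 * n - 1 - j then - s else 0) * A $$ (l, c) else 0)))"
    by (intro sum.cong refl) (simp only: lessThan_iff opp_root_elt_index[OF assms(2) _ assms(4)]
        distrib_right if_distrib[of "\<lambda>x. x * _"] mult_1 mult_zero_left cong: if_cong)
  also have "\<dots> = A $$ (r, c) + ((if r = j + 1 then s else 0) * A $$ (j, c)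
      + (if j \<noteq> n - 1 \<and> r = 2 * n - 1 - j then - s else 0) * A $$ (2 * n - 2 - j, c))"
    unfolding sum.distrib using assms(2) j by (simp only: sum.delta finite_lessThan lessThan_iff if_True)
  finally show ?thesis by (simp only: if_mult_distrib(2))
      (simp only: if_mult_distrib(1) add.assoc[symmetric] diff_conv_add_uminus)
qed

text \<open>
  Parity keeps the two off-diagonal entries apart: neither shares its row with the column of the other.
\<close>

lemma root_elt_unit_rows:
  assumes "j < 2 * n - 1" "c < 2 * n"
  shows "root_elt n j s $$ (j + 1, c) = (if c = j + 1 then 1 else 0)"
    and "root_elt n j s $$ (2 * n - 1 - j, c) = (if c = 2 * n - 1 - j then 1 else 0)"
    and "root_elt n j s $$ (c, j) = (if c = j then 1 else 0)"
    and "root_elt n j s $$ (c, 2 * n - 2 - j) = (if c = 2 * n - 2 - j then 1 else 0)"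
proof -
  have *: "j + 1 < 2 * n" "2 * n - 1 - j < 2 * n" "j < 2 * n" "2 * n - 2 - j < 2 * n"
    using assms by linarith+
  have **: "j + 1 \<noteq> j" "j + 1 \<noteq> 2 * n - 2 - j" "2 * n - 1 - j \<noteq> j" "2 * n - 1 - j \<noteq> 2 * n - 2 - j"
  proof -
    have eq: "2 * n = j + (2 * n - 2 - j) + 2" using assms by linarith
    then have "even (j + (2 * n - 2 - j))" by (metis dvd_triv_left even_add even_numeral)
    then show "j + 1 \<noteq> 2 * n - 2 - j" by (metis even_add even_plus_one_iff)
    have "even (j + (2 * n - 1 - j) + 1)" using assms by simp
    then show "2 * n - 1 - j \<noteq> j" by (metis even_add even_plus_one_iff)
  qed (use assms in linarith)+
  show "root_elt n j s $$ (j + 1, c) = (if c = j + 1 then 1 else 0)"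
    by (simp only: root_elt_index[OF *(1) assms(2,1)] ** if_False if_cancel simp_thms add_0_right)
  show "root_elt n j s $$ (2 * n - 1 - j, c) = (if c = 2 * n - 1 - j then 1 else 0)"
    by (simp only: root_elt_index[OF *(2) assms(2,1)] ** if_False if_cancel simp_thms add_0_right)
  show "root_elt n j s $$ (c, j) = (if c = j then 1 else 0)"
    by (simp only: root_elt_index[OF assms(2) *(3) assms(1)] ** **[symmetric] if_False if_cancel simp_thms add_0_right eq_commute[of j c])
  show "root_elt n j s $$ (c, 2 * n - 2 - j) = (if c = 2 * n - 2 - j then 1 else 0)"
    by (simp only: root_elt_index[OF assms(2) *(4) assms(1)] ** **[symmetric] if_False if_cancel simp_thms add_0_right eq_commute[of "2 * n - 2 - j" c])
qed

lemma root_elt_add: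
  assumes "j < 2 * n - 1"
  shows "root_elt n j s * root_elt n j t = root_elt n j (s + t)"
proof (rule eq_matI)
  fix r c assume "r < dim_row (root_elt n j (s + t))" "c < dim_col (root_elt n j (s + t))"
  then have rc: "r < 2 * n" "c < 2 * n" by (auto simp: root_elt_def)
  have gen: "(if e then 1 else 0) + ((if q then if p then t else 0 else 0) + (if v then if u then - t else 0 else 0))
      + (if p then s * (if q then 1 else 0) else 0) - (if u then s * (if v then 1 else 0) else 0) =
      (if e then 1 else 0) + ((if q then if p then s + t else 0 else 0) + (if v then if u then - (s + t) else 0 else 0))"
    for e p q u v
    by (cases e; cases p; cases q; cases u; cases v) simp_all
  show "(root_elt n j s * root_elt n j t) $$ (r, c) = root_elt n j (s + t) $$ (r, c)"
    unfolding root_elt_mult[OF root_elt_carrier rc assms] root_elt_unit_rows(1,2)[OF assms rc(2)]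
      root_elt_index[OF rc assms] by (rule gen)
qed (auto simp: root_elt_def)

lemma root_elt_reflect:
  assumes "j < 2 * n - 1" "j \<noteq> n - 1"
  shows "root_elt n j s = root_elt n (2 * n - 2 - j) (- s)"
proof (rule eq_matI)
  fix r c assume "r < dim_row (root_elt n (2 * n - 2 - j) (- s))" "c < dim_col (root_elt n (2 * n - 2 - j) (- s))"
  then have rc: "r < 2 * n" "c < 2 * n" by (auto simp: root_elt_def)
  have j': "2 * n - 2 - j < 2 * n - 1" "2 * n - 2 - j + 1 = 2 * n - 1 - j" "2 * n - 2 - (2 * n - 2 - j) = j"
    "2 * n - 1 - (2 * n - 2 - j) = j + 1" "2 * n - 2 - j \<noteq> n - 1"
    using assms by linarith+
  have gen: "e + ((if p then if q then s else 0 else 0) + (if v then if True \<and> u then - s else 0 else 0)) =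
      e + ((if v then if u then - s else 0 else 0) + (if p then if True \<and> q then - (- s) else 0 else 0))" for p q u v e
    by simp
  show "root_elt n j s $$ (r, c) = root_elt n (2 * n - 2 - j) (- s) $$ (r, c)"
    unfolding root_elt_index[OF rc assms(1)] root_elt_index[OF rc j'(1)] j' eqTrueI[OF assms(2)] eqTrueI[OF j'(5)]
    by (rule gen)
qed (auto simp: root_elt_def)

lemma root_elt_zero: "root_elt n j 0 = 1\<^sub>m (2 * n)"
  by (rule eq_matI) (auto simp: root_elt_def)

lemma opp_root_elt_zero: "opp_root_elt n j 0 = 1\<^sub>m (2 * n)"
  by (simp add: opp_root_elt_def root_elt_zero)

lemma opp_root_elt_add:
  assumes "j < 2 * n - 1"
  shows "opp_root_elt n j s * opp_root_elt n j t = opp_root_elt n j (s + t)"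
  unfolding opp_root_elt_def
  using transpose_mult[OF root_elt_carrier root_elt_carrier, of n j t j s] by (simp add: root_elt_add[OF assms] add.commute)

text \<open>
  The entry-wise content of the next lemma, with the conditions on indices replaced by truth values:
  \<open>rj\<close>, \<open>rm\<close>, \<open>cj\<close>, \<open>cm\<close> say that the row or column is one of the two mirrored indices, \<open>ne\<close> that these
  differ.
\<close>

lemma root_elt_cancel:
  fixes s w x y d :: complex
  assumes "rj \<Longrightarrow> ne \<Longrightarrow> w = y" "rm \<Longrightarrow> ne \<Longrightarrow> w = x" "rj \<Longrightarrow> \<not> ne \<Longrightarrow> y = - w"
    and "\<not> ne \<Longrightarrow> rm = rj" "\<not> ne \<Longrightarrow> cm = from_coords"
  shows "w * (d + ((if rm then if from_coords then s else 0 else 0) + (if rj then if ne \<and> cm then - s else 0 else 0)))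
    + (if rj then s * (y * (if cm then 1 else 0)) else 0)
    - (if ne \<and> rm then s * (x * (if from_coords then 1 else 0)) else 0) = w * d"
proof (cases ne)
  case True
  have "(if rm then s * (x * (if from_coords then 1 else 0)) else 0) = w * (if rm then if from_coords then s else 0 else 0)"
    using assms(2)[OF _ True] by (cases rm) simp_all
  moreover have "(if rj then s * (y * (if cm then 1 else 0)) else 0) = - (w * (if rj then if cm then - s else 0 else 0))"
    using assms(1)[OF _ True] by (cases rj) simp_all
  ultimately show ?thesis using True by (simp add: distrib_left)
next
  case False
  have "(if rj then s * (y * (if cm then 1 else 0)) else 0) = - (w * (if rj then if cm then s else 0 else 0))"
    using assms(3)[OF _ False] by (cases rj) simp_all
  then show ?thesis using False assms(4,5)[OF False] by (simp add: distrib_left)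
qed

lemma root_elt_std_Sp:
  assumes "j < 2 * n - 1"
  shows "root_elt n j s \<in> std_Sp n"
proof -
  let ?A = "root_elt n j s" and ?J = "bourbaki_form n"
  have "?A * ?J * transpose_mat ?A = ?A * (?J * transpose_mat ?A)"
    by (rule assoc_mult_mat[of _ "2 * n" "2 * n" _ "2 * n" _ "2 * n"]) simp_all
  also have "\<dots> = ?J"
  proof (rule eq_matI)
    fix r c assume "r < dim_row ?J" "c < dim_col ?J"
    then have rc: "r < 2 * n" "c < 2 * n" by auto
    have J: "(?J * transpose_mat ?A) $$ (k, c) = jsgn n k * ?A $$ (c, 2 * n - 1 - k)" if "k < 2 * n" for k
      using bourbaki_form_mult[of "transpose_mat ?A" n "2 * n" k c] that rc
      by (auto simp: root_elt_def)
    have C: "?J * transpose_mat ?A \<in> carrier_mat (2 * n) (2 * n)"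
      by (rule mult_carrier_mat) auto
    define m where "m = 2 * n - 2 - j"
    have m: "j + 1 < 2 * n" "m + 1 < 2 * n" "2 * n - 1 - j = m + 1" "2 * n - 1 - (j + 1) = m" "2 * n - 1 - (m + 1) = j"
      "j \<noteq> n - 1 \<longleftrightarrow> j \<noteq> m" "2 * n - 2 - j = m"
      using assms unfolding m_def by linarith+
    have r': "2 * n - 1 - r < 2 * n" "2 * n - 1 - r = j + 1 \<longleftrightarrow> r = m" "2 * n - 1 - r = m + 1 \<longleftrightarrow> r = j"
      using rc assms unfolding m_def by linarith+
    have "(?A * (?J * transpose_mat ?A)) $$ (r, c) = jsgn n r * ?A $$ (c, 2 * n - 1 - r)
        + (if r = j then s * (jsgn n (j + 1) * ?A $$ (c, m)) else 0)
        - (if j \<noteq> m \<and> r = m then s * (jsgn n (m + 1) * ?A $$ (c, j)) else 0)"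
      using root_elt_mult[OF C rc assms, of s] J[OF rc(1)] J[OF m(1)] J[OF m(2)]
      by (simp only: m)
    also have "\<dots> = jsgn n r * ((if 2 * n - 1 - r = c then 1 else 0)
        + ((if r = m then if c = j then s else 0 else 0) + (if r = j then if j \<noteq> m \<and> c = m then - s else 0 else 0)))
        + (if r = j then s * (jsgn n (j + 1) * (if c = m then 1 else 0)) else 0)
        - (if j \<noteq> m \<and> r = m then s * (jsgn n (m + 1) * (if c = j then 1 else 0)) else 0)"
      using root_elt_index[OF rc(2) r'(1) assms, of s] root_elt_unit_rows(3,4)[OF assms rc(2), of s]
      by (simp only: m r')
    also have "\<dots> = jsgn n r * (if 2 * n - 1 - r = c then 1 else 0)"
    proof (rule root_elt_cancel)
      have "2 * n = j + m + 2" using assms unfolding m_def by linarith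
      then have ne: "j + 1 \<noteq> n" "m + 1 \<noteq> n" if "j \<noteq> m" using that by linarith+
      show "jsgn n r = jsgn n (j + 1)" if "r = j" "j \<noteq> m"
        unfolding jsgn_def that(1) using ne[OF that(2)] by (intro if_cong refl) linarith
      show "jsgn n r = jsgn n (m + 1)" if "r = m" "j \<noteq> m"
        unfolding jsgn_def that(1) using ne[OF that(2)] by (intro if_cong refl) linarith
      show "jsgn n (j + 1) = - jsgn n r" if "r = j" "\<not> j \<noteq> m"
        using that m(6) m(1) by (simp add: jsgn_def)
    qed simp_all
    also have "\<dots> = ?J $$ (r, c)"
      unfolding bourbaki_form_index[OF rc] by (simp add: eq_commute[of _ c])
    finally show "(?A * (?J * transpose_mat ?A)) $$ (r, c) = ?J $$ (r, c)" .
  qed (auto simp: root_elt_def)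
  finally show ?thesis by (simp add: std_Sp_def)
qed

definition lower_tri :: "complex mat \<Rightarrow> bool" where
  "lower_tri A \<longleftrightarrow> (\<forall>c<dim_col A. \<forall>r<c. A $$ (r, c) = 0)"

lemma opp_root_elt_std_Sp: "j < 2 * n - 1 \<Longrightarrow> opp_root_elt n j s \<in> std_Sp n"
  unfolding opp_root_elt_def by (rule transpose_std_Sp[OF root_elt_std_Sp])

lemma opp_root_elt_lower: "lower_tri (opp_root_elt n j s)"
  by (auto simp: lower_tri_def opp_root_elt_def root_elt_def)

definition last_lower :: "nat \<Rightarrow> nat \<Rightarrow> complex mat \<Rightarrow> bool" where
  "last_lower n k A \<longleftrightarrow> (\<forall>c. 2 * n - k \<le> c \<longrightarrow> c < 2 * n \<longrightarrow> A $$ (c, c) \<noteq> 0 \<and> (\<forall>r<c. A $$ (r, c) = 0))"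

text \<open>
  Column \<open>c\<close> is orthogonal to the lower triangular column \<open>2n - 1 - r\<close>. Once the entries of column \<open>c\<close> above row
  \<open>r\<close> are known to vanish, only the entry in row \<open>r\<close> contributes to this product.
\<close>

lemma last_lower_top_zero:
  assumes A: "A \<in> std_Sp n" and low: "last_lower n k A" and k: "k \<le> n"
  shows "r < k \<Longrightarrow> r < c \<Longrightarrow> c < 2 * n \<Longrightarrow> A $$ (r, c) = 0"
proof (induction r arbitrary: c rule: less_induct)
  case (less r)
  let ?d = "2 * n - 1 - r"
  have d: "2 * n - k \<le> ?d" "?d < 2 * n" using less.prems k by auto
  have "(\<Sum>a<2 * n. jsgn n a * A $$ (a, c) * A $$ (2 * n - 1 - a, ?d)) =
      (\<Sum>a<2 * n. if a = r then jsgn n r * A $$ (r, c) * A $$ (?d, ?d) else 0)"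
  proof (intro sum.cong refl)
    fix a assume a: "a \<in> {..<2 * n}"
    show "jsgn n a * A $$ (a, c) * A $$ (2 * n - 1 - a, ?d) =
        (if a = r then jsgn n r * A $$ (r, c) * A $$ (?d, ?d) else 0)"
    proof (cases a r rule: linorder_cases)
      case less': less
      then have "A $$ (a, c) = 0" using less.IH[OF less', of c] less.prems by simp
      then show ?thesis using less' by simp
    next
      case greater
      then have "A $$ (2 * n - 1 - a, ?d) = 0"
        using low d less.prems a unfolding last_lower_def by auto
      then show ?thesis using greater by simp
    qed simp
  qed
  moreover have "(\<Sum>a<2 * n. jsgn n a * A $$ (a, c) * A $$ (2 * n - 1 - a, ?d)) = 0"
    using std_Sp_cols[OF A, of c ?d] less.prems d by auto
  ultimately have "jsgn n r * A $$ (r, c) * A $$ (?d, ?d) = 0"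
    using less.prems by simp
  moreover have "A $$ (?d, ?d) \<noteq> 0" using low d by (simp add: last_lower_def)
  ultimately show ?case by (simp add: jsgn_def split: if_splits)
qed

text \<open>
  Otherwise the columns \<open>k\<close> and \<open>2n - 1 - k\<close> would have disjoint mirrored supports and be orthogonal.
\<close>

lemma last_lower_pivot:
  assumes A: "A \<in> std_Sp n" and low: "last_lower n k A" and k: "k < n"
  shows "\<exists>r. k \<le> r \<and> r \<le> 2 * n - 1 - k \<and> A $$ (r, 2 * n - 1 - k) \<noteq> 0"
proof (rule ccontr)
  let ?c = "2 * n - 1 - k"
  assume no: "\<not> ?thesis"
  have zero: "A $$ (r, ?c) = 0" if "r \<le> ?c" for r
    using no last_lower_top_zero[OF A low, of r ?c] that k by (cases "r < k") auto
  have "(\<Sum>a<2 * n. jsgn n a * A $$ (a, k) * A $$ (2 * n - 1 - a, ?c)) = 0"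
  proof (intro sum.neutral ballI)
    fix a assume "a \<in> {..<2 * n}"
    then show "jsgn n a * A $$ (a, k) * A $$ (2 * n - 1 - a, ?c) = 0"
      using zero[of "2 * n - 1 - a"] last_lower_top_zero[OF A low, of a k] k by (cases "a < k") auto
  qed
  then show False using std_Sp_cols[OF A, of k ?c] k by (simp add: jsgn_def)
qed

text \<open>
  Column elimination from the right. In column \<open>2n - 1 - k\<close> the topmost nonzero entry is moved down one row at
  a time: the entry below it is made nonzero by a lower triangular root element, and then the root
  element of index \<open>j\<close> clears row \<open>j\<close>. Only rows from \<open>k\<close> to \<open>2n - 1 - k\<close> change, and there the columns treated before
  are zero. As \<open>k \<ge> 1\<close>, the first simple root is never used. After \<open>n\<close> columns the form forces
  the whole matrix to be lower triangular.
\<close>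

lemma std_Sp_generation:
  assumes low: "\<And>A. A \<in> std_Sp n \<Longrightarrow> lower_tri A \<Longrightarrow> A \<in> Q"
    and mult: "\<And>A B. A \<in> Q \<Longrightarrow> B \<in> Q \<Longrightarrow> A * B \<in> Q"
    and root: "\<And>j s. 1 \<le> j \<Longrightarrow> j < n \<Longrightarrow> root_elt n j s \<in> Q"
  shows "1 \<le> k \<Longrightarrow> k \<le> n \<Longrightarrow> A \<in> std_Sp n \<Longrightarrow> last_lower n k A \<Longrightarrow> A \<in> Q"
proof (induction "n - k" arbitrary: k A)
  case 0
  have "lower_tri A"
    unfolding lower_tri_def
  proof (intro allI impI)
    fix c r assume "c < dim_col A" "r < c"
    moreover have "dim_col A = 2 * n" using std_Sp_carrier[OF 0(4)] by simp
    ultimately show "A $$ (r, c) = 0"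
      using last_lower_top_zero[OF 0(4,5,3), of r c] 0 unfolding last_lower_def
      by (cases "r < n") auto
  qed
  then show ?case by (rule low[OF 0(4)])
next
  case (Suc d k A)
  then have k: "1 \<le> k" "k < n" by auto
  let ?c = "2 * n - 1 - k"
  have root': "root_elt n j s \<in> Q" if "k \<le> j" "j < ?c" for j s
  proof (cases "j < n")
    case True
    then show ?thesis using root[of j s] k that by simp
  next
    case False
    then have "root_elt n j s = root_elt n (2 * n - 2 - j) (- s)"
      by (intro root_elt_reflect) (use that k in linarith)+
    moreover have "1 \<le> 2 * n - 2 - j" "2 * n - 2 - j < n" using False that k by linarith+
    ultimately show ?thesis using root[of "2 * n - 2 - j" "- s"] by (simp only:)
  qed
  have "B \<in> Q" if "B \<in> std_Sp n" "last_lower n k B" "k \<le> j" "j \<le> ?c" "\<And>r. r < j \<Longrightarrow> B $$ (r, ?c) = 0" for B j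
    using that
  proof (induction "?c - j" arbitrary: j B)
    case 0
    then have j: "j = ?c" by simp
    have "B $$ (?c, ?c) \<noteq> 0"
      using last_lower_pivot[OF 0(2,3) k(2)] 0(6) j by (metis le_neq_implies_less)
    have "last_lower n (Suc k) B"
      unfolding last_lower_def
    proof (intro allI impI)
      fix c assume c: "2 * n - Suc k \<le> c" "c < 2 * n"
      show "B $$ (c, c) \<noteq> 0 \<and> (\<forall>r<c. B $$ (r, c) = 0)"
      proof (cases "c = ?c")
        case True
        then show ?thesis using \<open>B $$ (?c, ?c) \<noteq> 0\<close> 0(6) j by simp
      next
        case False
        then have "2 * n - k \<le> c" using c by linarith
        then show ?thesis using 0(3) c(2) by (simp add: last_lower_def)
      qed
    qed
    then show ?case using Suc(1)[of "Suc k" B] Suc(2) k 0(2) by auto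
  next
    case (Suc e j B)
    then have j: "j < ?c" by simp
    have Bc: "B \<in> carrier_mat (2 * n) (2 * n)" by (rule std_Sp_carrier[OF Suc(3)])
    have j': "j < 2 * n - 1" using j by simp
    have dd: "B $$ (r, c) = 0" if "2 * n - k \<le> c" "c < 2 * n" "r < c" for r c
      using Suc(4) that by (simp add: last_lower_def)
    have nz: "C \<in> Q" if C: "C \<in> std_Sp n" "last_lower n k C" "\<And>r. r < j \<Longrightarrow> C $$ (r, ?c) = 0"
      "C $$ (j + 1, ?c) \<noteq> 0" for C
    proof -
      have Cc: "C \<in> carrier_mat (2 * n) (2 * n)" by (rule std_Sp_carrier[OF C(1)])
      define t where "t = - C $$ (j, ?c) / C $$ (j + 1, ?c)"
      let ?D = "root_elt n j t * C"
      have ent: "?D $$ (r, c) = C $$ (r, c) + (if r = j then t * C $$ (j + 1, c) else 0)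
          - (if j \<noteq> n - 1 \<and> r = 2 * n - 2 - j then t * C $$ (2 * n - 1 - j, c) else 0)"
        if "r < 2 * n" "c < 2 * n" for r c
        by (rule root_elt_mult[OF Cc that j'])
      have cz: "C $$ (r, c) = 0" if "2 * n - k \<le> c" "c < 2 * n" "r < c" for r c
        using C(2) that by (simp add: last_lower_def)
      have "?D \<in> std_Sp n" by (rule std_Sp_mult[OF root_elt_std_Sp[OF j'] C(1)])
      moreover have "last_lower n k ?D"
        unfolding last_lower_def
      proof (intro allI impI conjI)
        fix c assume c: "2 * n - k \<le> c" "c < 2 * n"
        have 1: "C $$ (j + 1, c) = 0" "C $$ (2 * n - 1 - j, c) = 0"
          by (rule cz; use c j k Suc(5) in linarith)+
        have eq: "?D $$ (r, c) = C $$ (r, c)" if "r < 2 * n" for r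
          by (simp only: ent[OF that c(2)] 1 mult_zero_right if_cancel add_0_right diff_zero)
        show "?D $$ (c, c) \<noteq> 0" using C(2) c unfolding eq[OF c(2)] last_lower_def by blast
        show "?D $$ (r, c) = 0" if "r < c" for r
          using eq[of r] cz[OF c that] that c by (simp only: less_trans[of r c "2 * n"])
      qed
      moreover have "?D $$ (r, ?c) = 0" if "r < Suc j" for r
      proof (cases "r = j")
        case True
        have "j = n - 1" if "j = 2 * n - 2 - j" using that j' by linarith
        then have no: "(j \<noteq> n - 1 \<and> j = 2 * n - 2 - j) = False" by blast
        have "?D $$ (j, ?c) = C $$ (j, ?c) + t * C $$ (j + 1, ?c)"
          using ent[of j ?c] j k by (simp only: no if_False if_True refl diff_zero)
        then show ?thesis using C(4) True by (simp add: t_def)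
      next
        case False
        then have r: "r < j" using that by simp
        have "C $$ (2 * n - 1 - j, ?c) = 0" if "r = 2 * n - 2 - j"
        proof (rule C(3))
          have "n \<le> j" using that r by linarith
          then show "2 * n - 1 - j < j" using j' by linarith
        qed
        then have z: "(if j \<noteq> n - 1 \<and> r = 2 * n - 2 - j then t * C $$ (2 * n - 1 - j, ?c) else 0) = 0"
          by (intro if_zero) (simp only: mult_zero_right)
        have "r < 2 * n" "?c < 2 * n" using r j' k by linarith+
        from ent[OF this] show ?thesis
          by (simp only: z False C(3)[OF r] if_False add_0_right diff_zero)
      qed
      ultimately have "?D \<in> Q"
        by (intro Suc(1)[of "Suc j"]) (use Suc(2,5) j in auto)
      then have "root_elt n j (- t) * ?D \<in> Q" by (rule mult[OF root'[OF Suc(5) j]])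
      also have "root_elt n j (- t) * ?D = (root_elt n j (- t) * root_elt n j t) * C"
        by (rule assoc_mult_mat[symmetric, of _ "2 * n" "2 * n" _ "2 * n" _ "2 * n"]) (use Cc in simp_all)
      also have "\<dots> = C" using Cc by (simp add: root_elt_add[OF j'] root_elt_zero)
      finally show ?thesis .
    qed
    show ?case
    proof (cases "B $$ (j + 1, ?c) = 0")
      case False
      show ?thesis by (rule nz[OF Suc(3,4,7) False])
    next
      case True
      show ?thesis
      proof (cases "B $$ (j, ?c) = 0")
        case True
        show ?thesis
        proof (rule Suc(1)[OF _ Suc(3,4)])
          show "e = ?c - Suc j" using Suc(2) by simp
          show "k \<le> Suc j" "Suc j \<le> ?c" using Suc(5) j by auto
          show "B $$ (r, ?c) = 0" if "r < Suc j" for r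
            using Suc(7)[of r] True that by (cases "r = j") auto
        qed
      next
        case False
        let ?D = "opp_root_elt n j 1 * B"
        have ent: "?D $$ (r, c) = B $$ (r, c) + (if r = j + 1 then 1 * B $$ (j, c) else 0)
            - (if j \<noteq> n - 1 \<and> r = 2 * n - 1 - j then 1 * B $$ (2 * n - 2 - j, c) else 0)"
          if "r < 2 * n" "c < 2 * n" for r c
          by (rule opp_root_elt_mult[OF Bc that j'])
        have "?D \<in> Q"
        proof (rule nz)
          show "?D \<in> std_Sp n" by (rule std_Sp_mult[OF opp_root_elt_std_Sp[OF j'] Suc(3)])
          show "last_lower n k ?D"
            unfolding last_lower_def
          proof (intro allI impI conjI)
            fix c assume c: "2 * n - k \<le> c" "c < 2 * n"
            have 1: "B $$ (j, c) = 0" "B $$ (2 * n - 2 - j, c) = 0"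
              by (rule dd; use c j k Suc(5) in linarith)+
            have eq: "?D $$ (r, c) = B $$ (r, c)" if "r < 2 * n" for r
              by (simp only: ent[OF that c(2)] 1 mult_zero_right if_cancel add_0_right diff_zero)
            show "?D $$ (c, c) \<noteq> 0" using Suc(4) c unfolding eq[OF c(2)] last_lower_def by blast
            show "?D $$ (r, c) = 0" if "r < c" for r
              using eq[of r] dd[OF c that] that c by (simp only: less_trans[of r c "2 * n"])
          qed
          show "?D $$ (r, ?c) = 0" if "r < j" for r
          proof -
            have "B $$ (2 * n - 2 - j, ?c) = 0" if "r = 2 * n - 1 - j"
              by (rule Suc(7)) (use that \<open>r < j\<close> j' in linarith)
            then have z: "(if j \<noteq> n - 1 \<and> r = 2 * n - 1 - j then 1 * B $$ (2 * n - 2 - j, ?c) else 0) = 0"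
              by (intro if_zero) (simp only: mult_1)
            have "r < 2 * n" "?c < 2 * n" "r \<noteq> j + 1" using that j' k by linarith+
            from ent[OF this(1,2)] this(3) Suc(7)[OF that] show ?thesis
              by (simp only: z if_False add_0_right diff_zero)
          qed
          have "j = n - 1" if "j + 1 = 2 * n - 1 - j" using that j' by linarith
        then have no: "(j \<noteq> n - 1 \<and> j + 1 = 2 * n - 1 - j) = False" by blast
          have "j + 1 < 2 * n" "?c < 2 * n" using j' k by linarith+
          from ent[OF this] have "?D $$ (j + 1, ?c) = B $$ (j + 1, ?c) + B $$ (j, ?c)"
            by (simp only: no if_False if_True refl diff_zero mult_1)
          then show "?D $$ (j + 1, ?c) \<noteq> 0" using True False by simp
        qed
        then have "opp_root_elt n j (- 1) * ?D \<in> Q"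
          by (rule mult[OF low[OF opp_root_elt_std_Sp[OF j'] opp_root_elt_lower]])
        also have "opp_root_elt n j (- 1) * ?D = (opp_root_elt n j (- 1) * opp_root_elt n j 1) * B"
          by (rule assoc_mult_mat[symmetric, of _ "2 * n" "2 * n" _ "2 * n" _ "2 * n"]) (use Bc in simp_all)
        also have "\<dots> = B" using Bc by (simp add: opp_root_elt_add[OF j'] opp_root_elt_zero)
        finally show ?thesis .
      qed
    qed
  qed
  from this[OF Suc(5,6), of k] show ?case
    using last_lower_top_zero[OF Suc(5,6)] k by auto
qed

definition line_stab :: "nat \<Rightarrow> complex mat set" where
  "line_stab n = {A \<in> std_Sp n. \<forall>r<2 * n - 1. A $$ (r, 2 * n - 1) = 0}"

lemma line_stab_last_nonzero:
  assumes "A \<in> line_stab n" "0 < n"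
  shows "A $$ (2 * n - 1, 2 * n - 1) \<noteq> 0"
proof
  assume 0: "A $$ (2 * n - 1, 2 * n - 1) = 0"
  have "A $$ (r, 2 * n - 1) = 0" if "r < 2 * n" for r
    using assms(1) 0 that by (cases "r = 2 * n - 1") (auto simp: line_stab_def)
  then have "(\<Sum>a<2 * n. jsgn n a * A $$ (a, 0) * A $$ (2 * n - 1 - a, 2 * n - 1)) = 0"
    by (intro sum.neutral) auto
  then show False
    using std_Sp_cols[of A n 0 "2 * n - 1"] assms by (simp add: line_stab_def jsgn_def)
qed

lemma line_stab_generation:
  assumes "0 < n" "\<And>A. A \<in> std_Sp n \<Longrightarrow> lower_tri A \<Longrightarrow> A \<in> Q"
    and "\<And>A B. A \<in> Q \<Longrightarrow> B \<in> Q \<Longrightarrow> A * B \<in> Q"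
    and "\<And>j s. 1 \<le> j \<Longrightarrow> j < n \<Longrightarrow> root_elt n j s \<in> Q"
  shows "line_stab n \<subseteq> Q"
proof
  fix A assume A: "A \<in> line_stab n"
  have "last_lower n 1 A"
    unfolding last_lower_def
  proof (intro allI impI)
    fix c assume "2 * n - 1 \<le> c" "c < 2 * n"
    then have "c = 2 * n - 1" by simp
    then show "A $$ (c, c) \<noteq> 0 \<and> (\<forall>r<c. A $$ (r, c) = 0)"
      using A line_stab_last_nonzero[OF A assms(1)] by (simp add: line_stab_def)
  qed
  then show "A \<in> Q"
    using std_Sp_generation[OF assms(2-4), of 1 A] A assms(1) by (simp add: line_stab_def)
qed

section \<open>The Pfaffian semi-invariants\<close>

text \<open>
  The form \<open>J\<close> on the row vectors of \<open>g\<close>.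
\<close>

definition row_form :: "nat \<Rightarrow> complex mat \<Rightarrow> nat \<Rightarrow> nat \<Rightarrow> complex" where
  "row_form n g r c = (\<Sum>a<2 * n. jsgn n a * g $$ (r, a) * g $$ (c, 2 * n - 1 - a))"

lemma row_form_swap: "row_form n g c r = - row_form n g r c"
proof -
  have "row_form n g c r = (\<Sum>a<2 * n. jsgn n (2 * n - 1 - a) * g $$ (c, 2 * n - 1 - a) * g $$ (r, 2 * n - 1 - (2 * n - 1 - a)))"
    unfolding row_form_def
    by (rule sum.reindex_bij_witness[of _ "\<lambda>a. 2 * n - 1 - a" "\<lambda>a. 2 * n - 1 - a"]) auto
  also have "\<dots> = (\<Sum>a<2 * n. - (jsgn n a * g $$ (r, a) * g $$ (c, 2 * n - 1 - a)))"
  proof (intro sum.cong refl)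
    fix a assume "a \<in> {..<2 * n}"
    then have "jsgn n (2 * n - 1 - a) = - jsgn n a" "2 * n - 1 - (2 * n - 1 - a) = a"
      by (auto simp: jsgn_def)
    then show "jsgn n (2 * n - 1 - a) * g $$ (c, 2 * n - 1 - a) * g $$ (r, 2 * n - 1 - (2 * n - 1 - a))
        = - (jsgn n a * g $$ (r, a) * g $$ (c, 2 * n - 1 - a))"
      by (simp only:) simp
  qed
  finally show ?thesis by (simp add: row_form_def sum_negf)
qed

lemma row_form_self: "row_form n g r r = 0"
  using row_form_swap[of n g r r] by simp

text \<open>
  The last \<open>k\<close> rows; if \<open>k\<close> is odd, one row \<open>e\<^sub>0\<close> is appended, the vector that represents the last coordinate as a
  linear form. The parabolic subgroup preserves its line.
\<close>

definition bottom :: "nat \<Rightarrow> nat \<Rightarrow> complex mat \<Rightarrow> complex mat" where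
  "bottom n k g = mat (2 * ((k + 1) div 2)) (2 * n)
     (\<lambda>(a, c). if a < k then g $$ (2 * n - k + a, c) else if c = 0 then 1 else 0)"

lemma bottom_carrier [simp]: "bottom n k g \<in> carrier_mat (2 * ((k + 1) div 2)) (2 * n)"
  by (simp add: bottom_def)

text \<open>
  The semi-invariants whose weights generate the monoid, for \<open>0 < k < 2n\<close>; the weights are computed in
  \<open>corner_pfaffian_upper\<close> and \<open>corner_pfaffian_line_stab\<close>.
\<close>

definition corner_pfaffian :: "nat \<Rightarrow> nat \<Rightarrow> complex mat \<Rightarrow> complex" where
  "corner_pfaffian n k g = pfaffian ((k + 1) div 2) (bottom n k g * bourbaki_form n * transpose_mat (bottom n k g))"

lemma gram_carrier: "bottom n k g * bourbaki_form n * transpose_mat (bottom n k g)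
    \<in> carrier_mat (2 * ((k + 1) div 2)) (2 * ((k + 1) div 2))"
  by (meson bottom_carrier bourbaki_form_carrier mult_carrier_mat transpose_carrier_mat)

lemma gram_bottom:
  assumes n: "0 < n" and k: "k \<le> 2 * n" and a: "a < 2 * ((k + 1) div 2)" and d: "d < 2 * ((k + 1) div 2)"
  shows "(bottom n k g * bourbaki_form n * transpose_mat (bottom n k g)) $$ (a, d) =
    (if a < k then if d < k then row_form n g (2 * n - k + a) (2 * n - k + d) else - g $$ (2 * n - k + a, 2 * n - 1)
     else if d < k then g $$ (2 * n - k + d, 2 * n - 1) else 0)"
proof -
  have ent: "bottom n k g $$ (a, c) = (if a < k then g $$ (2 * n - k + a, c) else if c = 0 then 1 else 0)"
    if "a < 2 * ((k + 1) div 2)" "c < 2 * n" for a c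
    using that by (simp add: bottom_def)
  have e: "(bottom n k g * bourbaki_form n * transpose_mat (bottom n k g)) $$ (a, d) =
      (\<Sum>x<2 * n. jsgn n x * bottom n k g $$ (a, x) * bottom n k g $$ (d, 2 * n - 1 - x))"
    by (rule gram_index[OF bottom_carrier a d])
  have last: "2 * n - 1 - x = 0 \<longleftrightarrow> x = 2 * n - 1" if "x < 2 * n" for x using that by linarith
  have lt: "2 * n - 1 - x < 2 * n" for x using n by linarith
  consider "a < k" "d < k" | "a < k" "\<not> d < k" | "\<not> a < k" "d < k" | "\<not> a < k" "\<not> d < k" by blast
  then show ?thesis
  proof cases
    case 1
    have "(\<Sum>x<2 * n. jsgn n x * bottom n k g $$ (a, x) * bottom n k g $$ (d, 2 * n - 1 - x)) =
        row_form n g (2 * n - k + a) (2 * n - k + d)"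
      unfolding row_form_def by (intro sum.cong refl) (simp only: lessThan_iff ent[OF a] ent[OF d lt] 1 if_True)
    then show ?thesis using 1 e by simp
  next
    case 2
    have "(\<Sum>x<2 * n. jsgn n x * bottom n k g $$ (a, x) * bottom n k g $$ (d, 2 * n - 1 - x)) =
        (\<Sum>x<2 * n. if x = 2 * n - 1 then - g $$ (2 * n - k + a, 2 * n - 1) else 0)"
    proof (intro sum.cong refl)
      fix x assume "x \<in> {..<2 * n}"
      then have x: "x < 2 * n" by simp
      show "jsgn n x * bottom n k g $$ (a, x) * bottom n k g $$ (d, 2 * n - 1 - x) =
          (if x = 2 * n - 1 then - g $$ (2 * n - k + a, 2 * n - 1) else 0)"
        unfolding ent[OF a x] ent[OF d lt] last[OF x] using 2 n by (auto simp: jsgn_def)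
    qed
    also have "\<dots> = - g $$ (2 * n - k + a, 2 * n - 1)" using n by simp
    finally show ?thesis using 2 e by simp
  next
    case 3
    have "(\<Sum>x<2 * n. jsgn n x * bottom n k g $$ (a, x) * bottom n k g $$ (d, 2 * n - 1 - x)) =
        (\<Sum>x<2 * n. if x = 0 then g $$ (2 * n - k + d, 2 * n - 1) else 0)"
    proof (intro sum.cong refl)
      fix x assume "x \<in> {..<2 * n}"
      then have x: "x < 2 * n" by simp
      show "jsgn n x * bottom n k g $$ (a, x) * bottom n k g $$ (d, 2 * n - 1 - x) =
          (if x = 0 then g $$ (2 * n - k + d, 2 * n - 1) else 0)"
        unfolding ent[OF a x] ent[OF d lt] using 3 n by (auto simp: jsgn_def)
    qed
    also have "\<dots> = g $$ (2 * n - k + d, 2 * n - 1)" using n by simp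
    finally show ?thesis using 3 e by simp
  next
    case 4
    have "(\<Sum>x<2 * n. jsgn n x * bottom n k g $$ (a, x) * bottom n k g $$ (d, 2 * n - 1 - x)) = 0"
    proof (intro sum.neutral ballI)
      fix x assume "x \<in> {..<2 * n}"
      then have x: "x < 2 * n" by simp
      show "jsgn n x * bottom n k g $$ (a, x) * bottom n k g $$ (d, 2 * n - 1 - x) = 0"
        unfolding ent[OF a x] ent[OF d lt] last[OF x] using 4 n by auto
    qed
    then show ?thesis using 4 e by simp
  qed
qed

lemma corner_pfaffian_poly_fun:
  assumes "0 < n" "k \<le> 2 * n"
  shows "corner_pfaffian n k \<in> poly_funs (2 * n)"
  unfolding corner_pfaffian_def
proof (rule pfaffian_poly_fun)
  fix r c assume r: "r < 2 * ((k + 1) div 2)" and c: "c < 2 * ((k + 1) div 2)"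
  let ?F = "\<lambda>g. (bottom n k g * bourbaki_form n * transpose_mat (bottom n k g)) $$ (r, c)"
  have lt: "2 * n - k + x < 2 * n" if "x < k" for x using that assms by linarith
  have gfp: "(\<lambda>g. row_form n g i j) \<in> poly_funs (2 * n)" if "i < 2 * n" "j < 2 * n" for i j
    unfolding row_form_def using that
    by (intro poly_funs_sum poly_funs.mult poly_funs.const poly_funs.entry) auto
  have neg: "(\<lambda>g. - g $$ (i, j)) \<in> poly_funs (2 * n)" if "i < 2 * n" "j < 2 * n" for i j
    using poly_funs.mult[OF poly_funs.const poly_funs.entry[OF that], of "- 1"] by simp
  have l: "2 * n - 1 < 2 * n" using assms by simp
  show "?F \<in> poly_funs (2 * n)"
    unfolding gram_bottom[OF assms r c]
    by (cases "r < k"; cases "c < k")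
      (simp_all only: if_True if_False gfp[OF lt lt] neg[OF lt l] poly_funs.entry[OF lt l] poly_funs.const)
qed

text \<open>
  Used by contraposition: where the semi-invariants do not vanish, the Gram-Schmidt reduction below
  never meets a zero pivot.
\<close>

lemma corner_pfaffian_zero:
  assumes n: "0 < n" and k: "Suc k \<le> 2 * n"
    and orth: "\<And>c. 2 * n - Suc k < c \<Longrightarrow> c < 2 * n \<Longrightarrow> row_form n g (2 * n - Suc k) c = 0"
    and l: "even k \<Longrightarrow> g $$ (2 * n - Suc k, 2 * n - 1) = 0"
  shows "corner_pfaffian n (Suc k) g = 0"
  unfolding corner_pfaffian_def
proof (rule pfaffian_zero_row[of _ _ 0])
  let ?m = "(Suc k + 1) div 2"
  show m: "0 < 2 * ?m" by simp
  fix c assume c: "c < 2 * ?m"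
  have z: "row_form n g (2 * n - Suc k + 0) (2 * n - Suc k + c) = 0" if "c < Suc k"
  proof (cases "c = 0")
    case False
    then have "2 * n - Suc k < 2 * n - Suc k + c" "2 * n - Suc k + c < 2 * n" using that k by linarith+
    from orth[OF this] show ?thesis by (simp only: add_0_right)
  qed (simp add: row_form_self)
  then have z': "row_form n g (2 * n - Suc k + c) (2 * n - Suc k + 0) = 0" if "c < Suc k"
    using row_form_swap[of n g "2 * n - Suc k + c" "2 * n - Suc k + 0"] that by simp
  have l': "g $$ (2 * n - Suc k + 0, 2 * n - 1) = 0" if "\<not> c < Suc k"
  proof -
    have "even k" using c that by presburger
    then show ?thesis using l by simp
  qed
  show "(bottom n (Suc k) g * bourbaki_form n * transpose_mat (bottom n (Suc k) g)) $$ (0, c) = 0 \<and>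
      (bottom n (Suc k) g * bourbaki_form n * transpose_mat (bottom n (Suc k) g)) $$ (c, 0) = 0"
    unfolding gram_bottom[OF n k m c] gram_bottom[OF n k c m]
    by (cases "c < Suc k") (simp_all only: z z' l' if_True if_False zero_less_Suc minus_zero simp_thms)
qed

lemma det_triangular:
  assumes "A \<in> carrier_mat k k" "upper_triangular A"
  shows "det A = (\<Prod>i<k. A $$ (i, i) :: complex)"
proof -
  have "det A = prod_list (diag_mat A)" by (rule det_upper_triangular[OF assms(2,1)])
  also have "\<dots> = (\<Prod>i<k. A $$ (i, i))"
    using assms(1) by (simp add: prod_list_diag_prod atLeast0LessThan)
  finally show ?thesis .
qed

text \<open>
  Passing from \<open>g\<close> to \<open>b g\<close> multiplies the last \<open>k\<close> rows by the lower right corner of \<open>b\<close>.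
\<close>

lemma corner_pfaffian_upper:
  assumes n: "0 < n" and k: "k \<le> 2 * n" and b: "b \<in> carrier_mat (2 * n) (2 * n)" "upper_triangular b"
    and g: "g \<in> carrier_mat (2 * n) (2 * n)"
  shows "corner_pfaffian n k (b * g) = (\<Prod>r\<in>{2 * n - k..<2 * n}. b $$ (r, r)) * corner_pfaffian n k g"
proof -
  let ?m = "(k + 1) div 2"
  define R where "R = 2 * n - k"
  have R: "R + k = 2 * n" using k by (simp add: R_def)
  define C where "C = mat (2 * ?m) (2 * ?m) (\<lambda>(a, d). if a < k \<and> d < k then b $$ (R + a, R + d)
    else if a = d then 1 else 0)"
  have C: "C \<in> carrier_mat (2 * ?m) (2 * ?m)" by (simp add: C_def)
  have km: "k \<le> 2 * ?m" by presburger
  have lt: "R + a < 2 * n" if "a < k" for a using that R by linarith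
  have up: "upper_triangular C"
    using upper_triangularD[OF b(2)] lt b(1) by (auto simp: C_def)
  have "bottom n k (b * g) = C * bottom n k g"
  proof (rule eq_matI)
    fix a c assume "a < dim_row (C * bottom n k g)" "c < dim_col (C * bottom n k g)"
    then have a: "a < 2 * ?m" and c: "c < 2 * n" by (auto simp: C_def bottom_def)
    have "(C * bottom n k g) $$ (a, c) = (\<Sum>d<2 * ?m. C $$ (a, d) * bottom n k g $$ (d, c))"
      by (rule index_mult_sum[OF C bottom_carrier a c])
    also have "\<dots> = bottom n k (b * g) $$ (a, c)"
    proof (cases "a < k")
      case True
      have "(\<Sum>d<2 * ?m. C $$ (a, d) * bottom n k g $$ (d, c)) = (\<Sum>d<k. C $$ (a, d) * bottom n k g $$ (d, c))"
        using km a True by (intro sum.mono_neutral_right) (auto simp: C_def)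
      also have "\<dots> = (\<Sum>d<k. b $$ (R + a, R + d) * g $$ (R + d, c))"
        using km a c True by (intro sum.cong) (auto simp: C_def bottom_def R_def)
      also have "\<dots> = (\<Sum>l\<in>{R..<2 * n}. b $$ (R + a, l) * g $$ (l, c))"
        by (rule sum.reindex_bij_witness[of _ "\<lambda>l. l - R" "\<lambda>d. R + d"]) (use R in auto)
      also have "\<dots> = (\<Sum>l<2 * n. b $$ (R + a, l) * g $$ (l, c))"
        using upper_triangularD[OF b(2), of _ "R + a"] lt[OF True] b(1)
        by (intro sum.mono_neutral_left) auto
      also have "\<dots> = (b * g) $$ (R + a, c)"
        by (rule index_mult_sum[symmetric, OF b(1) g lt[OF True] c])
      finally show ?thesis using a c True by (simp add: bottom_def R_def)
    next
      case False
      have "(\<Sum>d<2 * ?m. C $$ (a, d) * bottom n k g $$ (d, c)) = (\<Sum>d<2 * ?m. if d = a then bottom n k g $$ (a, c) else 0)"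
        using a False by (intro sum.cong) (auto simp: C_def)
      then show ?thesis using a c False by (simp add: bottom_def)
    qed
    finally show "bottom n k (b * g) $$ (a, c) = (C * bottom n k g) $$ (a, c)" by simp
  qed (auto simp: bottom_def C_def)
  then have "corner_pfaffian n k (b * g) = pfaffian ?m (C * (bottom n k g * bourbaki_form n * transpose_mat (bottom n k g)) * transpose_mat C)"
    unfolding corner_pfaffian_def by (simp add: gram_mult[OF C bottom_carrier bourbaki_form_carrier])
  also have "\<dots> = det C * corner_pfaffian n k g" unfolding corner_pfaffian_def by (rule pfaffian_congruence[OF C gram_carrier])
  also have "det C = (\<Prod>i<2 * ?m. C $$ (i, i))" by (rule det_triangular[OF C up])
  also have "\<dots> = (\<Prod>i<k. C $$ (i, i))"
    using km by (intro prod.mono_neutral_right) (auto simp: C_def)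
  also have "\<dots> = (\<Prod>i<k. b $$ (R + i, R + i))"
    using km by (intro prod.cong) (auto simp: C_def)
  also have "\<dots> = (\<Prod>r\<in>{R..<2 * n}. b $$ (r, r))"
    by (rule prod.reindex_bij_witness[of _ "\<lambda>l. l - R" "\<lambda>d. R + d"]) (use R in auto)
  finally show ?thesis by (simp add: R_def)
qed

text \<open>
  The last column of \<open>p\<close> is a multiple of the last coordinate vector; pair it with the other columns.
\<close>

lemma line_stab_first_row:
  assumes p: "p \<in> line_stab n" and n: "0 < n" and c: "c < 2 * n"
  shows "p $$ (2 * n - 1, 2 * n - 1) * p $$ (0, c) = (if c = 0 then 1 else 0)"
proof -
  have S: "p \<in> std_Sp n" using p by (simp add: line_stab_def)
  have "(\<Sum>a<2 * n. jsgn n a * p $$ (a, 2 * n - 1) * p $$ (2 * n - 1 - a, c)) =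
      (\<Sum>a<2 * n. if a = 2 * n - 1 then - (p $$ (2 * n - 1, 2 * n - 1) * p $$ (0, c)) else 0)"
  proof (intro sum.cong refl)
    fix a assume "a \<in> {..<2 * n}"
    then show "jsgn n a * p $$ (a, 2 * n - 1) * p $$ (2 * n - 1 - a, c) =
        (if a = 2 * n - 1 then - (p $$ (2 * n - 1, 2 * n - 1) * p $$ (0, c)) else 0)"
      using p n by (cases "a = 2 * n - 1") (auto simp: line_stab_def jsgn_def)
  qed
  also have "\<dots> = - (p $$ (2 * n - 1, 2 * n - 1) * p $$ (0, c))" using n by simp
  finally have "- (p $$ (2 * n - 1, 2 * n - 1) * p $$ (0, c)) =
      (if c = 2 * n - 1 - (2 * n - 1) then jsgn n (2 * n - 1) else 0)"
    using std_Sp_cols[OF S, of "2 * n - 1" c] n c by simp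
  also have "jsgn n (2 * n - 1) = - 1" unfolding jsgn_def using n by (intro if_not_P) linarith
  finally show ?thesis by (auto simp: neg_equal_iff_equal minus_equation_iff split: if_splits)
qed

text \<open>
  The form is preserved, and \<open>e\<^sub>0 p\<close> is \<open>e\<^sub>0\<close> divided by the last entry of \<open>p\<close>.
\<close>

lemma corner_pfaffian_line_stab:
  assumes n: "0 < n" and k: "k \<le> 2 * n" and p: "p \<in> line_stab n"
    and g: "g \<in> carrier_mat (2 * n) (2 * n)"
  shows "corner_pfaffian n k (g * p) = (if even k then 1 else p $$ (2 * n - 1, 2 * n - 1)) * corner_pfaffian n k g"
proof -
  let ?m = "(k + 1) div 2" and ?c = "p $$ (2 * n - 1, 2 * n - 1)"
  have S: "p \<in> std_Sp n" using p by (simp add: line_stab_def)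
  note pc = std_Sp_carrier[OF S]
  define C where "C = mat (2 * ?m) (2 * ?m) (\<lambda>(a, d). if a = d then if a < k then 1 else ?c else 0)"
  have C: "C \<in> carrier_mat (2 * ?m) (2 * ?m)" by (simp add: C_def)
  have km: "k \<le> 2 * ?m" by presburger
  have up: "upper_triangular C" by (auto simp: C_def)
  have bp: "bottom n k g * p \<in> carrier_mat (2 * ?m) (2 * n)" by (rule mult_carrier_mat[OF bottom_carrier pc])
  have "bottom n k (g * p) = C * (bottom n k g * p)"
  proof (rule eq_matI)
    fix a c assume "a < dim_row (C * (bottom n k g * p))" "c < dim_col (C * (bottom n k g * p))"
    then have a: "a < 2 * ?m" and c: "c < 2 * n" using pc by (auto simp: C_def bottom_def)
    have "(C * (bottom n k g * p)) $$ (a, c) = (\<Sum>d<2 * ?m. C $$ (a, d) * (bottom n k g * p) $$ (d, c))"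
      by (rule index_mult_sum[OF C bp a c])
    also have "\<dots> = (\<Sum>d<2 * ?m. if d = a then (if a < k then 1 else ?c) * (bottom n k g * p) $$ (a, c) else 0)"
      using a by (intro sum.cong) (auto simp: C_def)
    also have "\<dots> = (if a < k then 1 else ?c) * (bottom n k g * p) $$ (a, c)" using a by simp
    also have "(bottom n k g * p) $$ (a, c) = (\<Sum>l<2 * n. bottom n k g $$ (a, l) * p $$ (l, c))"
      by (rule index_mult_sum[OF bottom_carrier pc a c])
    also have "(if a < k then 1 else ?c) * \<dots> = bottom n k (g * p) $$ (a, c)"
    proof (cases "a < k")
      case True
      then have lt: "2 * n - k + a < 2 * n" using k by linarith
      have "(\<Sum>l<2 * n. bottom n k g $$ (a, l) * p $$ (l, c)) = (\<Sum>l<2 * n. g $$ (2 * n - k + a, l) * p $$ (l, c))"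
        using a True by (intro sum.cong) (auto simp: bottom_def)
      also have "\<dots> = (g * p) $$ (2 * n - k + a, c)" by (rule index_mult_sum[symmetric, OF g pc lt c])
      finally show ?thesis using True a c by (simp add: bottom_def)
    next
      case False
      have "(\<Sum>l<2 * n. bottom n k g $$ (a, l) * p $$ (l, c)) = (\<Sum>l<2 * n. if l = 0 then p $$ (0, c) else 0)"
        using a False by (intro sum.cong) (auto simp: bottom_def)
      then show ?thesis using False a c line_stab_first_row[OF p n c] n by (simp add: bottom_def)
    qed
    finally show "bottom n k (g * p) $$ (a, c) = (C * (bottom n k g * p)) $$ (a, c)" by simp
  qed (use pc in \<open>auto simp: bottom_def C_def\<close>)
  then have "corner_pfaffian n k (g * p) = pfaffian ?m (C * (bottom n k g * (p * bourbaki_form n * transpose_mat p) * transpose_mat (bottom n k g)) * transpose_mat C)"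
    unfolding corner_pfaffian_def by (simp add: gram_mult[OF C bp bourbaki_form_carrier] gram_mult[OF bottom_carrier pc bourbaki_form_carrier])
  also have "\<dots> = pfaffian ?m (C * (bottom n k g * bourbaki_form n * transpose_mat (bottom n k g)) * transpose_mat C)"
    using S by (simp add: std_Sp_def)
  also have "\<dots> = det C * corner_pfaffian n k g" unfolding corner_pfaffian_def by (rule pfaffian_congruence[OF C gram_carrier])
  also have "det C = (\<Prod>i<2 * ?m. C $$ (i, i))" by (rule det_triangular[OF C up])
  also have "\<dots> = (\<Prod>i\<in>{k..<2 * ?m}. C $$ (i, i))"
    by (intro prod.mono_neutral_right) (auto simp: C_def)
  also have "\<dots> = (\<Prod>i\<in>{k..<2 * ?m}. ?c)"
    by (intro prod.cong) (auto simp: C_def)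
  also have "\<dots> = (if even k then 1 else ?c)" by (auto elim!: evenE oddE)
  finally show ?thesis .
qed

section \<open>Symplectic Gram-Schmidt reduction\<close>

definition upper_inv :: "nat \<Rightarrow> complex mat \<Rightarrow> bool" where
  "upper_inv N b \<longleftrightarrow> b \<in> carrier_mat N N \<and> upper_triangular b \<and> (\<forall>i<N. b $$ (i, i) \<noteq> 0)"

lemma upper_mult:
  assumes a: "a \<in> carrier_mat N N" "upper_triangular a" and b: "b \<in> carrier_mat N N" "upper_triangular b"
  shows "upper_triangular (a * b)"
    and "i < N \<Longrightarrow> (a * b) $$ (i, i) = a $$ (i, i) * (b $$ (i, i) :: complex)"
proof -
  have e: "(a * b) $$ (i, j) = (\<Sum>l<N. a $$ (i, l) * b $$ (l, j))" if "i < N" "j < N" for i j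
    by (rule index_mult_sum[OF a(1) b(1) that])
  have za: "a $$ (i, l) = 0" if "l < i" "i < N" for i l using upper_triangularD[OF a(2) that(1)] that a(1) by simp
  have zb: "b $$ (i, l) = 0" if "l < i" "i < N" for i l using upper_triangularD[OF b(2) that(1)] that b(1) by simp
  show "upper_triangular (a * b)"
  proof (rule upper_triangularI)
    fix i j assume ij: "j < i" "i < dim_row (a * b)"
    then have i: "i < N" "j < N" using a by auto
    have "(\<Sum>l<N. a $$ (i, l) * b $$ (l, j)) = 0"
    proof (intro sum.neutral ballI)
      fix l assume "l \<in> {..<N}"
      then show "a $$ (i, l) * b $$ (l, j) = 0"
        using za[of l i] zb[of j l] ij i by (cases "l < i") auto
    qed
    then show "(a * b) $$ (i, j) = 0" using e[OF i] by simp
  qed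
  show "(a * b) $$ (i, i) = a $$ (i, i) * b $$ (i, i)" if i: "i < N"
  proof -
    have "(\<Sum>l<N. a $$ (i, l) * b $$ (l, i)) = (\<Sum>l<N. if l = i then a $$ (i, i) * b $$ (i, i) else 0)"
    proof (intro sum.cong refl)
      fix l assume "l \<in> {..<N}"
      then show "a $$ (i, l) * b $$ (l, i) = (if l = i then a $$ (i, i) * b $$ (i, i) else 0)"
        using za[of l i] zb[of i l] i by (cases l i rule: linorder_cases) auto
    qed
    then show ?thesis using e[OF i i] i by simp
  qed
qed

lemma upper_inv_mult: "upper_inv N a \<Longrightarrow> upper_inv N b \<Longrightarrow> upper_inv N (a * b)"
  unfolding upper_inv_def using upper_mult[of a N b] by auto

lemma upper_inv_one: "upper_inv N (1\<^sub>m N)"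
  by (auto simp: upper_inv_def)

definition rowop :: "nat \<Rightarrow> nat \<Rightarrow> (nat \<Rightarrow> complex) \<Rightarrow> complex mat" where
  "rowop N r y = mat N N (\<lambda>(i, j). if i = r then if j < r then 0 else y j else if i = j then 1 else 0)"

lemma rowop_upper_inv: "y r \<noteq> 0 \<Longrightarrow> upper_inv N (rowop N r y)"
  by (auto simp: upper_inv_def rowop_def)

lemma rowop_mult:
  assumes "h \<in> carrier_mat N N" "i < N" "c < N" "r < N"
  shows "(rowop N r y * h) $$ (i, c) = (if i = r then \<Sum>j\<in>{r..<N}. y j * h $$ (j, c) else h $$ (i, c))"
proof -
  have "(rowop N r y * h) $$ (i, c) = (\<Sum>l<N. rowop N r y $$ (i, l) * h $$ (l, c))"
    by (rule index_mult_sum[of _ N]) (use assms in \<open>auto simp: rowop_def\<close>)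
  also have "\<dots> = (if i = r then \<Sum>j\<in>{r..<N}. y j * h $$ (j, c) else h $$ (i, c))"
  proof (cases "i = r")
    case True
    have "(\<Sum>l<N. rowop N r y $$ (i, l) * h $$ (l, c)) = (\<Sum>l\<in>{r..<N}. rowop N r y $$ (i, l) * h $$ (l, c))"
      using True assms by (intro sum.mono_neutral_right) (auto simp: rowop_def)
    also have "\<dots> = (\<Sum>j\<in>{r..<N}. y j * h $$ (j, c))"
      using True assms by (intro sum.cong) (auto simp: rowop_def)
    finally show ?thesis using True by simp
  next
    case False
    have "(\<Sum>l<N. rowop N r y $$ (i, l) * h $$ (l, c)) = (\<Sum>l<N. if l = i then h $$ (i, c) else 0)"
      using False assms by (intro sum.cong) (auto simp: rowop_def)
    then show ?thesis using False assms by simp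
  qed
  finally show ?thesis .
qed

lemma row_form_rowop:
  assumes h: "h \<in> carrier_mat (2 * n) (2 * n)" and r: "r < 2 * n" and d: "d < 2 * n" "d \<noteq> r"
  shows "row_form n (rowop (2 * n) r y * h) r d = (\<Sum>j\<in>{r..<2 * n}. y j * row_form n h j d)"
    and "e < 2 * n \<Longrightarrow> e \<noteq> r \<Longrightarrow> row_form n (rowop (2 * n) r y * h) e d = row_form n h e d"
proof -
  have "row_form n (rowop (2 * n) r y * h) r d =
      (\<Sum>a<2 * n. jsgn n a * (\<Sum>j\<in>{r..<2 * n}. y j * h $$ (j, a)) * h $$ (d, 2 * n - 1 - a))"
    unfolding row_form_def using rowop_mult[OF h _ _ r, of _ _ y] r d by (intro sum.cong refl) simp
  also have "\<dots> = (\<Sum>a<2 * n. \<Sum>j\<in>{r..<2 * n}. y j * (jsgn n a * h $$ (j, a) * h $$ (d, 2 * n - 1 - a)))"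
    by (simp add: sum_distrib_left sum_distrib_right mult_ac)
  also have "\<dots> = (\<Sum>j\<in>{r..<2 * n}. y j * row_form n h j d)"
    unfolding row_form_def sum_distrib_left by (rule sum.swap)
  finally show "row_form n (rowop (2 * n) r y * h) r d = (\<Sum>j\<in>{r..<2 * n}. y j * row_form n h j d)" .
  show "row_form n (rowop (2 * n) r y * h) e d = row_form n h e d" if "e < 2 * n" "e \<noteq> r"
    unfolding row_form_def using rowop_mult[OF h _ _ r, of _ _ y] d that by (intro sum.cong refl) simp
qed

text \<open>
  The normal form, for the rows from \<open>R\<close> on, of a flag of row vectors with respect to the symplectic form and
  the last coordinate.
\<close>

definition normalized :: "nat \<Rightarrow> nat \<Rightarrow> complex mat \<Rightarrow> bool" where
  "normalized n R h \<longleftrightarrow> h \<in> carrier_mat (2 * n) (2 * n) \<and>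
     (\<forall>r c. R \<le> r \<longrightarrow> r < 2 * n \<longrightarrow> R \<le> c \<longrightarrow> c < 2 * n \<longrightarrow> row_form n h r c = hyp_form r c) \<and>
     (\<forall>r. R \<le> r \<longrightarrow> r < 2 * n \<longrightarrow> h $$ (r, 2 * n - 1) = (if odd r then 1 else 0))"

lemma normalizedI:
  assumes h: "h \<in> carrier_mat (2 * n) (2 * n)" and nh: "normalized n (Suc r) h0"
    and r: "r < 2 * n"
    and same: "\<And>e c. e < 2 * n \<Longrightarrow> e \<noteq> r \<Longrightarrow> c < 2 * n \<Longrightarrow> h $$ (e, c) = h0 $$ (e, c)"
    and row: "\<And>d. r < d \<Longrightarrow> d < 2 * n \<Longrightarrow> row_form n h r d = hyp_form r d"
    and l: "h $$ (r, 2 * n - 1) = (if odd r then 1 else 0)"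
  shows "normalized n r h"
  unfolding normalized_def
proof (intro conjI allI impI h)
  have g0: "row_form n h e d = row_form n h0 e d" if "e < 2 * n" "e \<noteq> r" "d < 2 * n" "d \<noteq> r" for e d
    unfolding row_form_def using same that by (intro sum.cong refl) simp
  fix e d assume e: "r \<le> e" "e < 2 * n" and d: "r \<le> d" "d < 2 * n"
  show "row_form n h e d = hyp_form e d"
  proof (cases "e = r"; cases "d = r")
    assume "e \<noteq> r" "d \<noteq> r"
    then show ?thesis using g0[OF e(2) _ d(2)] nh e d unfolding normalized_def by (simp add: Suc_le_eq)
  next
    assume "e = r" "d \<noteq> r"
    then show ?thesis using row[of d] d by simp
  next
    assume "e \<noteq> r" "d = r"
    then show ?thesis using row[of e] e row_form_swap[of n h e r] hyp_form_swap[of e r] by simp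
  next
    assume "e = r" "d = r"
    then show ?thesis by (simp add: row_form_self hyp_form_def)
  qed
next
  fix e assume e: "r \<le> e" "e < 2 * n"
  then show "h $$ (e, 2 * n - 1) = (if odd e then 1 else 0)"
    using l same[of e "2 * n - 1"] nh r by (cases "e = r") (auto simp: normalized_def)
qed

text \<open>
  Subtract from row \<open>r\<close> its components along the complete pairs below. For odd \<open>r\<close> the last coordinate, for
  even \<open>r\<close> the product with row \<open>r + 1\<close>, is then nonzero, since the semi-invariant is, and can be scaled to 1.
  For even \<open>r\<close> a multiple of row \<open>r + 1\<close> moreover clears the last coordinate.
\<close>

lemma gram_schmidt_step:
  assumes n: "0 < n" and r: "r < 2 * n" and nh: "normalized n (Suc r) h" and pfaffian: "corner_pfaffian n (2 * n - r) h \<noteq> 0"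
  shows "\<exists>b. upper_inv (2 * n) b \<and> normalized n r (b * h)"
proof -
  let ?N = "2 * n"
  have h: "h \<in> carrier_mat ?N ?N" using nh by (simp add: normalized_def)
  have hyp: "row_form n h c d = hyp_form c d" if "r < c" "c < ?N" "r < d" "d < ?N" for c d
    using nh that by (simp add: normalized_def)
  have hl: "h $$ (c, ?N - 1) = (if odd c then 1 else 0)" if "r < c" "c < ?N" for c
    using nh that by (simp add: normalized_def)
  \<comment> \<open>orthogonalise row r against the complete pairs below it\<close>
  define y where "y c = (if c = r then 1 else if even c then - row_form n h r (c + 1)
      else if c = r + 1 then 0 else row_form n h r (c - 1))" for c
  define b1 where "b1 = rowop ?N r y"
  have b1: "upper_inv ?N b1" unfolding b1_def by (rule rowop_upper_inv) (simp add: y_def)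
  define h1 where "h1 = b1 * h"
  have h1: "h1 \<in> carrier_mat ?N ?N" using b1 h by (auto simp: h1_def upper_inv_def)
  have same1: "h1 $$ (e, c) = h $$ (e, c)" if "e < ?N" "e \<noteq> r" "c < ?N" for e c
    unfolding h1_def b1_def using rowop_mult[OF h that(1,3) r] that by simp
  have orth: "row_form n h1 r d = 0" if d: "r < d" "d < ?N" "\<not> (even r \<and> d = r + 1)" for d
  proof -
    have "row_form n h1 r d = (\<Sum>j\<in>{r..<?N}. y j * row_form n h j d)"
      unfolding h1_def b1_def by (rule row_form_rowop(1)[OF h r]) (use d in auto)
    also have "\<dots> = row_form n h r d + (\<Sum>j\<in>{Suc r..<?N}. y j * row_form n h j d)"
      using r by (subst sum.atLeast_Suc_lessThan) (auto simp: y_def)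
    also have "(\<Sum>j\<in>{Suc r..<?N}. y j * row_form n h j d) = (\<Sum>j\<in>{Suc r..<?N}. y j * hyp_form j d)"
      by (intro sum.cong refl) (use d hyp in auto)
    also have "\<dots> = - row_form n h r d"
    proof (cases "even d")
      case True
      then have dl: "d + 1 < ?N" using d by presburger
      have "(\<Sum>j\<in>{Suc r..<?N}. y j * hyp_form j d) = (\<Sum>j\<in>{Suc r..<?N}. if j = d + 1 then - y (d + 1) else 0)"
        using True by (intro sum.cong refl) (auto simp: hyp_form_def)
      also have "\<dots> = - y (d + 1)" using dl d by simp
      also have "y (d + 1) = row_form n h r d" using True d by (simp add: y_def)
      finally show ?thesis .
    next
      case False
      then have diagm: "r < d - 1" "d = (d - 1) + 1" "even (d - 1)" using d by (auto; presburger)+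
      have "(\<Sum>j\<in>{Suc r..<?N}. y j * hyp_form j d) = (\<Sum>j\<in>{Suc r..<?N}. if j = d - 1 then y (d - 1) else 0)"
        using False diagm by (intro sum.cong refl) (auto simp: hyp_form_def)
      also have "\<dots> = y (d - 1)" using diagm d by simp
      also have "\<dots> = - row_form n h r d" using diagm by (simp add: y_def)
      finally show ?thesis .
    qed
    finally show ?thesis by simp
  qed
  have pf1: "corner_pfaffian n (?N - r) h1 \<noteq> 0"
  proof -
    have "corner_pfaffian n (?N - r) h1 = (\<Prod>i\<in>{?N - (?N - r)..<?N}. b1 $$ (i, i)) * corner_pfaffian n (?N - r) h"
      unfolding h1_def by (rule corner_pfaffian_upper[OF n]) (use b1 h in \<open>auto simp: upper_inv_def\<close>)
    then show ?thesis using pfaffian b1 by (simp add: upper_inv_def)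
  qed
  have kr: "?N - r = Suc (?N - Suc r)" "?N - Suc (?N - Suc r) = r" "Suc (?N - Suc r) \<le> ?N"
    using r by linarith+
  have evk: "even (?N - Suc r) \<longleftrightarrow> odd r" using r by presburger
  have comb: "upper_inv ?N (b2 * b1) \<and> normalized n r ((b2 * b1) * h)"
    if "upper_inv ?N b2" "normalized n r (b2 * h1)" for b2
  proof -
    have "(b2 * b1) * h = b2 * h1"
      unfolding h1_def using that(1) b1 h by (intro assoc_mult_mat[of _ ?N ?N _ ?N _ ?N]) (auto simp: upper_inv_def)
    then show ?thesis using that upper_inv_mult b1 by auto
  qed
  have nz1: "normalized n r (rowop ?N r z * h1)"
    if z: "z r \<noteq> 0" and row: "\<And>d. r < d \<Longrightarrow> d < ?N \<Longrightarrow> (\<Sum>j\<in>{r..<?N}. z j * row_form n h1 j d) = hyp_form r d"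
      and l: "(\<Sum>j\<in>{r..<?N}. z j * h1 $$ (j, ?N - 1)) = (if odd r then 1 else 0)" for z
  proof (rule normalizedI[OF _ nh r])
    show "rowop ?N r z * h1 \<in> carrier_mat ?N ?N" using h1 by (intro mult_carrier_mat[of _ ?N ?N]) (auto simp: rowop_def)
    show "(rowop ?N r z * h1) $$ (e, c) = h $$ (e, c)" if "e < ?N" "e \<noteq> r" "c < ?N" for e c
      using rowop_mult[OF h1 that(1,3) r, of z] same1[OF that] that by simp
    show "row_form n (rowop ?N r z * h1) r d = hyp_form r d" if "r < d" "d < ?N" for d
      using row_form_rowop(1)[OF h1 r, of d z] row[OF that] that by simp
    show "(rowop ?N r z * h1) $$ (r, ?N - 1) = (if odd r then 1 else 0)"
      using rowop_mult[OF h1 r _ r, of "?N - 1" z] l n by simp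
  qed
  show ?thesis
  proof (cases "even r")
    case False
    have v: "h1 $$ (r, ?N - 1) \<noteq> 0"
    proof
      assume "h1 $$ (r, ?N - 1) = 0"
      then have "corner_pfaffian n (Suc (?N - Suc r)) h1 = 0"
        using orth False by (intro corner_pfaffian_zero[OF n kr(3)]) (simp_all only: kr(2), auto)
      then show False using pf1 kr(1) by simp
    qed
    define z where "z j = (if j = r then 1 / h1 $$ (r, ?N - 1) else 0)" for j
    have sz: "(\<Sum>j\<in>{r..<?N}. z j * F j) = F r / h1 $$ (r, ?N - 1)" for F
      using r by (subst sum.atLeast_Suc_lessThan) (auto simp: z_def)
    have "normalized n r (rowop ?N r z * h1)"
    proof (rule nz1)
      show "z r \<noteq> 0" using v by (simp add: z_def)
      show "(\<Sum>j\<in>{r..<?N}. z j * row_form n h1 j d) = hyp_form r d" if "r < d" "d < ?N" for d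
        using orth[OF that] False that by (simp add: sz hyp_form_def)
      show "(\<Sum>j\<in>{r..<?N}. z j * h1 $$ (j, ?N - 1)) = (if odd r then 1 else 0)"
        using v False by (simp add: sz)
    qed
    moreover have "upper_inv ?N (rowop ?N r z)" using v by (intro rowop_upper_inv) (simp add: z_def)
    ultimately show ?thesis using comb by blast
  next
    case True
    have r1: "r + 1 < ?N" using True r by presburger
    let ?v = "row_form n h1 r (r + 1)"
    have v: "?v \<noteq> 0"
    proof
      assume v0: "?v = 0"
      have "row_form n h1 r c = 0" if "r < c" "c < ?N" for c using orth[OF that] v0 by blast
      then have "corner_pfaffian n (Suc (?N - Suc r)) h1 = 0"
        using True evk by (intro corner_pfaffian_zero[OF n kr(3)]) (simp_all only: kr(2), auto)
      then show False using pf1 kr(1) by simp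
    qed
    define z where "z j = (if j = r then 1 / ?v else if j = r + 1 then - h1 $$ (r, ?N - 1) / ?v else 0)" for j
    have sz: "(\<Sum>j\<in>{r..<?N}. z j * F j) = F r / ?v - h1 $$ (r, ?N - 1) / ?v * F (r + 1)" for F
    proof -
      have "(\<Sum>j\<in>{r..<?N}. z j * F j) = z r * F r + (z (r + 1) * F (r + 1) + (\<Sum>j\<in>{Suc (Suc r)..<?N}. z j * F j))"
        using r r1 by (simp add: sum.atLeast_Suc_lessThan)
      also have "(\<Sum>j\<in>{Suc (Suc r)..<?N}. z j * F j) = 0" by (intro sum.neutral) (auto simp: z_def)
      finally show ?thesis by (simp add: z_def)
    qed
    have h1r: "row_form n h1 (r + 1) d = hyp_form (r + 1) d" if "r < d" "d < ?N" for d
    proof -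
      have "row_form n h1 (r + 1) d = row_form n h (r + 1) d"
        unfolding h1_def b1_def by (rule row_form_rowop(2)[OF h r]) (use that r1 in auto)
      then show ?thesis using hyp[of "r + 1" d] that r1 by simp
    qed
    have "normalized n r (rowop ?N r z * h1)"
    proof (rule nz1)
      show "z r \<noteq> 0" using v by (simp add: z_def)
      show "(\<Sum>j\<in>{r..<?N}. z j * row_form n h1 j d) = hyp_form r d" if "r < d" "d < ?N" for d
      proof (cases "d = r + 1")
        case d: True
        show ?thesis unfolding sz h1r[OF that] using d v True by (simp add: hyp_form_def)
      next
        case False
        have "row_form n h1 r d = 0" by (rule orth) (use that False in auto)
        then show ?thesis unfolding sz h1r[OF that] using False True that by (simp add: hyp_form_def)
      qed
      have "h1 $$ (r + 1, ?N - 1) = 1" using same1[OF r1, of "?N - 1"] hl[OF _ r1] True n by simp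
      then show "(\<Sum>j\<in>{r..<?N}. z j * h1 $$ (j, ?N - 1)) = (if odd r then 1 else 0)"
        unfolding sz using True by simp
    qed
    moreover have "upper_inv ?N (rowop ?N r z)" using v by (intro rowop_upper_inv) (simp add: z_def)
    ultimately show ?thesis using comb by blast
  qed
qed

lemma gram_schmidt:
  assumes n: "0 < n" and g: "g \<in> carrier_mat (2 * n) (2 * n)"
    and pfaffian: "\<And>k. 1 \<le> k \<Longrightarrow> k \<le> 2 * n \<Longrightarrow> corner_pfaffian n k g \<noteq> 0"
  shows "\<exists>b. upper_inv (2 * n) b \<and> normalized n 0 (b * g)"
proof -
  have "k \<le> 2 * n \<Longrightarrow> \<exists>b. upper_inv (2 * n) b \<and> normalized n (2 * n - k) (b * g)" for k
  proof (induction k)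
    case 0
    show ?case using upper_inv_one[of "2 * n"] g by (intro exI[of _ "1\<^sub>m (2 * n)"]) (auto simp: normalized_def)
  next
    case (Suc k)
    let ?r = "2 * n - Suc k"
    obtain b where b: "upper_inv (2 * n) b" "normalized n (Suc ?r) (b * g)"
      using Suc by (auto simp: Suc_diff_Suc)
    have r: "?r < 2 * n" "2 * n - ?r = Suc k" using Suc.prems by auto
    have "corner_pfaffian n (2 * n - ?r) (b * g) = (\<Prod>i\<in>{2 * n - (2 * n - ?r)..<2 * n}. b $$ (i, i)) * corner_pfaffian n (2 * n - ?r) g"
      by (rule corner_pfaffian_upper[OF n]) (use b g in \<open>auto simp: upper_inv_def\<close>)
    then have "corner_pfaffian n (2 * n - ?r) (b * g) \<noteq> 0"
      using b(1) pfaffian[of "Suc k"] Suc.prems r(2) by (simp add: upper_inv_def)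
    from gram_schmidt_step[OF n r(1) b(2) this]
    obtain b' where b': "upper_inv (2 * n) b'" "normalized n ?r (b' * (b * g))" by blast
    have "b' * (b * g) = (b' * b) * g"
      using b b' g by (intro assoc_mult_mat[symmetric, of _ "2 * n" "2 * n" _ "2 * n" _ "2 * n"]) (auto simp: upper_inv_def)
    then show ?case using b' upper_inv_mult[OF b'(1) b(1)] by auto
  qed
  from this[of "2 * n"] show ?thesis by simp
qed

section \<open>The open orbit\<close>

definition diagm :: "nat \<Rightarrow> (nat \<Rightarrow> complex) \<Rightarrow> complex mat" where
  "diagm N d = mat N N (\<lambda>(i, j). if i = j then d i else 0)"

lemma diagm_carrier [simp]: "diagm N d \<in> carrier_mat N N"
  by (simp add: diagm_def)

lemma diagm_dim [simp]: "dim_row (diagm N d) = N" "dim_col (diagm N d) = N"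
  by (simp_all add: diagm_def)

lemma diagm_index [simp]: "i < N \<Longrightarrow> j < N \<Longrightarrow> diagm N d $$ (i, j) = (if i = j then d i else 0)"
  by (simp add: diagm_def)

lemma diagm_left:
  assumes "A \<in> carrier_mat N k" "i < N" "j < k"
  shows "(diagm N d * A) $$ (i, j) = d i * A $$ (i, j)"
proof -
  have "(diagm N d * A) $$ (i, j) = (\<Sum>l<N. diagm N d $$ (i, l) * A $$ (l, j))"
    by (rule index_mult_sum[OF diagm_carrier assms])
  also have "\<dots> = (\<Sum>l<N. if l = i then d i * A $$ (i, j) else 0)"
    using assms by (intro sum.cong) auto
  finally show ?thesis using assms by simp
qed

lemma diagm_right:
  assumes "A \<in> carrier_mat k N" "i < k" "j < N"
  shows "(A * diagm N d) $$ (i, j) = A $$ (i, j) * d j"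
proof -
  have "(A * diagm N d) $$ (i, j) = (\<Sum>l<N. A $$ (i, l) * diagm N d $$ (l, j))"
    by (rule index_mult_sum[OF assms(1) diagm_carrier assms(2,3)])
  also have "\<dots> = (\<Sum>l<N. if l = j then A $$ (i, j) * d j else 0)"
    using assms by (intro sum.cong) auto
  finally show ?thesis using assms by simp
qed

lemma diagm_mult: "diagm N d * diagm N e = diagm N (\<lambda>i. d i * e i)"
proof (rule eq_matI)
  fix i j assume "i < dim_row (diagm N (\<lambda>i. d i * e i))" "j < dim_col (diagm N (\<lambda>i. d i * e i))"
  then have ij: "i < N" "j < N" by auto
  show "(diagm N d * diagm N e) $$ (i, j) = diagm N (\<lambda>i. d i * e i) $$ (i, j)"
    unfolding diagm_left[OF diagm_carrier ij] using ij by simp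
qed auto

lemma diagm_cong: "(\<And>i. i < N \<Longrightarrow> d i = e i) \<Longrightarrow> diagm N d = diagm N e"
  by (intro eq_matI) auto

lemma diagm_one: "(\<And>i. i < N \<Longrightarrow> d i = 1) \<Longrightarrow> diagm N d = 1\<^sub>m N"
  by (intro eq_matI) auto

lemma diagm_upper: "upper_triangular (diagm N d)"
  by (rule upper_triangularI) simp

lemma det_diagm: "det (diagm N d) = (\<Prod>i<N. d i)"
  by (subst det_triangular[OF diagm_carrier diagm_upper]) simp

lemma diagonal_diagm: "A \<in> carrier_mat N N \<Longrightarrow> diagonal_mat A \<Longrightarrow> A = diagm N (\<lambda>i. A $$ (i, i))"
  by (intro eq_matI) (auto simp: diagonal_mat_def)

lemma diagm_std_Sp: "diagm (2 * n) d \<in> std_Sp n \<longleftrightarrow> (\<forall>i<2 * n. d i * d (2 * n - 1 - i) = 1)"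
proof -
  let ?A = "diagm (2 * n) d" and ?J = "bourbaki_form n"
  have e: "(?A * ?J * transpose_mat ?A) $$ (r, c) = (if c = 2 * n - 1 - r then jsgn n r * (d r * d c) else 0)"
    if "r < 2 * n" "c < 2 * n" for r c
  proof -
    have t: "transpose_mat ?A = ?A" by (rule eq_matI) auto
    have "(?A * ?J * ?A) $$ (r, c) = (?A * ?J) $$ (r, c) * d c"
      by (rule diagm_right[OF _ that]) (rule mult_carrier_mat[OF diagm_carrier bourbaki_form_carrier])
    also have "(?A * ?J) $$ (r, c) = d r * ?J $$ (r, c)" by (rule diagm_left[OF bourbaki_form_carrier that])
    finally show ?thesis unfolding t bourbaki_form_index[OF that] by simp
  qed
  have nz: "jsgn n r \<noteq> 0" for r by (simp add: jsgn_def)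
  show ?thesis
  proof
    assume "?A \<in> std_Sp n"
    then have eq: "?A * ?J * transpose_mat ?A = ?J" by (simp add: std_Sp_def)
    show "\<forall>i<2 * n. d i * d (2 * n - 1 - i) = 1"
    proof (intro allI impI)
      fix i assume i: "i < 2 * n"
      then have i': "2 * n - 1 - i < 2 * n" by linarith
      have "jsgn n i * (d i * d (2 * n - 1 - i)) = jsgn n i"
        using e[OF i i'] bourbaki_form_index[OF i i'] unfolding eq by simp
      then show "d i * d (2 * n - 1 - i) = 1" using nz[of i] by simp
    qed
  next
    assume d: "\<forall>i<2 * n. d i * d (2 * n - 1 - i) = 1"
    have "?A * ?J * transpose_mat ?A = ?J"
      by (rule eq_matI) (use e d bourbaki_form_index in auto)
    then show "?A \<in> std_Sp n" by (simp add: std_Sp_def)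
  qed
qed

lemma diagm_line_stab: "0 < n \<Longrightarrow> diagm (2 * n) d \<in> std_Sp n \<Longrightarrow> diagm (2 * n) d \<in> line_stab n"
  by (auto simp: line_stab_def)

lemma mat_inverse_exists:
  assumes "A \<in> carrier_mat N N" "det (A :: complex mat) \<noteq> 0"
  obtains B where "B \<in> carrier_mat N N" "A * B = 1\<^sub>m N" "B * A = 1\<^sub>m N"
  using det_non_zero_imp_unit[OF assms, of "()"] that by (auto simp: Units_def ring_mat_def)

definition std_SL :: "nat \<Rightarrow> complex mat set" where
  "std_SL N = {A \<in> carrier_mat N N. det A = 1}"

definition std_borel :: "nat \<Rightarrow> complex mat set" where
  "std_borel N = {A \<in> std_SL N. upper_triangular A}"

lemma std_borel_carrier: "b \<in> std_borel N \<Longrightarrow> b \<in> carrier_mat N N"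
  by (simp add: std_borel_def std_SL_def)

lemma std_SL_mult: "A \<in> std_SL N \<Longrightarrow> B \<in> std_SL N \<Longrightarrow> A * B \<in> std_SL N"
  by (auto simp: std_SL_def det_mult)

lemma std_borel_mult: "A \<in> std_borel N \<Longrightarrow> B \<in> std_borel N \<Longrightarrow> A * B \<in> std_borel N"
  unfolding std_borel_def using std_SL_mult[of A N B] upper_mult(1)[of A N B] by (auto simp: std_SL_def)

lemma std_borel_one: "1\<^sub>m N \<in> std_borel N"
  by (auto simp: std_borel_def std_SL_def)

lemma line_stab_one: "1\<^sub>m (2 * n) \<in> line_stab n"
  using std_Sp_one by (auto simp: line_stab_def)

definition hyp_mat :: "nat \<Rightarrow> complex mat" where
  "hyp_mat n = mat (2 * n) (2 * n) (\<lambda>(r, c). hyp_form r c)"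

lemma pfaffian_hyp_mat: "pfaffian n (hyp_mat n) \<noteq> 0"
  by (rule pfaffian_hyp_form_nonzero) (simp add: hyp_mat_def)

lemma gram_row_form:
  assumes h: "h \<in> carrier_mat (2 * n) (2 * n)"
    and row_form: "\<And>r c. r < 2 * n \<Longrightarrow> c < 2 * n \<Longrightarrow> row_form n h r c = hyp_form r c"
  shows "h * bourbaki_form n * transpose_mat h = hyp_mat n"
proof (rule eq_matI)
  fix r c assume "r < dim_row (hyp_mat n)" "c < dim_col (hyp_mat n)"
  then have rc: "r < 2 * n" "c < 2 * n" by (auto simp: hyp_mat_def)
  show "(h * bourbaki_form n * transpose_mat h) $$ (r, c) = hyp_mat n $$ (r, c)"
    unfolding gram_index[OF h rc] row_form_def[symmetric] row_form[OF rc] using rc by (simp add: hyp_mat_def)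
qed (use h in \<open>auto simp: hyp_mat_def\<close>)

lemma nat_double_cases:
  assumes "x < 2 * n"
  shows "(\<exists>s<n. x = 2 * s) \<or> (\<exists>s<n. x = 2 * s + (1 :: nat))"
proof (cases "even x")
  case True
  then show ?thesis using assms by (auto elim!: evenE)
next
  case False
  then show ?thesis using assms by (auto elim!: oddE)
qed

lemma hyp_form_double:
  "hyp_form (2 * s) (2 * t) = 0" "hyp_form (2 * s + 1) (2 * t + 1) = 0"
  "hyp_form (2 * s) (2 * t + 1) = (if s = t then 1 else 0)"
  "hyp_form (2 * t + 1) (2 * s) = - (if s = t then 1 else 0)"
  by (simp_all add: hyp_form_def) presburger+

text \<open>
  A hyperbolic basis that ends with \<open>e\<^sub>0\<close>: for odd \<open>k\<close> its last \<open>k + 1\<close> vectors can serve as the last \<open>k\<close> rows of a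
  matrix followed by the appended row \<open>e\<^sub>0\<close>.
\<close>

definition pairing_basis :: "nat \<Rightarrow> complex mat" where
  "pairing_basis n = mat (2 * n) (2 * n) (\<lambda>(r, c).
     if even r then if c = n + r div 2 then - 1 else 0 else if c + r div 2 + 1 = n then 1 else 0)"

lemma row_form_pairing_basis:
  assumes "r < 2 * n" "c < 2 * n"
  shows "row_form n (pairing_basis n) r c = hyp_form r c"
proof -
  let ?h = "pairing_basis n"
  have even_odd: "row_form n ?h (2 * s) (2 * t + 1) = (if s = t then 1 else 0)" if "s < n" "t < n" for s t
  proof -
    have "row_form n ?h (2 * s) (2 * t + 1) = (\<Sum>a<2 * n. if a = n + s then if s = t then 1 else 0 else 0)"
      unfolding row_form_def
    proof (intro sum.cong refl)
      fix a assume "a \<in> {..<2 * n}"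
      then have a: "a < 2 * n" "2 * n - 1 - a < 2 * n" by auto
      have st: "2 * s < 2 * n" "2 * t + 1 < 2 * n" using that by linarith+
      have 1: "?h $$ (2 * s, a) = (if a = n + s then - 1 else 0)"
        using a st by (simp add: pairing_basis_def)
      have "?h $$ (2 * t + 1, 2 * n - 1 - a) = (if 2 * n - 1 - a + t + 1 = n then 1 else 0)"
        using a st by (simp only: pairing_basis_def index_mat) simp
      moreover have "a = n + s \<Longrightarrow> (2 * n - 1 - a + t + 1 = n) = (s = t)" using a that by linarith
      ultimately show "jsgn n a * ?h $$ (2 * s, a) * ?h $$ (2 * t + 1, 2 * n - 1 - a) =
          (if a = n + s then if s = t then 1 else 0 else 0)"
        unfolding 1 by (cases "a = n + s") (simp_all add: jsgn_def)
    qed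
    then show ?thesis using that by simp
  qed
  have even_even: "row_form n ?h (2 * s) (2 * t) = 0" if "s < n" "t < n" for s t
    unfolding row_form_def
  proof (intro sum.neutral ballI)
    fix a assume "a \<in> {..<2 * n}"
    then have a: "a < 2 * n" "2 * n - 1 - a < 2 * n" by auto
    have st: "2 * s < 2 * n" "2 * t < 2 * n" using that by linarith+
    have 1: "?h $$ (2 * s, a) = (if a = n + s then - 1 else 0)"
      using a st by (simp add: pairing_basis_def)
    have "?h $$ (2 * t, 2 * n - 1 - a) = (if 2 * n - 1 - a = n + t then - 1 else 0)"
      using a st by (simp only: pairing_basis_def index_mat) simp
    moreover have "a = n + s \<Longrightarrow> 2 * n - 1 - a \<noteq> n + t" using a that by linarith
    ultimately show "jsgn n a * ?h $$ (2 * s, a) * ?h $$ (2 * t, 2 * n - 1 - a) = 0"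
      unfolding 1 by (cases "a = n + s") simp_all
  qed
  have odd_odd: "row_form n ?h (2 * s + 1) (2 * t + 1) = 0" if "s < n" "t < n" for s t
    unfolding row_form_def
  proof (intro sum.neutral ballI)
    fix a assume "a \<in> {..<2 * n}"
    then have a: "a < 2 * n" "2 * n - 1 - a < 2 * n" by auto
    have st: "2 * s + 1 < 2 * n" "2 * t + 1 < 2 * n" using that by linarith+
    have 1: "?h $$ (2 * s + 1, a) = (if a + s + 1 = n then 1 else 0)"
      using a st by (simp only: pairing_basis_def index_mat) simp
    have "?h $$ (2 * t + 1, 2 * n - 1 - a) = (if 2 * n - 1 - a + t + 1 = n then 1 else 0)"
      using a st by (simp only: pairing_basis_def index_mat) simp
    moreover have "a + s + 1 = n \<Longrightarrow> 2 * n - 1 - a + t + 1 \<noteq> n" using a that by linarith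
    ultimately show "jsgn n a * ?h $$ (2 * s + 1, a) * ?h $$ (2 * t + 1, 2 * n - 1 - a) = 0"
      unfolding 1 by (cases "a + s + 1 = n") simp_all
  qed
  have odd_even: "row_form n ?h (2 * t + 1) (2 * s) = - (if s = t then 1 else 0)" if "s < n" "t < n" for s t
    using even_odd[OF that] row_form_swap[of n ?h "2 * t + 1" "2 * s"] by simp
  from nat_double_cases[OF assms(1)] nat_double_cases[OF assms(2)] show ?thesis
    by (elim disjE exE conjE)
      (simp_all only: even_odd odd_even even_even odd_odd hyp_form_double)
qed

lemma pfaffian_bourbaki_form: "pfaffian n (bourbaki_form n) \<noteq> 0"
proof -
  have c: "pairing_basis n \<in> carrier_mat (2 * n) (2 * n)" by (simp add: pairing_basis_def)
  have "pfaffian n (hyp_mat n) = det (pairing_basis n) * pfaffian n (bourbaki_form n)"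
    using pfaffian_congruence[OF c bourbaki_form_carrier] gram_row_form[OF c row_form_pairing_basis] by simp
  then show ?thesis using pfaffian_hyp_mat[of n] by auto
qed

text \<open>
  Compare the Pfaffians of both sides of \<open>A J A\<^sup>T = J\<close>.
\<close>

lemma std_Sp_det: "A \<in> std_Sp n \<Longrightarrow> det A = 1"
  using pfaffian_congruence[of A n "bourbaki_form n"] pfaffian_bourbaki_form[of n] by (auto simp: std_Sp_def)

lemma corner_pfaffian_nonzero:
  assumes n: "0 < n" and k: "k \<le> 2 * n"
  shows "\<exists>g\<in>carrier_mat (2 * n) (2 * n). corner_pfaffian n k g \<noteq> 0"
proof -
  let ?h = "pairing_basis n" and ?N = "2 * n"
  have c: "?h \<in> carrier_mat ?N ?N" by (simp add: pairing_basis_def)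
  define R where "R = ?N - 2 * ((k + 1) div 2)"
  have R: "R + 2 * ((k + 1) div 2) = ?N" "even R" using k unfolding R_def by presburger+
  have "\<exists>g\<in>carrier_mat ?N ?N. \<forall>a<2 * ((k + 1) div 2). \<forall>c<?N. bottom n k g $$ (a, c) = ?h $$ (R + a, c)"
  proof (cases "even k")
    case True
    then have "2 * ((k + 1) div 2) = k" by (auto elim!: evenE)
    then show ?thesis using c R k by (intro bexI[of _ ?h]) (auto simp: bottom_def R_def)
  next
    case False
    then have kk: "2 * ((k + 1) div 2) = k + 1" by (auto elim!: oddE)
    define g where "g = mat ?N ?N (\<lambda>(r, c). ?h $$ (r - 1, c))"
    have "bottom n k g $$ (a, c) = ?h $$ (R + a, c)" if a: "a < 2 * ((k + 1) div 2)" and c: "c < ?N" for a c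
    proof (cases "a < k")
      case True
      then have "?N - k + a < ?N" "?N - k + a - 1 = R + a" using kk R k False by linarith+
      then show ?thesis using a c True by (simp add: bottom_def g_def)
    next
      case False
      then have Ra: "R + a = 2 * (n - 1) + 1" using a kk R n by linarith
      have "2 * (n - 1) + 1 < ?N" using n by linarith
      then have "?h $$ (2 * (n - 1) + 1, c) = (if c + (n - 1) + 1 = n then 1 else 0)"
        using c by (simp only: pairing_basis_def index_mat) simp
      then show ?thesis unfolding Ra using a c False n by (simp add: bottom_def)
    qed
    then show ?thesis by (intro bexI[of _ g]) (auto simp: g_def)
  qed
  then obtain g where g: "g \<in> carrier_mat ?N ?N"
    "\<And>a c. a < 2 * ((k + 1) div 2) \<Longrightarrow> c < ?N \<Longrightarrow> bottom n k g $$ (a, c) = ?h $$ (R + a, c)" by blast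
  have "corner_pfaffian n k g \<noteq> 0"
    unfolding corner_pfaffian_def
  proof (rule pfaffian_hyp_form_nonzero)
    fix a d assume a: "a < 2 * ((k + 1) div 2)" and d: "d < 2 * ((k + 1) div 2)"
    have "(bottom n k g * bourbaki_form n * transpose_mat (bottom n k g)) $$ (a, d) =
        (\<Sum>x<?N. jsgn n x * bottom n k g $$ (a, x) * bottom n k g $$ (d, ?N - 1 - x))"
      by (rule gram_index[OF bottom_carrier a d])
    also have "\<dots> = row_form n ?h (R + a) (R + d)"
      unfolding row_form_def using g(2)[OF a] g(2)[OF d] n by (intro sum.cong refl) simp
    also have "\<dots> = hyp_form (R + a) (R + d)" by (rule row_form_pairing_basis) (use a d R in linarith)+
    also have "\<dots> = hyp_form a d" using R(2) by (simp add: hyp_form_def)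
    finally show "(bottom n k g * bourbaki_form n * transpose_mat (bottom n k g)) $$ (a, d) = hyp_form a d" .
  qed
  then show ?thesis using g(1) by blast
qed

text \<open>
  A matrix in normal form whose even rows lie in the span of \<open>e\<^sub>0, \<dots>, e\<^sub>n\<^sub>-\<^sub>1\<close> and whose odd rows lie in the
  span of the other basis vectors. Because of these two Lagrangian subspaces its stabiliser contains pairs
  of diagonal matrices.
\<close>

definition base_pt :: "nat \<Rightarrow> complex mat" where
  "base_pt n = mat (2 * n) (2 * n) (\<lambda>(r, c).
     if even r then if c < n then if c = r div 2 then 1 else if r = 0 then - 1 else 0 else 0
     else if n \<le> c then if c + 1 = 2 * n \<or> c + r div 2 + 1 = 2 * n then 1 else 0 else 0)"

lemma base_pt_carrier [simp]: "base_pt n \<in> carrier_mat (2 * n) (2 * n)"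
  by (simp add: base_pt_def)

lemma base_pt_even:
  "s < n \<Longrightarrow> c < 2 * n \<Longrightarrow> base_pt n $$ (2 * s, c) =
    (if c < n then if c = s then 1 else if s = 0 then - 1 else 0 else 0)"
  by (simp add: base_pt_def)

lemma base_pt_odd:
  "s < n \<Longrightarrow> c < 2 * n \<Longrightarrow> base_pt n $$ (2 * s + 1, c) =
    (if n \<le> c then if c + 1 = 2 * n \<or> c + s + 1 = 2 * n then 1 else 0 else 0)"
  by (simp only: base_pt_def index_mat) simp

lemma normalized_base_pt:
  assumes n: "0 < n"
  shows "normalized n 0 (base_pt n)"
proof -
  let ?h = "base_pt n"
  have lt: "2 * n - 1 - a < 2 * n" for a using n by linarith
  have even_odd: "row_form n ?h (2 * s) (2 * t + 1) = (if s = t then 1 else 0)" if st: "s < n" "t < n" for s t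
  proof -
    have "row_form n ?h (2 * s) (2 * t + 1) =
        (\<Sum>a<2 * n. (if a = s then if s = 0 \<or> s = t then 1 else 0 else 0)
          + (if a = t then if s = 0 \<and> t \<noteq> 0 then - 1 else 0 else 0))"
      unfolding row_form_def
    proof (intro sum.cong refl)
      fix a assume "a \<in> {..<2 * n}"
      then have a: "a < 2 * n" by simp
      show "jsgn n a * ?h $$ (2 * s, a) * ?h $$ (2 * t + 1, 2 * n - 1 - a) =
          (if a = s then if s = 0 \<or> s = t then 1 else 0 else 0) + (if a = t then if s = 0 \<and> t \<noteq> 0 then - 1 else 0 else 0)"
      proof (cases "a < n")
        case True
        then have "n \<le> 2 * n - 1 - a" "(2 * n - 1 - a + 1 = 2 * n) = (a = 0)" "(2 * n - 1 - a + t + 1 = 2 * n) = (a = t)"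
          by linarith+
        then have "?h $$ (2 * t + 1, 2 * n - 1 - a) = (if a = 0 \<or> a = t then 1 else 0)"
          using base_pt_odd[OF st(2) lt[of a]] by (simp only: if_True)
        then show ?thesis unfolding base_pt_even[OF st(1) a] using True by (auto simp: jsgn_def)
      next
        case False
        then show ?thesis unfolding base_pt_even[OF st(1) a] using st by auto
      qed
    qed
    also have "\<dots> = (if s = 0 \<or> s = t then 1 else 0) + (if s = 0 \<and> t \<noteq> 0 then - 1 else 0)"
      unfolding sum.distrib using st by simp
    finally show ?thesis by (auto split: if_splits)
  qed
  have even_even: "row_form n ?h (2 * s) (2 * t) = 0" if st: "s < n" "t < n" for s t
    unfolding row_form_def
  proof (intro sum.neutral ballI)
    fix a assume "a \<in> {..<2 * n}"
    then have a: "a < 2 * n" by simp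
    have "(a < n \<longrightarrow> \<not> 2 * n - 1 - a < n)" by linarith
    then show "jsgn n a * ?h $$ (2 * s, a) * ?h $$ (2 * t, 2 * n - 1 - a) = 0"
      unfolding base_pt_even[OF st(1) a] base_pt_even[OF st(2) lt] by (cases "a < n") simp_all
  qed
  have odd_odd: "row_form n ?h (2 * s + 1) (2 * t + 1) = 0" if st: "s < n" "t < n" for s t
    unfolding row_form_def
  proof (intro sum.neutral ballI)
    fix a assume "a \<in> {..<2 * n}"
    then have a: "a < 2 * n" by simp
    have "(n \<le> a \<longrightarrow> \<not> n \<le> 2 * n - 1 - a)" using a by linarith
    then show "jsgn n a * ?h $$ (2 * s + 1, a) * ?h $$ (2 * t + 1, 2 * n - 1 - a) = 0"
      unfolding base_pt_odd[OF st(1) a] base_pt_odd[OF st(2) lt] by (cases "n \<le> a") simp_all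
  qed
  have odd_even: "row_form n ?h (2 * t + 1) (2 * s) = - (if s = t then 1 else 0)" if "s < n" "t < n" for s t
    using even_odd[OF that] row_form_swap[of n ?h "2 * t + 1" "2 * s"] by simp
  have g: "row_form n ?h r c = hyp_form r c" if "r < 2 * n" "c < 2 * n" for r c
    using nat_double_cases[OF that(1)] nat_double_cases[OF that(2)]
    by (elim disjE exE conjE)
      (simp_all only: even_odd odd_even even_even odd_odd hyp_form_double)
  have l: "?h $$ (r, 2 * n - 1) = (if odd r then 1 else 0)" if "r < 2 * n" for r
    using nat_double_cases[OF that]
  proof (elim disjE exE conjE)
    fix s assume s: "s < n" "r = 2 * s"
    have "\<not> 2 * n - 1 < n" "2 * n - 1 < 2 * n" using n by linarith+
    then show ?thesis unfolding s(2) by (simp only: base_pt_even[OF s(1)] if_False) simp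
  next
    fix s assume s: "s < n" "r = 2 * s + 1"
    have "n \<le> 2 * n - 1" "2 * n - 1 < 2 * n" "2 * n - 1 + 1 = 2 * n" using n by linarith+
    then show ?thesis unfolding s(2) by (simp only: base_pt_odd[OF s(1)] if_True simp_thms) simp
  qed
  show ?thesis unfolding normalized_def using g l by simp
qed

lemma det_base_pt:
  assumes "0 < n"
  shows "det (base_pt n) \<noteq> 0"
proof -
  have "pfaffian n (hyp_mat n) = det (base_pt n) * pfaffian n (bourbaki_form n)"
    using pfaffian_congruence[OF base_pt_carrier bourbaki_form_carrier, of n] gram_row_form[OF base_pt_carrier, of n]
      normalized_base_pt[OF assms] by (simp add: normalized_def)
  then show ?thesis using pfaffian_hyp_mat[of n] by auto
qed

text \<open>
  Two matrices in normal form have the same Gram matrix and the same last column, so they differ by a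
  symplectic matrix that fixes the last basis vector.
\<close>

lemma open_orbit:
  assumes n: "0 < n" and g: "g \<in> carrier_mat (2 * n) (2 * n)" "det g \<noteq> 0"
    and pfaffian: "\<And>k. 1 \<le> k \<Longrightarrow> k < 2 * n \<Longrightarrow> corner_pfaffian n k g \<noteq> 0"
  shows "\<exists>b q. upper_inv (2 * n) b \<and> q \<in> line_stab n \<and> b * g = base_pt n * q"
proof -
  let ?N = "2 * n" and ?J = "bourbaki_form n" and ?h0 = "base_pt n"
  have "corner_pfaffian n ?N g \<noteq> 0"
  proof -
    have "(?N + 1) div 2 = n" by simp
    moreover have "bottom n ?N g = g"
      by (rule eq_matI) (use g in \<open>auto simp: bottom_def\<close>)
    ultimately have "corner_pfaffian n ?N g = det g * pfaffian n ?J"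
      unfolding corner_pfaffian_def using pfaffian_congruence[OF g(1) bourbaki_form_carrier] by simp
    then show ?thesis using g(2) pfaffian_bourbaki_form by simp
  qed
  then have "corner_pfaffian n k g \<noteq> 0" if "1 \<le> k" "k \<le> ?N" for k using pfaffian[of k] that by (cases "k = ?N") auto
  from gram_schmidt[OF n g(1) this] obtain b where b: "upper_inv ?N b" "normalized n 0 (b * g)" by auto
  define h where "h = b * g"
  have h: "h \<in> carrier_mat ?N ?N" "h * ?J * transpose_mat h = hyp_mat n"
    using b(2) gram_row_form[of h n] by (auto simp: normalized_def h_def)
  have h0: "?h0 * ?J * transpose_mat ?h0 = hyp_mat n"
    using normalized_base_pt[OF n] gram_row_form[of ?h0 n] by (auto simp: normalized_def)
  obtain B where B: "B \<in> carrier_mat ?N ?N" "?h0 * B = 1\<^sub>m ?N" "B * ?h0 = 1\<^sub>m ?N"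
    using mat_inverse_exists[OF base_pt_carrier det_base_pt[OF n]] by blast
  define q where "q = B * h"
  have q: "q \<in> carrier_mat ?N ?N" using B h by (simp add: q_def)
  have "q * ?J * transpose_mat q = B * (?h0 * ?J * transpose_mat ?h0) * transpose_mat B"
    unfolding q_def gram_mult[OF B(1) h(1) bourbaki_form_carrier] h(2) h0 ..
  also have "\<dots> = ?J"
    unfolding gram_mult[OF B(1) base_pt_carrier bourbaki_form_carrier, symmetric] B(3) by simp
  finally have "q \<in> std_Sp n" using q by (simp add: std_Sp_def)
  moreover have "q $$ (l, ?N - 1) = 0" if "l < ?N - 1" for l
  proof -
    have l: "l < ?N" "?N - 1 < ?N" using that by linarith+
    have "q $$ (l, ?N - 1) = (\<Sum>r<?N. B $$ (l, r) * h $$ (r, ?N - 1))"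
      unfolding q_def by (rule index_mult_sum[OF B(1) h(1) l])
    also have "\<dots> = (\<Sum>r<?N. B $$ (l, r) * ?h0 $$ (r, ?N - 1))"
      using b(2) normalized_base_pt[OF n] by (intro sum.cong refl) (auto simp: normalized_def h_def)
    also have "\<dots> = (B * ?h0) $$ (l, ?N - 1)" by (rule index_mult_sum[symmetric, OF B(1) base_pt_carrier l])
    finally show ?thesis unfolding B(3) using that l by simp
  qed
  moreover have "?h0 * q = b * g"
  proof -
    have "?h0 * (B * h) = (?h0 * B) * h"
      by (rule assoc_mult_mat[symmetric, OF base_pt_carrier B(1) h(1)])
    also have "\<dots> = h" unfolding B(2) by (rule left_mult_one_mat[OF h(1)])
    finally show ?thesis unfolding q_def h_def .
  qed
  ultimately show ?thesis using b(1) by (intro exI[of _ b] exI[of _ q]) (auto simp: line_stab_def)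
qed

section \<open>The relation between the two characters\<close>

text \<open>
  Semi-invariance in the standard basis, with the character of \<open>b\<close> moved to the other side instead of inverting
  \<open>b\<close>.
\<close>

definition semi_invariant ::
    "nat \<Rightarrow> (complex mat \<Rightarrow> complex) \<Rightarrow> (complex mat \<Rightarrow> complex) \<Rightarrow> (complex mat \<Rightarrow> complex) \<Rightarrow> bool" where
  "semi_invariant n f \<omega> \<chi> \<longleftrightarrow>
     (\<forall>a\<in>std_borel (2 * n). \<forall>b\<in>std_borel (2 * n). \<omega> (a * b) = \<omega> a * \<omega> b) \<and> (\<forall>b\<in>std_borel (2 * n). \<omega> b \<noteq> 0) \<and>
     (\<forall>p\<in>line_stab n. \<forall>q\<in>line_stab n. \<chi> (p * q) = \<chi> p * \<chi> q) \<and> (\<forall>p\<in>line_stab n. \<chi> p \<noteq> 0) \<and>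
     (\<forall>b\<in>std_borel (2 * n). \<forall>g\<in>std_SL (2 * n). \<forall>p\<in>line_stab n. f (b * g * p) * \<omega> b = f g * \<chi> p)"

lemma mult_one:
  assumes "\<And>x y. x \<in> A \<Longrightarrow> y \<in> A \<Longrightarrow> \<phi> (x * y) = \<phi> x * (\<phi> y :: complex)"
    and "u \<in> A" "u * u = u" "\<phi> u \<noteq> 0"
  shows "\<phi> u = 1"
  using assms(1)[OF assms(2,2)] assms(3,4) by simp

lemma line_stab_std_SL: "p \<in> line_stab n \<Longrightarrow> p \<in> std_SL (2 * n)"
  using std_Sp_det[of p n] std_Sp_carrier[of p n] by (auto simp: line_stab_def std_SL_def)

context
  fixes n :: nat and f \<omega> \<chi> :: "complex mat \<Rightarrow> complex"
  assumes n: "0 < n" and si: "semi_invariant n f \<omega> \<chi>"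
begin

lemma left_char_mult: "a \<in> std_borel (2 * n) \<Longrightarrow> b \<in> std_borel (2 * n) \<Longrightarrow> \<omega> (a * b) = \<omega> a * \<omega> b"
  and left_char_nonzero: "b \<in> std_borel (2 * n) \<Longrightarrow> \<omega> b \<noteq> 0"
  and right_char_mult: "p \<in> line_stab n \<Longrightarrow> q \<in> line_stab n \<Longrightarrow> \<chi> (p * q) = \<chi> p * \<chi> q"
  and right_char_nonzero: "p \<in> line_stab n \<Longrightarrow> \<chi> p \<noteq> 0"
  and semi: "b \<in> std_borel (2 * n) \<Longrightarrow> g \<in> std_SL (2 * n) \<Longrightarrow> p \<in> line_stab n \<Longrightarrow> f (b * g * p) * \<omega> b = f g * \<chi> p"
  using si unfolding semi_invariant_def by blast+

lemma left_char_one: "\<omega> (1\<^sub>m (2 * n)) = 1"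
  by (rule mult_one[of "std_borel (2 * n)"]) (auto simp: left_char_mult std_borel_one left_char_nonzero)

lemma right_char_one: "\<chi> (1\<^sub>m (2 * n)) = 1"
  by (rule mult_one[of "line_stab n"]) (auto simp: right_char_mult line_stab_one right_char_nonzero)

lemma semi_left: "b \<in> std_borel (2 * n) \<Longrightarrow> g \<in> std_SL (2 * n) \<Longrightarrow> f (b * g) * \<omega> b = f g"
  using semi[of b g "1\<^sub>m (2 * n)"] right_mult_one_mat[of "b * g" "2 * n" "2 * n"] std_SL_mult[of b "2 * n" g]
  by (simp add: line_stab_one right_char_one std_borel_def std_SL_def)

lemma semi_right: "g \<in> std_SL (2 * n) \<Longrightarrow> p \<in> line_stab n \<Longrightarrow> f (g * p) = f g * \<chi> p"
  using semi[of "1\<^sub>m (2 * n)" g p] left_mult_one_mat[of g "2 * n" "2 * n"]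
  by (simp add: std_borel_one left_char_one std_SL_def)

text \<open>
  Density: there is a point where neither \<open>f\<close>, extended along \<open>norm_top\<close>, nor any of the Pfaffians vanishes. It
  lies in the orbit of the base point, and semi-invariance transports nonvanishing along the orbit.
\<close>

lemma orbit_nonzero:
  assumes f: "f \<in> poly_funs (2 * n)" and g0: "g0 \<in> std_SL (2 * n)" "f g0 \<noteq> 0"
  shows "f (norm_top (base_pt n)) \<noteq> 0"
proof -
  let ?N = "2 * n" and ?h0 = "base_pt n"
  obtain M F where F: "F \<in> poly_funs ?N"
    "\<And>A. A \<in> carrier_mat ?N ?N \<Longrightarrow> det A \<noteq> 0 \<Longrightarrow> F A = det A ^ M * f (norm_top A)"
    using poly_funs_norm_top[OF f] by blast
  define \<F> where "\<F> k = (if k = 0 then (\<lambda>A. F A * det_poly ?N A) else corner_pfaffian n k)" for k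
  have "\<exists>A\<in>carrier_mat ?N ?N. \<forall>k\<in>{..<?N}. \<F> k A \<noteq> 0"
  proof (rule poly_funs_nonzero_prod)
    fix k assume k: "k \<in> {..<?N}"
    show "\<F> k \<in> poly_funs ?N"
      using k corner_pfaffian_poly_fun[OF n, of k] by (auto simp: \<F>_def intro: poly_funs.mult F(1))
    have g0c: "g0 \<in> carrier_mat ?N ?N" "det g0 = 1" using g0 by (auto simp: std_SL_def)
    then have "F g0 * det_poly ?N g0 \<noteq> 0"
      using F(2)[OF g0c(1)] g0(2) norm_top_SL[OF g0c] by (simp add: det_poly_eq)
    then show "\<exists>A\<in>carrier_mat ?N ?N. \<F> k A \<noteq> 0"
      using k corner_pfaffian_nonzero[OF n, of k] g0c(1) by (cases "k = 0") (auto simp: \<F>_def)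
  qed simp
  then obtain A where A: "A \<in> carrier_mat ?N ?N" "\<And>k. k < ?N \<Longrightarrow> \<F> k A \<noteq> 0" by blast
  have dA: "det A \<noteq> 0" "f (norm_top A) \<noteq> 0"
    using A(2)[of 0] F(2)[OF A(1)] det_poly_eq[OF A(1)] n by (auto simp: \<F>_def)
  have "corner_pfaffian n k A \<noteq> 0" if "1 \<le> k" "k < ?N" for k using A(2)[OF that(2)] that(1) by (simp add: \<F>_def)
  from open_orbit[OF n A(1) dA(1) this]
  obtain b q where bq: "upper_inv ?N b" "q \<in> line_stab n" "b * A = ?h0 * q" by auto
  have bc: "b \<in> carrier_mat ?N ?N" and qc: "q \<in> carrier_mat ?N ?N"
    using bq std_Sp_carrier by (auto simp: upper_inv_def line_stab_def)
  have norm_diagm: "norm_top B = diagm ?N (\<lambda>i. if i = 0 then 1 / det B else 1) * B" if "B \<in> carrier_mat ?N ?N" for B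
  proof (rule eq_matI)
    fix i j assume "i < dim_row (diagm ?N (\<lambda>i. if i = 0 then 1 / det B else 1) * B)"
      "j < dim_col (diagm ?N (\<lambda>i. if i = 0 then 1 / det B else 1) * B)"
    then have ij: "i < ?N" "j < ?N" using that by auto
    show "norm_top B $$ (i, j) = (diagm ?N (\<lambda>i. if i = 0 then 1 / det B else 1) * B) $$ (i, j)"
      unfolding diagm_left[OF that ij] using ij that by (simp add: norm_top_def mat_multrow_gen_def)
  qed (use that in \<open>auto simp: norm_top_def\<close>)
  define D where "D c = diagm ?N (\<lambda>i. if i = 0 then c else 1)" for c :: complex
  have Dc: "D c \<in> carrier_mat ?N ?N" "upper_triangular (D c)" for c by (auto simp: D_def diagm_upper)
  have dn: "norm_top B = D (1 / det B) * B" if "B \<in> carrier_mat ?N ?N" for B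
    using norm_diagm[OF that] by (simp add: D_def)
  define b2 where "b2 = D (1 / det ?h0) * b * D (det A)"
  have nA: "norm_top A \<in> std_SL ?N" and nh: "norm_top ?h0 \<in> std_SL ?N"
    using det_norm_top[OF A(1)] dA det_norm_top[OF base_pt_carrier] n det_base_pt[OF n] A(1)
    by (auto simp: std_SL_def det_norm_top)
  have DD: "D (det A) * (D (1 / det A) * A) = A"
  proof -
    have "D (det A) * D (1 / det A) = 1\<^sub>m ?N"
      unfolding D_def diagm_mult by (rule diagm_one) (use dA in auto)
    then show ?thesis
      using assoc_mult_mat[OF Dc(1) Dc(1) A(1), of "det A" "1 / det A"] A(1) by simp
  qed
  have eq: "b2 * norm_top A = norm_top ?h0 * q"
  proof -
    have "b2 * norm_top A = D (1 / det ?h0) * b * (D (det A) * (D (1 / det A) * A))"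
      unfolding b2_def dn[OF A(1)]
      by (rule assoc_mult_mat[OF mult_carrier_mat[OF Dc(1) bc] Dc(1) mult_carrier_mat[OF Dc(1) A(1)]])
    also have "\<dots> = D (1 / det ?h0) * (b * A)" unfolding DD by (rule assoc_mult_mat[OF Dc(1) bc A(1)])
    also have "\<dots> = D (1 / det ?h0) * ?h0 * q" unfolding bq(3)
      by (rule assoc_mult_mat[symmetric, OF Dc(1) base_pt_carrier qc])
    finally show ?thesis unfolding dn[OF base_pt_carrier] .
  qed
  have b2c: "b2 \<in> carrier_mat ?N ?N" unfolding b2_def using bc Dc(1) by (meson mult_carrier_mat)
  have "det b2 * det (norm_top A) = det (norm_top ?h0) * det q"
    using arg_cong[OF eq, of det] det_mult[OF b2c, of "norm_top A"] det_mult[of "norm_top ?h0" ?N q] A(1) qc by simp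
  then have "det b2 = 1" using nA nh line_stab_std_SL[OF bq(2)] by (simp add: std_SL_def)
  moreover have "upper_triangular b2"
    unfolding b2_def
    by (rule upper_mult(1)[OF mult_carrier_mat[OF Dc(1) bc] upper_mult(1)[OF Dc bc] Dc])
      (use bq(1) in \<open>simp add: upper_inv_def\<close>)
  ultimately have b2: "b2 \<in> std_borel ?N" using b2c by (simp add: std_borel_def std_SL_def)
  have "f (norm_top ?h0 * q) \<noteq> 0"
    using semi_left[OF b2 nA] dA(2) unfolding eq by auto
  then show ?thesis using semi_right[OF nh bq(2)] by auto
qed

text \<open>
  Write the torus element as the square of \<open>e\<close>. A Weyl group element \<open>w\<close> of \<open>Sp(2n - 2)\<close> carries \<open>e\<close> to its inverse,
  so \<open>\<chi>(e)\<close> and \<open>\<chi>(e\<^sup>-\<^sup>1)\<close> agree, and \<open>\<chi>(e\<^sup>2) = 1\<close>.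
\<close>

lemma torus_char_trivial:
  assumes d: "diagm (2 * n) d \<in> std_Sp n" "d 0 = 1"
  shows "\<chi> (diagm (2 * n) d) = 1"
proof -
  let ?N = "2 * n"
  have dd: "d i * d (?N - 1 - i) = 1" if "i < ?N" for i using d that by (simp add: diagm_std_Sp)
  define e where "e i = (if i < n then csqrt (d i) else 1 / csqrt (d (?N - 1 - i)))" for i
  define e' where "e' i = 1 / e i" for i
  have nz: "d i \<noteq> 0" if "i < ?N" for i using dd[OF that] by auto
  have e0: "e 0 = 1" "e (?N - 1) = 1" using d(2) n by (auto simp: e_def)
  have enz: "e i \<noteq> 0" if "i < ?N" for i
    using nz[OF that] nz[of "?N - 1 - i"] that by (auto simp: e_def)
  have ee: "e i * e (?N - 1 - i) = 1" if "i < ?N" for i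
  proof (cases "i < n")
    case True
    then have "\<not> ?N - 1 - i < n" "?N - 1 - (?N - 1 - i) = i" using that by linarith+
    then show ?thesis using True nz[OF that] by (simp add: e_def)
  next
    case False
    then have "?N - 1 - i < n" "?N - 1 - i < ?N" using that by linarith+
    then show ?thesis using False nz[of "?N - 1 - i"] by (simp add: e_def)
  qed
  have esq: "e i * e i = d i" if "i < ?N" for i
  proof (cases "i < n")
    case True
    then show ?thesis by (simp add: e_def power2_eq_square[symmetric])
  next
    case False
    then have "e i * e i = 1 / d (?N - 1 - i)" by (simp add: e_def power2_eq_square[symmetric] power_divide)
    also have "\<dots> = d i" using dd[OF that] nz[of "?N - 1 - i"] that by (simp add: field_simps)
    finally show ?thesis .
  qed
  have e'e': "e' i * e' (?N - 1 - i) = 1" if "i < ?N" for i using ee[OF that] by (simp add: e'_def)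
  have s: "diagm ?N e \<in> line_stab n" "diagm ?N e' \<in> line_stab n"
    using ee e'e' by (auto intro!: diagm_line_stab n simp: diagm_std_Sp)
  define w where "w = mat ?N ?N (\<lambda>(r, c). if r = 0 \<or> r = ?N - 1 then if c = r then 1 else 0
    else if c = ?N - 1 - r then jsgn n r else 0)"
  have wc: "w \<in> carrier_mat ?N ?N" by (simp add: w_def)
  have wi: "w $$ (r, c) = (if r = 0 \<or> r = ?N - 1 then if c = r then 1 else 0
      else if c = ?N - 1 - r then jsgn n r else 0)" if "r < ?N" "c < ?N" for r c
    using that by (simp add: w_def)
  have w: "w \<in> line_stab n"
  proof -
    have "w * bourbaki_form n * transpose_mat w = bourbaki_form n"
    proof (rule eq_matI)
      fix r c assume "r < dim_row (bourbaki_form n)" "c < dim_col (bourbaki_form n)"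
      then have rc: "r < ?N" "c < ?N" by auto
      have r': "?N - 1 - r < ?N" "?N - 1 - (?N - 1 - r) = r" using rc by linarith+
      have "(w * bourbaki_form n * transpose_mat w) $$ (r, c) =
          (\<Sum>a<?N. jsgn n a * w $$ (r, a) * w $$ (c, ?N - 1 - a))"
        by (rule gram_index[OF wc rc])
      also have "\<dots> = (if c = ?N - 1 - r then jsgn n r else 0)"
      proof (cases "r = 0 \<or> r = ?N - 1")
        case True
        have "(\<Sum>a<?N. jsgn n a * w $$ (r, a) * w $$ (c, ?N - 1 - a)) =
            (\<Sum>a<?N. if a = r then jsgn n r * w $$ (c, ?N - 1 - r) else 0)"
          using True rc wi by (intro sum.cong refl) simp
        also have "\<dots> = jsgn n r * w $$ (c, ?N - 1 - r)" using rc by simp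
        also have "w $$ (c, ?N - 1 - r) = (if c = ?N - 1 - r then 1 else 0)"
        proof (cases "c = 0 \<or> c = ?N - 1")
          case c: True
          then show ?thesis unfolding wi[OF rc(2) r'(1)] by (simp only: if_True eq_commute[of c])
        next
          case False
          then have "?N - 1 - r \<noteq> ?N - 1 - c" "c \<noteq> ?N - 1 - r" using True rc by linarith+
          then show ?thesis unfolding wi[OF rc(2) r'(1)] using False by (simp only: if_False)
        qed
        finally show ?thesis by simp
      next
        case False
        have "(\<Sum>a<?N. jsgn n a * w $$ (r, a) * w $$ (c, ?N - 1 - a)) =
            (\<Sum>a<?N. if a = ?N - 1 - r then jsgn n (?N - 1 - r) * jsgn n r * w $$ (c, r) else 0)"
          using False rc wi r' by (intro sum.cong refl) simp
        also have "\<dots> = jsgn n (?N - 1 - r) * jsgn n r * w $$ (c, r)" using r' by simp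
        also have "w $$ (c, r) = (if c = ?N - 1 - r then jsgn n c else 0)"
        proof -
          have iff: "r = ?N - 1 - c \<longleftrightarrow> c = ?N - 1 - r" using rc by linarith
          show ?thesis
          proof (cases "c = 0 \<or> c = ?N - 1")
            case True
            then have "r \<noteq> c" "c \<noteq> ?N - 1 - r" using False rc by linarith+
            then show ?thesis unfolding wi[OF rc(2,1)] using True by (simp only: if_True if_False)
          next
            case c: False
            then show ?thesis unfolding wi[OF rc(2,1)] iff by (simp only: if_False)
          qed
        qed
        also have "jsgn n (?N - 1 - r) * jsgn n r * (if c = ?N - 1 - r then jsgn n c else 0) =
            (if c = ?N - 1 - r then jsgn n r else 0)"
          by (simp add: jsgn_def)
        finally show ?thesis .
      qed
      finally show "(w * bourbaki_form n * transpose_mat w) $$ (r, c) = bourbaki_form n $$ (r, c)"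
        unfolding bourbaki_form_index[OF rc] .
    qed (auto simp: w_def)
    moreover have "w $$ (r, ?N - 1) = 0" if "r < ?N - 1" for r
    proof -
      have r: "r < ?N" "?N - 1 < ?N" "?N - 1 \<noteq> r" "r \<noteq> 0 \<Longrightarrow> ?N - 1 \<noteq> ?N - 1 - r" "r \<noteq> ?N - 1" using that by linarith+
      then show ?thesis unfolding wi[OF r(1,2)] by (cases "r = 0") simp_all
    qed
    ultimately show ?thesis using wc by (simp add: line_stab_def std_Sp_def)
  qed
  have "w * diagm ?N e = diagm ?N e' * w"
  proof (rule eq_matI)
    fix r c assume "r < dim_row (diagm ?N e' * w)" "c < dim_col (diagm ?N e' * w)"
    then have rc: "r < ?N" "c < ?N" using wc by auto
    have "w $$ (r, c) * e c = e' r * w $$ (r, c)"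
    proof (cases "r = 0 \<or> r = ?N - 1")
      case True
      then show ?thesis unfolding wi[OF rc] using e0 by (auto simp: e'_def)
    next
      case False
      have "e (?N - 1 - r) = e' r" using ee[OF rc(1)] enz[OF rc(1)] by (simp add: e'_def field_simps)
      then show ?thesis unfolding wi[OF rc] using False by simp
    qed
    then show "(w * diagm ?N e) $$ (r, c) = (diagm ?N e' * w) $$ (r, c)"
      unfolding diagm_left[OF wc rc] diagm_right[OF wc rc] .
  qed (use wc in auto)
  then have "\<chi> w * \<chi> (diagm ?N e) = \<chi> (diagm ?N e') * \<chi> w"
    using right_char_mult[OF w s(1)] right_char_mult[OF s(2) w] by metis
  then have 1: "\<chi> (diagm ?N e) = \<chi> (diagm ?N e')" using right_char_nonzero[OF w] by (metis mult.commute mult_left_cancel)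
  have "diagm ?N e * diagm ?N e' = 1\<^sub>m ?N"
    unfolding diagm_mult by (rule diagm_one) (use enz in \<open>auto simp: e'_def\<close>)
  then have "\<chi> (diagm ?N e) * \<chi> (diagm ?N e') = 1" using right_char_mult[OF s] right_char_one by simp
  moreover have "diagm ?N e * diagm ?N e = diagm ?N d"
    unfolding diagm_mult by (rule diagm_cong) (rule esq)
  ultimately show ?thesis using right_char_mult[OF s(1,1)] 1 by simp
qed

lemma torus_char:
  assumes d: "diagm (2 * n) d \<in> std_Sp n"
  shows "\<chi> (diagm (2 * n) d) = \<chi> (diagm (2 * n) (\<lambda>i. if i < n then d 0 else 1 / d 0))"
proof -
  let ?N = "2 * n"
  have dd: "d i * d (?N - 1 - i) = 1" if "i < ?N" for i using d that by (simp add: diagm_std_Sp)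
  have d0: "d 0 \<noteq> 0" using dd[of 0] n by auto
  define p where "p i = (if i < n then d 0 else 1 / d 0)" for i
  define t where "t i = d i / p i" for i
  have pp: "p i * p (?N - 1 - i) = 1" if "i < ?N" for i
  proof -
    have "(?N - 1 - i < n) = (\<not> i < n)" using that by linarith
    then show ?thesis using d0 by (simp add: p_def)
  qed
  have pnz: "p i \<noteq> 0" for i using d0 by (simp add: p_def)
  have P: "diagm ?N p \<in> line_stab n" by (rule diagm_line_stab[OF n]) (use pp in \<open>simp add: diagm_std_Sp\<close>)
  have "t i * t (?N - 1 - i) = (d i * d (?N - 1 - i)) / (p i * p (?N - 1 - i))" for i
    by (simp add: t_def)
  then have T: "diagm ?N t \<in> std_Sp n" using dd pp by (simp add: diagm_std_Sp)
  have "diagm ?N t * diagm ?N p = diagm ?N d"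
    unfolding diagm_mult by (rule diagm_cong) (use pnz in \<open>simp add: t_def\<close>)
  moreover have "\<chi> (diagm ?N t) = 1" by (rule torus_char_trivial[OF T]) (use d0 n in \<open>simp add: t_def p_def\<close>)
  ultimately have "\<chi> (diagm ?N d) = \<chi> (diagm ?N p)" using right_char_mult[OF diagm_line_stab[OF n T] P] by simp
  then show ?thesis by (simp add: p_def[abs_def])
qed

text \<open>
  The two diagonal matrices act in the same way on the base point, one from the left and one from the right.
\<close>

lemma stabilizer_relation:
  assumes f: "f \<in> poly_funs (2 * n)" and g0: "g0 \<in> std_SL (2 * n)" "f g0 \<noteq> 0" and x: "x \<noteq> 0"
  shows "\<chi> (diagm (2 * n) (\<lambda>i. if i < n then x else 1 / x)) * \<omega> (diagm (2 * n) (\<lambda>i. if even i then x else 1 / x)) = 1"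
proof -
  let ?N = "2 * n" and ?h0 = "base_pt n"
  define p where "p = diagm ?N (\<lambda>i. if i < n then x else 1 / x)"
  define b where "b = diagm ?N (\<lambda>i. if even i then x else 1 / x)"
  define G where "G = norm_top ?h0"
  have G: "G \<in> std_SL ?N" "G \<in> carrier_mat ?N ?N"
    using det_norm_top[OF base_pt_carrier] det_base_pt[OF n] n by (auto simp: std_SL_def G_def)
  have "(\<Prod>i<?N. if even i then x else 1 / x) = 1"
    using prod_pairs[of "\<lambda>i. if even i then x else 1 / x" n] x by (simp add: atLeast0LessThan)
  then have b: "b \<in> std_borel ?N" by (simp add: b_def std_borel_def std_SL_def det_diagm diagm_upper)
  have "(?N - 1 - i < n) = (\<not> i < n)" if "i < ?N" for i using that by linarith
  then have p: "p \<in> line_stab n" unfolding p_def by (intro diagm_line_stab n) (use x in \<open>simp add: diagm_std_Sp\<close>)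
  have "b * G = G * p"
  proof (rule eq_matI)
    fix r c assume "r < dim_row (G * p)" "c < dim_col (G * p)"
    then have rc: "r < ?N" "c < ?N" using G by (auto simp: p_def)
    have "?h0 $$ (r, c) \<noteq> 0 \<Longrightarrow> even r = (c < n)" using rc by (auto simp: base_pt_def split: if_splits)
    moreover have "G $$ (r, c) = 0" if "?h0 $$ (r, c) = 0"
      using that rc by (auto simp: G_def norm_top_def mat_multrow_gen_def base_pt_carrier[THEN carrier_matD(1)] base_pt_carrier[THEN carrier_matD(2)])
    ultimately show "(b * G) $$ (r, c) = (G * p) $$ (r, c)"
      unfolding b_def p_def diagm_left[OF G(2) rc] diagm_right[OF G(2) rc] by (cases "?h0 $$ (r, c) = 0") auto
  qed (use G in \<open>auto simp: b_def p_def\<close>)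
  then have "f (G * p) * \<omega> b = f G" using semi_left[OF b G(1)] by simp
  then have "f G * \<chi> p * \<omega> b = f G" using semi_right[OF G(1) p] by simp
  moreover have "f G \<noteq> 0" unfolding G_def by (rule orbit_nonzero[OF f g0])
  ultimately show ?thesis unfolding p_def b_def by simp
qed

end

section \<open>Dominance and the weights of a semi-invariant\<close>

lemma poly_eqI_nonzero:
  assumes "\<And>x. x \<noteq> 0 \<Longrightarrow> poly p x = poly q (x :: complex)"
  shows "p = q"
proof (rule ccontr)
  assume "p \<noteq> q"
  then have "finite {x. poly (p - q) x = 0}" by (intro poly_roots_finite) simp
  then have "finite (insert 0 {x. poly (p - q) x = 0})" by simp
  moreover have "insert 0 {x. poly (p - q) x = 0} = UNIV" using assms by auto
  ultimately have "finite (UNIV :: complex set)" by (simp only:)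
  then show False using infinite_UNIV_char_0 by blast
qed

text \<open>
  Compare the coefficients of \<open>P(2x)\<close> and \<open>P(2) P(x)\<close>.
\<close>

lemma multiplicative_poly:
  assumes mult: "\<And>x y. x \<noteq> 0 \<Longrightarrow> y \<noteq> 0 \<Longrightarrow> poly P (x * y) = poly P x * poly P (y :: complex)"
    and one: "poly P 1 = 1"
  shows "\<exists>k. \<forall>x. x \<noteq> 0 \<longrightarrow> poly P x = x ^ k"
proof -
  have "pcompose P [:0, 2:] = Polynomial.smult (poly P 2) P"
    by (rule poly_eqI_nonzero) (use mult[of 2] in \<open>simp add: poly_pcompose mult.commute\<close>)
  then have c: "Polynomial.coeff P i * 2 ^ i = poly P 2 * Polynomial.coeff P i" for i
    by (metis coeff_pcompose_linear coeff_smult mult.commute)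
  have "P \<noteq> 0" using one by auto
  then obtain k where k: "Polynomial.coeff P k \<noteq> 0" using leading_coeff_neq_0 by blast
  have zero: "Polynomial.coeff P i = 0" if "i \<noteq> k" for i
  proof (rule ccontr)
    assume i: "Polynomial.coeff P i \<noteq> 0"
    have "(2 :: complex) ^ i = 2 ^ k" using c[of i] c[of k] i k by simp
    then have "(2 :: nat) ^ i = 2 ^ k" by (metis of_nat_eq_iff of_nat_numeral of_nat_power)
    then show False using that by simp
  qed
  then have "P = Polynomial.monom (Polynomial.coeff P k) k" by (intro poly_eqI) (auto simp: coeff_monom)
  then have m: "poly P x = Polynomial.coeff P k * x ^ k" for x by (metis Polynomial.poly_monom)
  then have "Polynomial.coeff P k = 1" using one by simp
  then show ?thesis using m by auto
qed

text \<open>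
  Multiplicativity and the Laurent property make \<open>\<phi>\<close> a power. If the exponent were \<open>-d < 0\<close>, then \<open>q(x) x\<^sup>d\<close>
  would be a polynomial in \<open>1/x\<close>, which is impossible for degree reasons.
\<close>

lemma multiplicative_nonneg_power:
  fixes \<phi> :: "complex \<Rightarrow> complex"
  assumes mult: "\<And>x y. x \<noteq> 0 \<Longrightarrow> y \<noteq> 0 \<Longrightarrow> \<phi> (x * y) = \<phi> x * \<phi> y"
    and nz: "\<And>x. x \<noteq> 0 \<Longrightarrow> \<phi> x \<noteq> 0"
    and laurent: "\<And>x. x \<noteq> 0 \<Longrightarrow> x ^ M * \<phi> x = poly P x"
    and qr: "\<And>x. x \<noteq> 0 \<Longrightarrow> poly q x = \<phi> x * poly r (inverse x)" and q0: "q \<noteq> 0"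
  shows "\<exists>a. \<forall>x. x \<noteq> 0 \<longrightarrow> \<phi> x = x ^ a"
proof -
  have "\<phi> 1 = 1" using mult[of 1 1] nz[of 1] by simp
  then have P1: "poly P 1 = 1" using laurent[of 1] by simp
  have "poly P (x * y) = poly P x * poly P y" if "x \<noteq> 0" "y \<noteq> 0" for x y
    using mult[OF that] laurent[of "x * y"] laurent[OF that(1)] laurent[OF that(2)] that
    by (metis (no_types, lifting) mult.assoc mult.left_commute mult_eq_0_iff power_mult_distrib)
  from multiplicative_poly[OF this P1] obtain k where "\<And>x. x \<noteq> 0 \<Longrightarrow> poly P x = x ^ k" by blast
  then have k: "x ^ M * \<phi> x = x ^ k" if "x \<noteq> 0" for x using laurent[OF that] that by simp
  show ?thesis
  proof (cases "M \<le> k")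
    case True
    have "\<phi> x = x ^ (k - M)" if "x \<noteq> 0" for x
      using k[OF that] that True by (simp add: power_diff field_simps)
    then show ?thesis by blast
  next
    case False
    define d where "d = M - k"
    have d: "0 < d" "M = k + d" using False by (auto simp: d_def)
    have inv: "x ^ d * \<phi> x = 1" if "x \<noteq> 0" for x
      using k[OF that] that by (simp add: d power_add)
    have "q * Polynomial.monom 1 (d + Polynomial.degree r) = reflect_poly r"
    proof (rule poly_eqI_nonzero)
      fix x :: complex assume x: "x \<noteq> 0"
      have "poly (q * Polynomial.monom 1 (d + Polynomial.degree r)) x = (x ^ d * \<phi> x) * (x ^ Polynomial.degree r * poly r (inverse x))"
        unfolding poly_mult Polynomial.poly_monom qr[OF x] power_add by simp
      also have "\<dots> = poly (reflect_poly r) x" unfolding inv[OF x] using poly_reflect_poly_nz[OF x, of r] by simp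
      finally show "poly (q * Polynomial.monom 1 (d + Polynomial.degree r)) x = poly (reflect_poly r) x" .
    qed
    moreover have "Polynomial.degree (q * Polynomial.monom 1 (d + Polynomial.degree r)) = Polynomial.degree q + (d + Polynomial.degree r)"
      using q0 by (subst degree_mult_eq) (auto simp: degree_monom_eq monom_eq_0_iff)
    ultimately have "Polynomial.degree q + (d + Polynomial.degree r) \<le> Polynomial.degree r" using degree_reflect_poly_le[of r] by simp
    then show ?thesis using d(1) by simp
  qed
qed

definition coroot :: "nat \<Rightarrow> nat \<Rightarrow> complex \<Rightarrow> complex mat" where
  "coroot N i x = diagm N (\<lambda>j. if j = i then x else if j = Suc i then 1 / x else 1)"

lemma coroot_std_borel: "Suc i < N \<Longrightarrow> x \<noteq> 0 \<Longrightarrow> coroot N i x \<in> std_borel N"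
proof -
  assume i: "Suc i < N" "x \<noteq> 0"
  have "(\<Prod>j<N. if j = i then x else if j = Suc i then 1 / x else 1) =
      (\<Prod>j\<in>{i, Suc i}. if j = i then x else if j = Suc i then 1 / x else 1)"
    using i by (intro prod.mono_neutral_right) auto
  also have "\<dots> = 1" using i by simp
  finally show ?thesis by (simp add: coroot_def std_borel_def std_SL_def det_diagm diagm_upper)
qed

lemma coroot_mult: "coroot N i x * coroot N i y = coroot N i (x * y)"
  unfolding coroot_def diagm_mult by (rule diagm_cong) simp

definition elem_mat :: "nat \<Rightarrow> nat \<Rightarrow> nat \<Rightarrow> complex \<Rightarrow> complex mat" where
  "elem_mat N i j y = mat N N (\<lambda>(r, c). if r = c then 1 else if r = i \<and> c = j then y else 0)"

lemma elem_carrier [simp]: "elem_mat N i j y \<in> carrier_mat N N"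
  by (simp add: elem_mat_def)

lemma elem_mult:
  assumes "A \<in> carrier_mat N k" "r < N" "c < k" "j < N" "i \<noteq> j"
  shows "(elem_mat N i j y * A) $$ (r, c) = A $$ (r, c) + (if r = i then y * A $$ (j, c) else 0)"
proof -
  have "(elem_mat N i j y * A) $$ (r, c) = (\<Sum>l<N. elem_mat N i j y $$ (r, l) * A $$ (l, c))"
    by (rule index_mult_sum[OF elem_carrier assms(1-3)])
  also have "\<dots> = (\<Sum>l<N. (if l = r then A $$ (r, c) else 0) + (if l = j then if r = i then y * A $$ (j, c) else 0 else 0))"
    using assms by (intro sum.cong refl) (auto simp: elem_mat_def)
  finally show ?thesis using assms unfolding sum.distrib by simp
qed

lemma elem_upper_std_borel: "i < j \<Longrightarrow> elem_mat N i j y \<in> std_borel N"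
proof -
  assume ij: "i < j"
  have u: "upper_triangular (elem_mat N i j y)"
    by (rule upper_triangularI) (use ij in \<open>auto simp: elem_mat_def\<close>)
  show ?thesis using u det_triangular[OF elem_carrier u] by (simp add: std_borel_def std_SL_def elem_mat_def)
qed

lemma elem_add:
  assumes "i \<noteq> j" "j < N"
  shows "elem_mat N i j y * elem_mat N i j z = elem_mat N i j (y + z)"
proof (rule eq_matI)
  fix r c assume "r < dim_row (elem_mat N i j (y + z))" "c < dim_col (elem_mat N i j (y + z))"
  then have rc: "r < N" "c < N" by (auto simp: elem_mat_def)
  show "(elem_mat N i j y * elem_mat N i j z) $$ (r, c) = elem_mat N i j (y + z) $$ (r, c)"
    unfolding elem_mult[OF elem_carrier rc assms(2,1)] using rc assms by (auto simp: elem_mat_def)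
qed (auto simp: elem_mat_def)

text \<open>
  On the coordinates \<open>i\<close> and \<open>i + 1\<close> this is the matrix with rows \<open>(0, -1)\<close> and \<open>(1, u)\<close>.
\<close>

definition weyl :: "nat \<Rightarrow> nat \<Rightarrow> complex \<Rightarrow> complex mat" where
  "weyl N i u = mat N N (\<lambda>(r, c). if r = i then if c = Suc i then - 1 else 0
     else if r = Suc i then if c = i then 1 else if c = Suc i then u else 0 else if r = c then 1 else 0)"

text \<open>
  The Bruhat decomposition in \<open>SL(2)\<close> of a lower unipotent matrix, with the last factor polynomial in \<open>1/s\<close>.
\<close>

lemma lower_decomposition:
  assumes "Suc i < N" "s \<noteq> 0"
  shows "elem_mat N (Suc i) i s = elem_mat N i (Suc i) (1 / s) * coroot N i (1 / s) * weyl N i (1 / s)"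
proof (rule eq_matI)
  have W: "weyl N i (1 / s) \<in> carrier_mat N N" by (simp add: weyl_def)
  have C: "coroot N i (1 / s) \<in> carrier_mat N N" by (simp add: coroot_def)
  have CW: "coroot N i (1 / s) * weyl N i (1 / s) \<in> carrier_mat N N" by (rule mult_carrier_mat[OF C W])
  have as: "elem_mat N i (Suc i) (1 / s) * coroot N i (1 / s) * weyl N i (1 / s) =
      elem_mat N i (Suc i) (1 / s) * (coroot N i (1 / s) * weyl N i (1 / s))"
    by (rule assoc_mult_mat[OF elem_carrier C W])
  fix r c assume "r < dim_row (elem_mat N i (Suc i) (1 / s) * coroot N i (1 / s) * weyl N i (1 / s))"
    "c < dim_col (elem_mat N i (Suc i) (1 / s) * coroot N i (1 / s) * weyl N i (1 / s))"
  then have rc: "r < N" "c < N" by (auto simp: elem_mat_def weyl_def)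
  have ne: "i \<noteq> Suc i" by simp
  show "elem_mat N (Suc i) i s $$ (r, c) = (elem_mat N i (Suc i) (1 / s) * coroot N i (1 / s) * weyl N i (1 / s)) $$ (r, c)"
    unfolding as elem_mult[OF CW rc assms(1) ne]
    unfolding coroot_def diagm_left[OF W rc] diagm_left[OF W assms(1) rc(2)]
    using rc assms by (auto simp: elem_mat_def weyl_def)
qed (auto simp: elem_mat_def weyl_def)

lemma det_elem_lower: "i < N \<Longrightarrow> det (elem_mat N (Suc i) i s) = 1"
proof -
  have t: "transpose_mat (elem_mat N (Suc i) i s) = elem_mat N i (Suc i) s"
    by (rule eq_matI) (auto simp: elem_mat_def)
  have "det (elem_mat N (Suc i) i s) = det (transpose_mat (elem_mat N (Suc i) i s))"
    by (rule det_transpose[symmetric, OF elem_carrier])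
  then show ?thesis unfolding t using elem_upper_std_borel[of i "Suc i" N s] by (simp add: std_borel_def std_SL_def)
qed

context
  fixes n :: nat and f \<omega> \<chi> :: "complex mat \<Rightarrow> complex"
  assumes n: "0 < n" and si: "semi_invariant n f \<omega> \<chi>"
begin

text \<open>
  The torus conjugates the unipotent element \<open>U(z)\<close> to \<open>U(4z) = U(z) U(3z)\<close>, so the character is trivial at
  \<open>U(3z)\<close>.
\<close>

lemma left_char_unipotent:
  assumes i: "Suc i < 2 * n"
  shows "\<omega> (elem_mat (2 * n) i (Suc i) y) = 1"
proof -
  let ?N = "2 * n" and ?U = "elem_mat (2 * n) i (Suc i)"
  have U: "?U z \<in> std_borel ?N" for z by (rule elem_upper_std_borel) simp
  have C: "coroot ?N i 2 \<in> std_borel ?N" by (rule coroot_std_borel[OF i]) simp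
  define z where "z = y / 3"
  have "coroot ?N i 2 * ?U z = ?U (4 * z) * coroot ?N i 2"
  proof (rule eq_matI)
    fix r c assume "r < dim_row (?U (4 * z) * coroot ?N i 2)" "c < dim_col (?U (4 * z) * coroot ?N i 2)"
    then have rc: "r < ?N" "c < ?N" by (auto simp: elem_mat_def coroot_def)
    show "(coroot ?N i 2 * ?U z) $$ (r, c) = (?U (4 * z) * coroot ?N i 2) $$ (r, c)"
      unfolding coroot_def diagm_left[OF elem_carrier rc] diagm_right[OF elem_carrier rc]
      using rc by (auto simp: elem_mat_def)
  qed (auto simp: elem_mat_def coroot_def)
  then have "\<omega> (coroot ?N i 2) * \<omega> (?U z) = \<omega> (?U (4 * z)) * \<omega> (coroot ?N i 2)"
    using left_char_mult[OF n si C U[of z]] left_char_mult[OF n si U[of "4 * z"] C] by metis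
  then have "\<omega> (?U (4 * z)) = \<omega> (?U z)" using left_char_nonzero[OF n si C] by (metis mult.commute mult_left_cancel)
  moreover have "?U z * ?U (3 * z) = ?U (4 * z)"
    using elem_add[of i "Suc i" ?N z "3 * z"] i by simp
  ultimately have "\<omega> (?U z) * \<omega> (?U (3 * z)) = \<omega> (?U z)"
    using left_char_mult[OF n si U[of z] U[of "3 * z"]] by simp
  then show ?thesis using left_char_nonzero[OF n si U[of z]] by (simp add: z_def)
qed

text \<open>
  By \<open>lower_decomposition\<close>, \<open>f\<close> at the lower unipotent element times \<open>g\<close>, a polynomial in \<open>s\<close>, equals the
  character at the coroot times a polynomial in \<open>1/s\<close>.
\<close>

lemma weight_dominant:
  assumes f: "f \<in> poly_funs (2 * n)" and w: "\<omega> \<in> poly_funs (2 * n)"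
    and g: "g \<in> std_SL (2 * n)" "f g \<noteq> 0" and i: "Suc i < 2 * n"
  shows "\<exists>a. \<forall>x. x \<noteq> 0 \<longrightarrow> \<omega> (coroot (2 * n) i x) = x ^ a"
proof -
  let ?N = "2 * n"
  have gc: "g \<in> carrier_mat ?N ?N" "det g = 1" using g by (auto simp: std_SL_def)
  obtain M P where MP: "\<And>x. x \<noteq> 0 \<Longrightarrow> x ^ M * \<omega> (coroot ?N i x) = poly P x"
  proof -
    have "\<exists>M q. \<forall>x. x \<noteq> 0 \<longrightarrow> x ^ M * \<omega> (coroot ?N i x) = poly q x"
    proof (rule poly_funs_laurent[OF w])
      fix r c assume rc: "r < ?N" "c < ?N"
      show "\<exists>q. \<forall>x. x \<noteq> 0 \<longrightarrow> x * coroot ?N i x $$ (r, c) = poly q x"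
        using rc by (intro exI[of _ "if r = c then if r = i then [:0, 0, 1:] else if r = Suc i then [:1:] else [:0, 1:] else 0"])
          (auto simp: coroot_def)
    qed
    then show ?thesis using that by blast
  qed
  have "\<exists>q. \<forall>x. f (elem_mat ?N (Suc i) i x * g) = poly q x"
  proof (rule poly_funs_curve[OF f])
    fix r c assume rc: "r < ?N" "c < ?N"
    show "\<exists>q. \<forall>x. (elem_mat ?N (Suc i) i x * g) $$ (r, c) = poly q x"
      using elem_mult[OF gc(1) rc, of i "Suc i"] i
      by (intro exI[of _ "[:g $$ (r, c), if r = Suc i then g $$ (i, c) else 0:]"]) auto
  qed
  then obtain q where q: "\<And>x. f (elem_mat ?N (Suc i) i x * g) = poly q x" by blast
  have wm: "(weyl ?N i x * g) $$ (r, c) = (if r = i then - g $$ (Suc i, c)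
      else if r = Suc i then g $$ (i, c) + x * g $$ (Suc i, c) else g $$ (r, c))" if "r < ?N" "c < ?N" for r c x
  proof -
    have W: "weyl ?N i x \<in> carrier_mat ?N ?N" by (simp add: weyl_def)
    have "(weyl ?N i x * g) $$ (r, c) = (\<Sum>l<?N. weyl ?N i x $$ (r, l) * g $$ (l, c))"
      by (rule index_mult_sum[OF W gc(1) that])
    also have "\<dots> = (\<Sum>l<?N. (if l = r then if r \<noteq> i \<and> r \<noteq> Suc i then g $$ (r, c) else 0 else 0)
        + (if l = Suc i then if r = i then - g $$ (Suc i, c) else if r = Suc i then x * g $$ (Suc i, c) else 0 else 0)
        + (if l = i then if r = Suc i then g $$ (i, c) else 0 else 0))"
      using that i by (intro sum.cong refl) (auto simp: weyl_def)
    finally show ?thesis using that i unfolding sum.distrib by auto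
  qed
  have "\<exists>q. \<forall>x. f (weyl ?N i x * g) = poly q x"
  proof (rule poly_funs_curve[OF f])
    fix r c assume rc: "r < ?N" "c < ?N"
    show "\<exists>q. \<forall>x. (weyl ?N i x * g) $$ (r, c) = poly q x"
      unfolding wm[OF rc]
      by (intro exI[of _ "if r = i then [:- g $$ (Suc i, c):] else if r = Suc i then [:g $$ (i, c), g $$ (Suc i, c):] else [:g $$ (r, c):]"]) auto
  qed
  then obtain r where r: "\<And>x. f (weyl ?N i x * g) = poly r x" by blast
  show ?thesis
  proof (rule multiplicative_nonneg_power[OF _ _ MP])
    show "\<omega> (coroot ?N i (x * y)) = \<omega> (coroot ?N i x) * \<omega> (coroot ?N i y)" if "x \<noteq> 0" "y \<noteq> 0" for x y
      using left_char_mult[OF n si coroot_std_borel[OF i that(1)] coroot_std_borel[OF i that(2)]] by (simp add: coroot_mult)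
    have inv: "\<omega> (coroot ?N i (1 / s)) * \<omega> (coroot ?N i s) = 1" if "s \<noteq> 0" for s
    proof -
      have "coroot ?N i (1 / s) * coroot ?N i s = 1\<^sub>m ?N"
        unfolding coroot_mult using that by (simp add: coroot_def) (rule diagm_one, simp)
      moreover have "1 / s \<noteq> 0" using that by simp
      ultimately show ?thesis
        using left_char_mult[OF n si coroot_std_borel[OF i \<open>1 / s \<noteq> 0\<close>] coroot_std_borel[OF i that]] left_char_one[OF n si] by simp
    qed
    show "\<omega> (coroot ?N i x) \<noteq> 0" if "x \<noteq> 0" for x by (rule left_char_nonzero[OF n si coroot_std_borel[OF i that]])
    show "poly q s = \<omega> (coroot ?N i s) * poly r (inverse s)" if s: "s \<noteq> 0" for s
    proof -
      let ?U = "elem_mat ?N i (Suc i) (1 / s)" and ?C = "coroot ?N i (1 / s)" and ?W = "weyl ?N i (1 / s)"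
      have U: "?U \<in> std_borel ?N" by (rule elem_upper_std_borel) simp
      have C: "?C \<in> std_borel ?N" by (rule coroot_std_borel[OF i]) (use s in simp)
      have UC: "?U * ?C \<in> std_borel ?N" by (rule std_borel_mult[OF U C])
      have Wc: "?W \<in> carrier_mat ?N ?N" by (simp add: weyl_def)
      note dec = lower_decomposition[OF i s]
      have "det (elem_mat ?N (Suc i) i s) = det (?U * ?C) * det ?W"
        unfolding dec by (rule det_mult[OF std_borel_carrier[OF UC] Wc])
      then have "det ?W = 1" using UC det_elem_lower[of i ?N s] i by (simp add: std_borel_def std_SL_def)
      then have Wg: "?W * g \<in> std_SL ?N" using Wc g by (intro std_SL_mult) (auto simp: std_SL_def)
      have "elem_mat ?N (Suc i) i s * g = (?U * ?C) * (?W * g)"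
        unfolding dec by (rule assoc_mult_mat[OF std_borel_carrier[OF UC] Wc gc(1)])
      then have "f (elem_mat ?N (Suc i) i s * g) * \<omega> (?U * ?C) = f (?W * g)"
        using semi_left[OF n si UC Wg] by simp
      moreover have "\<omega> (?U * ?C) = \<omega> ?C" using left_char_mult[OF n si U C] left_char_unipotent[OF i] by simp
      ultimately have "poly q s * \<omega> ?C = poly r (1 / s)" using q r by simp
      then have "poly q s * (\<omega> ?C * \<omega> (coroot ?N i s)) = \<omega> (coroot ?N i s) * poly r (1 / s)" by (simp add: mult_ac)
      then show ?thesis unfolding inv[OF s] by (simp add: inverse_eq_divide)
    qed
    have "elem_mat ?N (Suc i) i 0 = 1\<^sub>m ?N" by (rule eq_matI) (auto simp: elem_mat_def)
    then show "q \<noteq> 0" using q[of 0] g(2) gc by auto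
  qed
qed

text \<open>
  A diagonal matrix of determinant one is the product of the coroots at its leading partial products, which
  expresses \<open>\<omega>\<close> by its values at the coroots; \<open>\<chi>\<close> then follows from \<open>stabilizer_relation\<close>.
\<close>

lemma weights_of_semi_invariant:
  assumes f: "f \<in> poly_funs (2 * n)" and w: "\<omega> \<in> poly_funs (2 * n)"
    and g: "g \<in> std_SL (2 * n)" "f g \<noteq> 0"
  shows "\<exists>a. (\<forall>d. (\<Prod>i<2 * n. d i) = 1 \<longrightarrow> \<omega> (diagm (2 * n) d) = (\<Prod>i\<in>{1..<2 * n}. (\<Prod>k<i. d k) ^ a i)) \<and>
     (\<forall>d. diagm (2 * n) d \<in> std_Sp n \<longrightarrow> \<chi> (diagm (2 * n) d) * d 0 ^ (\<Sum>i | i \<in> {1..<2 * n} \<and> odd i. a i) = 1)"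
proof -
  let ?N = "2 * n"
  have "\<forall>i. \<exists>a. Suc i < ?N \<longrightarrow> (\<forall>x. x \<noteq> 0 \<longrightarrow> \<omega> (coroot ?N i x) = x ^ a)"
    using weight_dominant[OF f w g] by blast
  then obtain a where a: "\<And>i x. Suc i < ?N \<Longrightarrow> x \<noteq> 0 \<Longrightarrow> \<omega> (coroot ?N i x) = x ^ a i" by metis
  define a' where "a' i = a (i - 1)" for i
  have wd: "\<omega> (diagm ?N d) = (\<Prod>i\<in>{1..<?N}. (\<Prod>k<i. d k) ^ a' i)" if d: "(\<Prod>i<?N. d i) = 1" for d
  proof -
    have dnz: "d i \<noteq> 0" if "i < ?N" for i using d that by (metis finite_lessThan lessThan_iff prod_zero_iff zero_neq_one)
    have pnz: "(\<Prod>l<k. d l) \<noteq> 0" if "k \<le> ?N" for k using dnz that by auto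
    define T where "T k = diagm ?N (\<lambda>j. if j < k then d j else if j = k then 1 / (\<Prod>l<k. d l) else 1)" for k
    have step: "T (Suc k) = T k * coroot ?N k (\<Prod>l<Suc k. d l)" if "Suc k < ?N" for k
      unfolding T_def coroot_def diagm_mult
      by (rule diagm_cong) (use pnz[of k] dnz[of k] that in \<open>auto simp: less_Suc_eq\<close>)
    have T0: "T 0 = 1\<^sub>m ?N" unfolding T_def by (rule diagm_one) simp
    have TB: "k < ?N \<Longrightarrow> T k \<in> std_borel ?N \<and> \<omega> (T k) = (\<Prod>i<k. (\<Prod>l<Suc i. d l) ^ a i)" for k
    proof (induction k)
      case 0
      then show ?case using T0 std_borel_one left_char_one[OF n si] by simp
    next
      case (Suc k)
      have C: "coroot ?N k (\<Prod>l<Suc k. d l) \<in> std_borel ?N"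
        by (rule coroot_std_borel[OF Suc.prems pnz]) (use Suc.prems in simp)
      have IH: "T k \<in> std_borel ?N" "\<omega> (T k) = (\<Prod>i<k. (\<Prod>l<Suc i. d l) ^ a i)" using Suc by auto
      show ?case
        unfolding step[OF Suc.prems] left_char_mult[OF n si IH(1) C] IH(2)
        using std_borel_mult[OF IH(1) C] a[OF Suc.prems pnz, of "Suc k"] Suc.prems by simp
    qed
    have N1: "?N - 1 < ?N" "Suc (?N - 1) = ?N" using n by linarith+
    have "T (?N - 1) = diagm ?N d"
      unfolding T_def
    proof (rule diagm_cong)
      fix i assume i: "i < ?N"
      have "(\<Prod>l<?N - 1. d l) * d (?N - 1) = 1" using d prod.lessThan_Suc[of d "?N - 1"] N1(2) by simp
      then have "1 / (\<Prod>l<?N - 1. d l) = d (?N - 1)" using pnz[of "?N - 1"] by (simp add: field_simps)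
      moreover have "\<not> i < ?N - 1 \<Longrightarrow> i = ?N - 1" using i by linarith
      ultimately show "(if i < ?N - 1 then d i else if i = ?N - 1 then 1 / (\<Prod>l<?N - 1. d l) else 1) = d i"
        by (cases "i < ?N - 1") (simp_all only: if_True if_False not_False_eq_True refl)
    qed
    then have "\<omega> (diagm ?N d) = (\<Prod>i<?N - 1. (\<Prod>l<Suc i. d l) ^ a i)" using TB[OF N1(1)] by simp
    also have "\<dots> = (\<Prod>i\<in>{1..<?N}. (\<Prod>k<i. d k) ^ a' i)"
      by (rule prod.reindex_bij_witness[of _ "\<lambda>i. i - 1" Suc]) (auto simp: a'_def)
    finally show ?thesis .
  qed
  have "\<chi> (diagm ?N d) * d 0 ^ (\<Sum>i | i \<in> {1..<?N} \<and> odd i. a' i) = 1" if d: "diagm ?N d \<in> std_Sp n" for d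
  proof -
    have d0: "d 0 \<noteq> 0" using d n unfolding diagm_std_Sp by (metis mult_eq_0_iff mult_pos_pos zero_less_numeral zero_neq_one)
    define e where "e i = (if even i then d 0 else 1 / d 0)" for i :: nat
    have e: "(\<Prod>k<i. e k) = (if odd i then d 0 else 1)" for i
      using d0 by (induction i) (auto simp: e_def)
    have "\<omega> (diagm ?N e) = (\<Prod>i\<in>{1..<?N}. (if odd i then d 0 else 1) ^ a' i)"
      using wd[of e] e by simp
    also have "\<dots> = (\<Prod>i | i \<in> {1..<?N} \<and> odd i. d 0 ^ a' i)"
      by (subst prod.inter_filter) (auto intro: prod.cong)
    also have "\<dots> = d 0 ^ (\<Sum>i | i \<in> {1..<?N} \<and> odd i. a' i)" by (simp add: power_sum)
    finally have "\<omega> (diagm ?N e) = d 0 ^ (\<Sum>i | i \<in> {1..<?N} \<and> odd i. a' i)" .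
    moreover have "\<chi> (diagm ?N (\<lambda>i. if i < n then d 0 else 1 / d 0)) * \<omega> (diagm ?N (\<lambda>i. if even i then d 0 else 1 / d 0)) = 1"
      by (rule stabilizer_relation[OF n si f g d0])
    ultimately show ?thesis using torus_char[OF n si d] by (simp add: e_def[abs_def])
  qed
  then show ?thesis using wd by blast
qed

end

section \<open>Passage to the given basis\<close>

lemma GL_carrier: "carrier (GL N) = {A \<in> carrier_mat N N. det A \<noteq> 0}"
proof -
  have "carrier (GL N) = Units (ring_mat TYPE(complex) N ())" by (simp add: GL_def units_of_carrier)
  also have "\<dots> = {A \<in> carrier_mat N N. det A \<noteq> 0}"
    using unit_imp_det_non_zero[of _ N "()"] det_non_zero_imp_unit[of _ N "()"]
    by (auto simp: Units_def ring_mat_def)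
  finally show ?thesis .
qed

lemma GL_mult [simp]: "mult (GL N) = (*)" and GL_one [simp]: "one (GL N) = 1\<^sub>m N"
  by (simp_all add: GL_def units_of_mult units_of_one ring_mat_def)

lemma GL_group: "group (GL N)"
proof -
  interpret ring "ring_mat TYPE(complex) N ()" by (rule ring_mat)
  show ?thesis unfolding GL_def by (rule units_group)
qed

lemma GL_inv:
  assumes "A \<in> carrier_mat N N" "B \<in> carrier_mat N N" "A * B = 1\<^sub>m N"
  shows "inv\<^bsub>GL N\<^esub> A = B"
proof -
  interpret group "GL N" by (rule GL_group)
  have BA: "B * A = 1\<^sub>m N" by (rule mat_mult_left_right_inverse[OF assms])
  have "det A * det B = 1" using det_mult[OF assms(1,2)] assms(3) by simp
  then have "A \<in> carrier (GL N)" "B \<in> carrier (GL N)" using assms by (auto simp: GL_carrier)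
  then show ?thesis using BA by (intro inv_equality) simp_all
qed

lemma line_stab_mult:
  assumes A: "A \<in> line_stab n" and B: "B \<in> line_stab n"
  shows "A * B \<in> line_stab n"
proof -
  have S: "A \<in> std_Sp n" "B \<in> std_Sp n" using A B by (auto simp: line_stab_def)
  have "(A * B) $$ (r, 2 * n - 1) = 0" if r: "r < 2 * n - 1" for r
  proof -
    have l: "r < 2 * n" "2 * n - 1 < 2 * n" using r by linarith+
    have "(A * B) $$ (r, 2 * n - 1) = (\<Sum>l<2 * n. A $$ (r, l) * B $$ (l, 2 * n - 1))"
      by (rule index_mult_sum[OF std_Sp_carrier[OF S(1)] std_Sp_carrier[OF S(2)] l])
    also have "\<dots> = 0"
    proof (intro sum.neutral ballI)
      fix l assume "l \<in> {..<2 * n}"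
      then show "A $$ (r, l) * B $$ (l, 2 * n - 1) = 0"
        using A B r by (cases "l = 2 * n - 1") (auto simp: line_stab_def)
    qed
    finally show ?thesis .
  qed
  then show ?thesis using std_Sp_mult[OF S] by (simp add: line_stab_def)
qed

lemma line_stab_inv:
  assumes A: "A \<in> line_stab n" and n: "0 < n"
  shows "sp_inv n A \<in> line_stab n"
proof -
  have S: "A \<in> std_Sp n" using A by (auto simp: line_stab_def)
  have "sp_inv n A $$ (r, 2 * n - 1) = 0" if r: "r < 2 * n - 1" for r
  proof -
    have l: "r < 2 * n" "2 * n - 1 < 2 * n" "2 * n - 1 - (2 * n - 1) = 0" "2 * n - 1 - r < 2 * n" "2 * n - 1 - r \<noteq> 0"
      using r by linarith+
    have "A $$ (0, 2 * n - 1 - r) = 0"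
      using line_stab_first_row[OF A n l(4)] line_stab_last_nonzero[OF A n] l(5) by simp
    then show ?thesis unfolding sp_inv_index[OF std_Sp_carrier[OF S] l(1,2)] l(3) by simp
  qed
  then show ?thesis using sp_inv_std_Sp[OF S] by (simp add: line_stab_def)
qed

lemma diagonal_mat_diagm: "diagonal_mat (diagm N d)"
  by (simp add: diagonal_mat_def)

lemma lower_tri_line_stab: "A \<in> std_Sp n \<Longrightarrow> lower_tri A \<Longrightarrow> A \<in> line_stab n"
  using std_Sp_carrier[of A n] by (auto simp: line_stab_def lower_tri_def)

context
  fixes n :: nat and \<Omega> S Si :: "complex mat"
  assumes n: "2 \<le> n" and \<Omega>: "\<Omega> \<in> carrier_mat (2 * n) (2 * n)"
    and S: "S \<in> carrier_mat (2 * n) (2 * n)" "transpose_mat S * \<Omega> * S = bourbaki_form n"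
    and Si: "Si \<in> carrier_mat (2 * n) (2 * n)" "S * Si = 1\<^sub>m (2 * n)" "Si * S = 1\<^sub>m (2 * n)"
begin

abbreviation (input) to_coords :: "complex mat \<Rightarrow> complex mat" where "to_coords \<equiv> in_basis (2 * n) S"

definition from_coords :: "complex mat \<Rightarrow> complex mat" where "from_coords A = S * A * Si"

lemma to_coords_eq: "to_coords A = Si * A * S"
  by (simp add: in_basis_def GL_inv[OF S(1) Si(1,2)])

lemma to_coords_carrier: "A \<in> carrier_mat (2 * n) (2 * n) \<Longrightarrow> to_coords A \<in> carrier_mat (2 * n) (2 * n)"
  unfolding to_coords_eq using S(1) Si(1) by (meson mult_carrier_mat)

lemma from_coords_carrier: "A \<in> carrier_mat (2 * n) (2 * n) \<Longrightarrow> from_coords A \<in> carrier_mat (2 * n) (2 * n)"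
  unfolding from_coords_def using S(1) Si(1) by (meson mult_carrier_mat)

lemma conj_mult:
  assumes "C \<in> carrier_mat N N" "D \<in> carrier_mat N N" "D * C = 1\<^sub>m N"
    and "A \<in> carrier_mat N N" "B \<in> carrier_mat N N"
  shows "C * (A * B) * D = (C * A * D) * (C * B * (D :: complex mat))"
proof -
  note m = mult_carrier_mat[of _ N N _ N] and a = assoc_mult_mat[of _ N N _ N _ N]
  have "(C * A * D) * (C * B * D) = C * A * (D * (C * (B * D)))"
    using assms by (simp add: a m)
  also have "D * (C * (B * D)) = (D * C) * (B * D)"
    by (rule assoc_mult_mat[symmetric, OF assms(2,1) mult_carrier_mat[OF assms(5,2)]])
  also have "\<dots> = B * D" unfolding assms(3) using assms m by (simp add: left_mult_one_mat[of _ N N])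
  also have "C * A * (B * D) = C * (A * B) * D" using assms by (simp add: a m)
  finally show ?thesis ..
qed

lemma conj_conj:
  assumes "C \<in> carrier_mat N N" "D \<in> carrier_mat N N" "D * C = 1\<^sub>m N"
    and "A \<in> carrier_mat N N"
  shows "D * (C * A * D) * (C :: complex mat) = A"
proof -
  note m = mult_carrier_mat[of _ N N _ N] and a = assoc_mult_mat[of _ N N _ N _ N]
  have "D * (C * A * D) * C = (D * C) * (A * (D * C))" using assms(1,2,4) by (simp add: a m)
  also have "\<dots> = A" unfolding assms(3) using assms(4) by simp
  finally show ?thesis .
qed

lemma to_coords_mult: "A \<in> carrier_mat (2 * n) (2 * n) \<Longrightarrow> B \<in> carrier_mat (2 * n) (2 * n) \<Longrightarrow> to_coords (A * B) = to_coords A * to_coords B"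
  unfolding to_coords_eq by (rule conj_mult[OF Si(1) S(1) Si(2)])

lemma from_coords_mult: "A \<in> carrier_mat (2 * n) (2 * n) \<Longrightarrow> B \<in> carrier_mat (2 * n) (2 * n) \<Longrightarrow> from_coords (A * B) = from_coords A * from_coords B"
  unfolding from_coords_def by (rule conj_mult[OF S(1) Si(1,3)])

lemma to_coords_from_coords [simp]: "A \<in> carrier_mat (2 * n) (2 * n) \<Longrightarrow> to_coords (from_coords A) = A"
  unfolding to_coords_eq from_coords_def by (rule conj_conj[OF S(1) Si(1,3)])

lemma from_coords_to_coords [simp]: "A \<in> carrier_mat (2 * n) (2 * n) \<Longrightarrow> from_coords (to_coords A) = A"
  unfolding to_coords_eq from_coords_def by (rule conj_conj[OF Si(1) S(1) Si(2)])

lemma to_coords_one: "to_coords (1\<^sub>m (2 * n)) = 1\<^sub>m (2 * n)"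
  unfolding to_coords_eq using S Si by simp

lemma from_coords_one: "from_coords (1\<^sub>m (2 * n)) = 1\<^sub>m (2 * n)"
  unfolding from_coords_def using S Si by simp

lemma to_coords_det: "A \<in> carrier_mat (2 * n) (2 * n) \<Longrightarrow> det (to_coords A) = det A"
proof -
  assume A: "A \<in> carrier_mat (2 * n) (2 * n)"
  have "det Si * det S = 1" using det_mult[OF Si(1) S(1)] Si(3) by simp
  moreover have "det (to_coords A) = det Si * det A * det S"
    unfolding to_coords_eq using det_mult[OF mult_carrier_mat[OF Si(1) A] S(1)] det_mult[OF Si(1) A] by simp
  ultimately show ?thesis by (simp add: mult_ac)
qed

lemma SL_iff: "A \<in> SL (2 * n) \<longleftrightarrow> A \<in> carrier_mat (2 * n) (2 * n) \<and> to_coords A \<in> std_SL (2 * n)"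
  using to_coords_det[of A] to_coords_carrier[of A] by (auto simp: SL_def GL_carrier std_SL_def)

lemma borel_iff: "A \<in> borel (2 * n) S (SL (2 * n)) \<longleftrightarrow> A \<in> carrier_mat (2 * n) (2 * n) \<and> to_coords A \<in> std_borel (2 * n)"
  by (auto simp: borel_def SL_iff std_borel_def)

lemma Sp_iff: "A \<in> Sp (2 * n) \<Omega> \<longleftrightarrow> A \<in> carrier_mat (2 * n) (2 * n) \<and> to_coords A \<in> std_Sp n"
proof (cases "A \<in> carrier_mat (2 * n) (2 * n)")
  case A: True
  let ?N = "2 * n"
  let ?Y = "to_coords A" and ?S = "transpose_mat S" and ?A = "transpose_mat A"
  have Y: "?Y \<in> carrier_mat ?N ?N" by (rule to_coords_carrier[OF A])
  have t: "?S \<in> carrier_mat ?N ?N" "?A \<in> carrier_mat ?N ?N" "transpose_mat ?Y \<in> carrier_mat ?N ?N"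
    using S(1) A Y by auto
  have SY: "S * ?Y = A * S"
  proof -
    have "S * ?Y = S * (Si * (A * S))"
      unfolding to_coords_eq by (simp add: assoc_mult_mat[OF Si(1) A S(1)])
    also have "\<dots> = (S * Si) * (A * S)"
      by (rule assoc_mult_mat[symmetric, OF S(1) Si(1) mult_carrier_mat[OF A S(1)]])
    also have "\<dots> = A * S" unfolding Si(2) by (rule left_mult_one_mat[OF mult_carrier_mat[OF A S(1)]])
    finally show ?thesis .
  qed
  have "transpose_mat ?Y * bourbaki_form n * ?Y =
      transpose_mat ?Y * (?S * \<Omega> * transpose_mat ?S) * transpose_mat (transpose_mat ?Y)"
    using S(2) by simp
  also have "\<dots> = (transpose_mat ?Y * ?S) * \<Omega> * transpose_mat (transpose_mat ?Y * ?S)"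
    by (rule gram_mult[symmetric, OF t(3,1) \<Omega>])
  also have "transpose_mat ?Y * ?S = ?S * ?A"
    using transpose_mult[OF S(1) Y] transpose_mult[OF A S(1)] SY by simp
  also have "(?S * ?A) * \<Omega> * transpose_mat (?S * ?A) = ?S * (?A * \<Omega> * transpose_mat ?A) * transpose_mat ?S"
    by (rule gram_mult[OF t(1,2) \<Omega>])
  finally have key: "transpose_mat ?Y * bourbaki_form n * ?Y = ?S * (?A * \<Omega> * A) * S" by simp
  have Z: "?A * \<Omega> * A \<in> carrier_mat ?N ?N" using t(2) A \<Omega> by (meson mult_carrier_mat)
  have cancel: "?S * V * S = ?S * W * S \<Longrightarrow> V = W" if "V \<in> carrier_mat ?N ?N" "W \<in> carrier_mat ?N ?N" for V W
  proof -
    have st: "transpose_mat Si * ?S = 1\<^sub>m ?N" using transpose_mult[OF S(1) Si(1)] Si(2) by simp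
    have ti: "transpose_mat Si \<in> carrier_mat ?N ?N" using Si(1) by simp
    have *: "transpose_mat Si * (?S * V * S) * Si = V" if V: "V \<in> carrier_mat ?N ?N" for V
      using gram_mult[OF ti t(1) V] V unfolding st by simp
    show "V = W" if eq: "?S * V * S = ?S * W * S"
      using *[OF \<open>V \<in> carrier_mat ?N ?N\<close>] *[OF \<open>W \<in> carrier_mat ?N ?N\<close>] unfolding eq by (rule trans[OF sym])
  qed
  have dn: "det A \<noteq> 0" if "to_coords A \<in> std_Sp n" using std_Sp_det_nonzero[OF that] to_coords_det[OF A] by simp
  have dn': "det A \<noteq> 0" if "A \<in> Sp (2 * n) \<Omega>" using that by (simp add: Sp_def GL_carrier)
  show ?thesis
  proof
    assume H: "A \<in> Sp (2 * n) \<Omega>"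
    then have "?A * \<Omega> * A = \<Omega>" by (simp add: Sp_def)
    then have "transpose_mat ?Y * bourbaki_form n * ?Y = bourbaki_form n" using key S(2) by simp
    then show "A \<in> carrier_mat ?N ?N \<and> to_coords A \<in> std_Sp n" using A Y by (simp add: std_Sp_iff)
  next
    assume H: "A \<in> carrier_mat ?N ?N \<and> to_coords A \<in> std_Sp n"
    then have "transpose_mat ?Y * bourbaki_form n * ?Y = bourbaki_form n" by (simp add: std_Sp_iff)
    then have "?S * (?A * \<Omega> * A) * S = ?S * \<Omega> * S" using key S(2) by simp
    then have "?A * \<Omega> * A = \<Omega>" by (rule cancel[OF Z \<Omega>])
    then show "A \<in> Sp (2 * n) \<Omega>" using A dn H by (simp add: Sp_def GL_carrier)
  qed
qed (auto simp: Sp_def GL_carrier)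

abbreviation (input) TG where "TG \<equiv> torus (2 * n) S (SL (2 * n))"
abbreviation (input) TS where "TS \<equiv> torus (2 * n) S (Sp (2 * n) \<Omega>)"

lemma TG_iff: "A \<in> TG \<longleftrightarrow> A \<in> carrier_mat (2 * n) (2 * n) \<and> (\<exists>d. to_coords A = diagm (2 * n) d \<and> (\<Prod>i<2 * n. d i) = 1)"
proof
  assume A: "A \<in> TG"
  then have c: "A \<in> carrier_mat (2 * n) (2 * n)" "to_coords A \<in> std_SL (2 * n)" by (auto simp: torus_def SL_iff)
  have "to_coords A = diagm (2 * n) (\<lambda>i. to_coords A $$ (i, i))"
    by (rule diagonal_diagm[OF to_coords_carrier[OF c(1)]]) (use A in \<open>simp add: torus_def\<close>)
  then show "A \<in> carrier_mat (2 * n) (2 * n) \<and> (\<exists>d. to_coords A = diagm (2 * n) d \<and> (\<Prod>i<2 * n. d i) = 1)"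
    using c by (intro conjI exI) (auto simp: std_SL_def det_diagm[symmetric])
next
  assume "A \<in> carrier_mat (2 * n) (2 * n) \<and> (\<exists>d. to_coords A = diagm (2 * n) d \<and> (\<Prod>i<2 * n. d i) = 1)"
  then obtain d where d: "A \<in> carrier_mat (2 * n) (2 * n)" "to_coords A = diagm (2 * n) d" "(\<Prod>i<2 * n. d i) = 1" by blast
  then have "A \<in> SL (2 * n)" by (simp add: SL_iff std_SL_def det_diagm)
  then show "A \<in> TG" using diagonal_mat_diagm d(2) by (simp add: torus_def)
qed

lemma TS_iff: "A \<in> TS \<longleftrightarrow> A \<in> carrier_mat (2 * n) (2 * n) \<and> (\<exists>d. to_coords A = diagm (2 * n) d \<and> diagm (2 * n) d \<in> std_Sp n)"
proof
  assume A: "A \<in> TS"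
  then have c: "A \<in> carrier_mat (2 * n) (2 * n)" "to_coords A \<in> std_Sp n" by (auto simp: torus_def Sp_iff)
  have "to_coords A = diagm (2 * n) (\<lambda>i. to_coords A $$ (i, i))"
    by (rule diagonal_diagm[OF to_coords_carrier[OF c(1)]]) (use A in \<open>simp add: torus_def\<close>)
  then show "A \<in> carrier_mat (2 * n) (2 * n) \<and> (\<exists>d. to_coords A = diagm (2 * n) d \<and> diagm (2 * n) d \<in> std_Sp n)"
    using c by metis
next
  assume "A \<in> carrier_mat (2 * n) (2 * n) \<and> (\<exists>d. to_coords A = diagm (2 * n) d \<and> diagm (2 * n) d \<in> std_Sp n)"
  then obtain d where d: "A \<in> carrier_mat (2 * n) (2 * n)" "to_coords A = diagm (2 * n) d" "diagm (2 * n) d \<in> std_Sp n" by blast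
  then have "A \<in> Sp (2 * n) \<Omega>" by (simp add: Sp_iff)
  then show "A \<in> TS" using diagonal_mat_diagm d(2) by (simp add: torus_def)
qed

lemma TG_mult:
  assumes "A \<in> TG" "B \<in> TG"
  shows "A * B \<in> TG"
proof -
  from assms obtain d e where c: "A \<in> carrier_mat (2 * n) (2 * n)" "B \<in> carrier_mat (2 * n) (2 * n)"
    and d: "to_coords A = diagm (2 * n) d" "(\<Prod>i<2 * n. d i) = 1" and e: "to_coords B = diagm (2 * n) e" "(\<Prod>i<2 * n. e i) = 1"
    by (auto simp: TG_iff)
  have "to_coords (A * B) = diagm (2 * n) (\<lambda>i. d i * e i)" using c d e by (simp add: to_coords_mult diagm_mult)
  moreover have "(\<Prod>i<2 * n. d i * e i) = 1" using d(2) e(2) by (simp add: prod.distrib)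
  ultimately show ?thesis unfolding TG_iff using c by (metis mult_carrier_mat)
qed

lemma TS_mult:
  assumes "A \<in> TS" "B \<in> TS"
  shows "A * B \<in> TS"
proof -
  from assms obtain d e where c: "A \<in> carrier_mat (2 * n) (2 * n)" "B \<in> carrier_mat (2 * n) (2 * n)"
    and d: "to_coords A = diagm (2 * n) d" "diagm (2 * n) d \<in> std_Sp n" and e: "to_coords B = diagm (2 * n) e" "diagm (2 * n) e \<in> std_Sp n"
    by (auto simp: TS_iff)
  have "to_coords (A * B) = diagm (2 * n) (\<lambda>i. d i * e i)" using c d e by (simp add: to_coords_mult diagm_mult)
  moreover have "diagm (2 * n) (\<lambda>i. d i * e i) \<in> std_Sp n" using std_Sp_mult[OF d(2) e(2)] by (simp add: diagm_mult)
  ultimately show ?thesis using c by (auto simp: TS_iff)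
qed

lemma opp_borel_iff:
  "A \<in> opp_borel (2 * n) S (Sp (2 * n) \<Omega>) \<longleftrightarrow> A \<in> carrier_mat (2 * n) (2 * n) \<and> to_coords A \<in> std_Sp n \<and> lower_tri (to_coords A)"
proof -
  have "upper_triangular (transpose_mat C) \<longleftrightarrow> lower_tri C" if "C \<in> carrier_mat (2 * n) (2 * n)" for C :: "complex mat"
    using that by (auto simp: upper_triangular_def lower_tri_def)
  then show ?thesis using to_coords_carrier[of A] by (auto simp: opp_borel_def Sp_iff)
qed

lemma TS_inv:
  assumes "A \<in> TS" "to_coords A = diagm (2 * n) d"
  shows "inv\<^bsub>GL (2 * n)\<^esub> A = from_coords (diagm (2 * n) (\<lambda>i. 1 / d i))"
proof (rule GL_inv)
  have c: "A \<in> carrier_mat (2 * n) (2 * n)" "diagm (2 * n) d \<in> std_Sp n" using assms by (auto simp: TS_iff)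
  show "A \<in> carrier_mat (2 * n) (2 * n)" by fact
  show "from_coords (diagm (2 * n) (\<lambda>i. 1 / d i)) \<in> carrier_mat (2 * n) (2 * n)" by (rule from_coords_carrier) simp
  have "d i * d (2 * n - 1 - i) = 1" if "i < 2 * n" for i using c(2) that by (simp add: diagm_std_Sp)
  then have nz: "d i \<noteq> 0" if "i < 2 * n" for i using that by fastforce
  have "A * from_coords (diagm (2 * n) (\<lambda>i. 1 / d i)) = from_coords (diagm (2 * n) d * diagm (2 * n) (\<lambda>i. 1 / d i))"
    using c(1) assms(2) from_coords_to_coords[OF c(1)] by (simp add: from_coords_mult)
  also have "diagm (2 * n) d * diagm (2 * n) (\<lambda>i. 1 / d i) = 1\<^sub>m (2 * n)"
    unfolding diagm_mult by (rule diagm_one) (use nz in simp)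
  finally show "A * from_coords (diagm (2 * n) (\<lambda>i. 1 / d i)) = 1\<^sub>m (2 * n)" by (simp add: from_coords_one)
qed

text \<open>
  A torus element that \<open>\<beta>\<^sub>1\<close> maps to 2 and every other simple root to 1.
\<close>

definition special_t :: "complex mat" where
  "special_t = from_coords (diagm (2 * n) (\<lambda>i. if i = 0 then 2 else if i = 2 * n - 1 then 1 / 2 else 1))"

lemma special_t:
  "special_t \<in> TS" "to_coords special_t = diagm (2 * n) (\<lambda>i. if i = 0 then 2 else if i = 2 * n - 1 then 1 / 2 else 1)"
proof -
  let ?d = "\<lambda>i. if i = 0 then 2 else if i = 2 * n - 1 then 1 / 2 else (1 :: complex)"
  show to_coords: "to_coords special_t = diagm (2 * n) ?d" by (simp add: special_t_def)
  have "?d i * ?d (2 * n - 1 - i) = 1" if i: "i < 2 * n" for i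
  proof -
    have "(2 * n - 1 - i = 0) = (i = 2 * n - 1)" "(2 * n - 1 - i = 2 * n - 1) = (i = 0)" "2 * n - 1 \<noteq> 0"
      using i n by linarith+
    then show ?thesis by (cases "i = 0"; cases "i = 2 * n - 1") simp_all
  qed
  then have "diagm (2 * n) ?d \<in> std_Sp n" unfolding diagm_std_Sp by blast
  then show "special_t \<in> TS" using to_coords by (auto simp: TS_iff special_t_def intro!: from_coords_carrier)
qed

abbreviation (input) \<beta> where "\<beta> \<equiv> simple_root_C n S (Sp (2 * n) \<Omega>)"

lemma simple_root_special:
  "\<beta> 1 special_t = 2" "2 \<le> i \<Longrightarrow> i \<le> n \<Longrightarrow> \<beta> i special_t = 1"
proof -
  have e: "eps (2 * n) S k special_t = (if k = 1 then 2 else 1)" if "1 \<le> k" "k \<le> n" for k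
  proof -
    have "k - 1 < 2 * n" "k - 1 \<noteq> 2 * n - 1" "(k - 1 = 0) = (k = 1)" using that by linarith+
    then show ?thesis unfolding eps_def special_t(2) by simp
  qed
  show "\<beta> 1 special_t = 2" using special_t(1) n e[of 1] e[of "Suc (Suc 0)"] by (simp add: simple_root_C_def)
  show "\<beta> i special_t = 1" if "2 \<le> i" "i \<le> n"
    using special_t(1) that e[of i] e[of "i + 1"] by (cases "i = n") (simp_all add: simple_root_C_def)
qed

lemma simple_root_ne:
  assumes "2 \<le> i" "i \<le> n"
  shows "\<beta> i \<noteq> \<beta> 1"
proof
  assume "\<beta> i = \<beta> 1"
  then have "\<beta> i special_t = 2" using simple_root_special(1) by simp
  then show False using simple_root_special(2)[OF assms] by simp
qed

text \<open>
  Conjugation by \<open>special_t\<close> fixes the root subgroup but multiplies the entries of the last column above the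
  diagonal by 2 or 4, so these vanish.
\<close>

lemma root_subgroup_line_stab:
  assumes A: "A \<in> root_subgroup (2 * n) (Sp (2 * n) \<Omega>) TS (\<beta> i)" and i: "2 \<le> i" "i \<le> n"
  shows "A \<in> carrier_mat (2 * n) (2 * n) \<and> to_coords A \<in> line_stab n"
proof -
  let ?N = "2 * n"
  let ?d = "\<lambda>i. if i = 0 then 2 else if i = ?N - 1 then 1 / 2 else (1 :: complex)"
  obtain u :: "complex \<Rightarrow> complex mat" and x where u: "A = u x" "range u \<subseteq> Sp ?N \<Omega>"
    "\<And>t x. t \<in> TS \<Longrightarrow> t * u x * inv\<^bsub>GL ?N\<^esub> t = u (\<beta> i t * x)"
    using A by (auto simp: root_subgroup_def)
  have H: "A \<in> carrier_mat ?N ?N" "to_coords A \<in> std_Sp n" using u(1,2) Sp_iff by auto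
  note Y = to_coords_carrier[OF H(1)]
  have tc: "special_t \<in> carrier_mat ?N ?N" using special_t(1) by (simp add: TS_iff)
  have cc: "from_coords (diagm ?N (\<lambda>i. 1 / ?d i)) \<in> carrier_mat ?N ?N" by (rule from_coords_carrier) simp
  have "special_t * A * from_coords (diagm ?N (\<lambda>i. 1 / ?d i)) = A"
    using u(3)[OF special_t(1), of x] simple_root_special(2)[OF i] TS_inv[OF special_t] u(1) by simp
  then have "to_coords (special_t * A * from_coords (diagm ?N (\<lambda>i. 1 / ?d i))) = to_coords A" by (simp only:)
  moreover have "to_coords (special_t * A * from_coords (diagm ?N (\<lambda>i. 1 / ?d i))) = diagm ?N ?d * to_coords A * diagm ?N (\<lambda>i. 1 / ?d i)"
    by (simp only: to_coords_mult[OF mult_carrier_mat[OF tc H(1)] cc] to_coords_mult[OF tc H(1)] special_t(2) to_coords_from_coords[OF diagm_carrier])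
  ultimately have eq: "diagm ?N ?d * to_coords A * diagm ?N (\<lambda>i. 1 / ?d i) = to_coords A" by (simp only:)
  have "to_coords A $$ (r, ?N - 1) = 0" if r: "r < ?N - 1" for r
  proof -
    have l: "r < ?N" "?N - 1 < ?N" "r \<noteq> ?N - 1" "?N - 1 \<noteq> 0" using r by linarith+
    have "(diagm ?N ?d * to_coords A * diagm ?N (\<lambda>i. 1 / ?d i)) $$ (r, ?N - 1) = ?d r * to_coords A $$ (r, ?N - 1) * (1 / ?d (?N - 1))"
      using diagm_right[OF mult_carrier_mat[OF diagm_carrier Y] l(1,2), of ?d] diagm_left[OF Y l(1,2), of ?d] by simp
    then have "?d r * to_coords A $$ (r, ?N - 1) * (1 / ?d (?N - 1)) = to_coords A $$ (r, ?N - 1)" unfolding eq by simp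
    then show ?thesis using l by (cases "r = 0") simp_all
  qed
  then show ?thesis using H by (simp add: line_stab_def)
qed

lemma root_elt_root_subgroup:
  assumes j: "1 \<le> j" "j < n"
  shows "from_coords (root_elt n j s) \<in> root_subgroup (2 * n) (Sp (2 * n) \<Omega>) TS (\<beta> (j + 1))"
proof -
  let ?N = "2 * n"
  define u where "u x = from_coords (root_elt n j x)" for x
  have j': "j < ?N - 1" using j by linarith
  have uc: "u x \<in> carrier_mat ?N ?N" for x unfolding u_def by (rule from_coords_carrier) simp
  have "range u \<subseteq> Sp ?N \<Omega>"
    using root_elt_std_Sp[OF j'] uc by (auto simp: Sp_iff u_def)
  moreover have "u (x + y) = u x * u y" for x y
    unfolding u_def by (simp add: from_coords_mult[symmetric] root_elt_add[OF j'])
  moreover have "\<exists>p. \<forall>x. u x $$ (a, b) = poly p x" if ab: "a < ?N" "b < ?N" for a b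
  proof -
    obtain q where q: "q \<in> poly_funs ?N" "\<And>A. A \<in> carrier_mat ?N ?N \<Longrightarrow> (S * A * Si) $$ (a, b) = q A"
      using poly_funs_conj[OF poly_funs.entry[OF ab] S(1) Si(1)] by auto
    have "\<exists>p. \<forall>x. q (root_elt n j x) = poly p x"
    proof (rule poly_funs_curve[OF q(1)])
      fix r c assume rc: "r < ?N" "c < ?N"
      show "\<exists>p. \<forall>x. root_elt n j x $$ (r, c) = poly p x"
        unfolding root_elt_index[OF rc j']
        by (intro exI[of _ "[:if c = r then 1 else 0, (if c = j + 1 then if r = j then 1 else 0 else 0)
          + (if c = 2 * n - 1 - j then if j \<noteq> n - 1 \<and> r = 2 * n - 2 - j then - 1 else 0 else 0):]"])
          (simp add: distrib_left if_distrib[of "\<lambda>y. _ * y"] cong: if_cong)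
    qed
    then show ?thesis using q(2) by (simp add: u_def from_coords_def)
  qed
  moreover have "t * u x * inv\<^bsub>GL ?N\<^esub> t = u (\<beta> (j + 1) t * x)" if t: "t \<in> TS" for t x
  proof -
    obtain d where d: "to_coords t = diagm ?N d" "diagm ?N d \<in> std_Sp n" and tc: "t \<in> carrier_mat ?N ?N"
      using t by (auto simp: TS_iff)
    have dd: "d i * d (?N - 1 - i) = 1" if "i < ?N" for i using d(2) that by (simp add: diagm_std_Sp)
    have dnz: "d i \<noteq> 0" if "i < ?N" for i using dd[OF that] by auto
    have "t * u x * inv\<^bsub>GL ?N\<^esub> t = from_coords (diagm ?N d) * from_coords (root_elt n j x) * from_coords (diagm ?N (\<lambda>i. 1 / d i))"
      using TS_inv[OF t d(1)] from_coords_to_coords[OF tc] by (simp add: u_def d(1))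
    also have "\<dots> = from_coords (diagm ?N d * root_elt n j x * diagm ?N (\<lambda>i. 1 / d i))"
      by (simp add: from_coords_mult mult_carrier_mat[OF diagm_carrier root_elt_carrier])
    also have "diagm ?N d * root_elt n j x * diagm ?N (\<lambda>i. 1 / d i) = root_elt n j (\<beta> (j + 1) t * x)"
    proof (rule eq_matI)
      fix r c assume "r < dim_row (root_elt n j (\<beta> (j + 1) t * x))" "c < dim_col (root_elt n j (\<beta> (j + 1) t * x))"
      then have rc: "r < ?N" "c < ?N" by (auto simp: root_elt_def)
      have e: "eps ?N S (j + 1) t = d j" "eps ?N S (j + 2) t = d (j + 1)"
        using j d(1) by (simp_all add: eps_def)
      have b: "\<beta> (j + 1) t = (if j + 1 < n then d j / d (j + 1) else (d j)\<^sup>2)"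
      proof (cases "j + 1 < n")
        case True
        then show ?thesis using t e by (simp add: simple_root_C_def)
      next
        case False
        then have "n = j + 1" using j by simp
        then show ?thesis using t e(1) by (simp add: simple_root_C_def)
      qed
      have 1: "d j / d (j + 1) = \<beta> (j + 1) t"
      proof (cases "j + 1 < n")
        case False
        then have "?N - 1 - j = j + 1" using j by linarith
        then have "d j * d (j + 1) = 1" using dd[of j] j' by simp
        then have "1 / d (j + 1) = d j" using dnz[of "j + 1"] j' by (simp add: field_simps)
        then have "d j / d (j + 1) = d j * d j" by (metis times_divide_eq_right mult_1_right)
        then show ?thesis using b False by (simp add: power2_eq_square)
      next
        case True
        then show ?thesis using b by (simp only: if_True)
      qed
      have 2: "d (?N - 2 - j) / d (?N - 1 - j) = d j / d (j + 1)"
      proof -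
        have l: "j < ?N" "j + 1 < ?N" "?N - 1 - (j + 1) = ?N - 2 - j" using j' by linarith+
        have "d (?N - 1 - j) = 1 / d j" using dd[OF l(1)] dnz[OF l(1)] by (simp add: field_simps)
        moreover have "d (?N - 2 - j) = 1 / d (j + 1)"
          using dd[OF l(2)] dnz[OF l(2)] unfolding l(3) by (simp add: field_simps)
        ultimately show ?thesis by (simp only:) simp
      qed
      have AC: "diagm ?N d * root_elt n j x \<in> carrier_mat ?N ?N"
        by (rule mult_carrier_mat[OF diagm_carrier root_elt_carrier])
      have "(diagm ?N d * root_elt n j x * diagm ?N (\<lambda>i. 1 / d i)) $$ (r, c) = d r * root_elt n j x $$ (r, c) * (1 / d c)"
        unfolding diagm_right[OF AC rc] diagm_left[OF root_elt_carrier rc] ..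
      also have "\<dots> = (d r / d c) * root_elt n j x $$ (r, c)" by simp
      also have "\<dots> = root_elt n j (\<beta> (j + 1) t * x) $$ (r, c)"
      proof -
        consider "r = c" | "r \<noteq> c" "r = j" "c = j + 1"
          | "r \<noteq> c" "\<not> (r = j \<and> c = j + 1)" "j \<noteq> n - 1" "r = ?N - 2 - j" "c = ?N - 1 - j"
          | "r \<noteq> c" "\<not> (r = j \<and> c = j + 1)" "\<not> (j \<noteq> n - 1 \<and> r = ?N - 2 - j \<and> c = ?N - 1 - j)" by blast
        then show ?thesis
        proof cases
          case 1
          then show ?thesis using rc dnz[OF rc(1)] by (simp add: root_elt_def)
        next
          case 2
          then show ?thesis using rc 1 by (simp add: root_elt_def)
        next
          case 3
          have x: "root_elt n j y $$ (r, c) = - y" for y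
            unfolding root_elt_def index_mat(1)[OF rc] prod.case using 3 by (simp only: if_False if_True simp_thms)
          have "d r / d c = \<beta> (j + 1) t" using 3(4,5) 1 2 by (simp only:)
          then show ?thesis unfolding x by simp
        next
          case 4
          have x: "root_elt n j y $$ (r, c) = 0" for y
            unfolding root_elt_def index_mat(1)[OF rc] prod.case using 4 by (simp only: if_False if_True simp_thms)
          show ?thesis unfolding x by simp
        qed
      qed
      finally show "(diagm ?N d * root_elt n j x * diagm ?N (\<lambda>i. 1 / d i)) $$ (r, c) = root_elt n j (\<beta> (j + 1) t * x) $$ (r, c)" .
    qed (auto simp: root_elt_def)
    finally show ?thesis by (simp add: u_def)
  qed
  ultimately show ?thesis
    unfolding root_subgroup_def mem_Collect_eq
    by (intro exI[of _ u]) (auto simp: u_def)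
qed

lemma parabolic_iff:
  "A \<in> parabolic (2 * n) (Sp (2 * n) \<Omega>) TS (opp_borel (2 * n) S (Sp (2 * n) \<Omega>)) (\<beta> ` {1..n}) {\<beta> 1} \<longleftrightarrow>
    A \<in> carrier_mat (2 * n) (2 * n) \<and> to_coords A \<in> line_stab n"
  (is "A \<in> ?P \<longleftrightarrow> _")
proof -
  let ?N = "2 * n" and ?Bm = "opp_borel (2 * n) S (Sp (2 * n) \<Omega>)"
  let ?gens = "?Bm \<union> (\<Union>b\<in>\<beta> ` {1..n} - {\<beta> 1}. root_subgroup (2 * n) (Sp (2 * n) \<Omega>) TS b)"
  have n0: "0 < n" using n by simp
  have P: "?P = generate (GL ?N) ?gens" by (simp add: parabolic_def)
  have gens: "A \<in> carrier_mat ?N ?N \<and> to_coords A \<in> line_stab n" if "A \<in> ?gens" for A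
    using that
  proof
    assume "A \<in> ?Bm"
    then show ?thesis using lower_tri_line_stab by (auto simp: opp_borel_iff)
  next
    assume "A \<in> (\<Union>b\<in>\<beta> ` {1..n} - {\<beta> 1}. root_subgroup (2 * n) (Sp (2 * n) \<Omega>) TS b)"
    then obtain b where b: "b \<in> \<beta> ` {1..n}" "b \<noteq> \<beta> 1" "A \<in> root_subgroup (2 * n) (Sp (2 * n) \<Omega>) TS b" by blast
    from b(1) obtain i where "b = \<beta> i" "i \<in> {1..n}" ..
    with b have i: "i \<in> {1..n}" "\<beta> i \<noteq> \<beta> 1" "A \<in> root_subgroup (2 * n) (Sp (2 * n) \<Omega>) TS (\<beta> i)" by simp_all
    then have "i \<noteq> 1" by blast
    then have "2 \<le> i" "i \<le> n" using i by auto
    then show ?thesis using root_subgroup_line_stab[OF i(3)] by blast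
  qed
  have sub: "A \<in> carrier_mat ?N ?N \<and> to_coords A \<in> line_stab n" if "A \<in> generate (GL ?N) ?gens" for A
    using that
  proof induction
    case one
    then show ?case by (simp add: to_coords_one line_stab_one)
  next
    case (incl h)
    then show ?case by (rule gens)
  next
    case (inv h)
    then have h: "h \<in> carrier_mat ?N ?N" "to_coords h \<in> line_stab n" using gens by blast+
    then have hS: "to_coords h \<in> std_Sp n" by (simp add: line_stab_def)
    note sc = sp_inv_carrier[OF to_coords_carrier[OF h(1)]]
    have "h * from_coords (sp_inv n (to_coords h)) = from_coords (to_coords h * sp_inv n (to_coords h))"
      using from_coords_mult[OF to_coords_carrier[OF h(1)] sc] from_coords_to_coords[OF h(1)] by simp
    then have "h * from_coords (sp_inv n (to_coords h)) = 1\<^sub>m ?N" by (simp add: sp_inv_right[OF hS] from_coords_one)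
    then have "inv\<^bsub>GL ?N\<^esub> h = from_coords (sp_inv n (to_coords h))" by (rule GL_inv[OF h(1) from_coords_carrier[OF sc]])
    then show ?case using from_coords_carrier[OF sc] to_coords_from_coords[OF sc] line_stab_inv[OF h(2) n0] by simp
  next
    case (eng h1 h2)
    then show ?case by (auto simp: to_coords_mult intro!: line_stab_mult)
  qed
  have "line_stab n \<subseteq> {Y. Y \<in> carrier_mat ?N ?N \<and> from_coords Y \<in> generate (GL ?N) ?gens}"
  proof (rule line_stab_generation[OF n0])
    fix Y assume Y: "Y \<in> std_Sp n" "lower_tri Y"
    note c = std_Sp_carrier[OF Y(1)]
    have "from_coords Y \<in> ?Bm" using Y c by (simp add: opp_borel_iff from_coords_carrier)
    then show "Y \<in> {Y. Y \<in> carrier_mat ?N ?N \<and> from_coords Y \<in> generate (GL ?N) ?gens}"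
      using c by (auto intro: generate.incl)
  next
    fix Y Z assume "Y \<in> {Y. Y \<in> carrier_mat ?N ?N \<and> from_coords Y \<in> generate (GL ?N) ?gens}"
      "Z \<in> {Y. Y \<in> carrier_mat ?N ?N \<and> from_coords Y \<in> generate (GL ?N) ?gens}"
    then show "Y * Z \<in> {Y. Y \<in> carrier_mat ?N ?N \<and> from_coords Y \<in> generate (GL ?N) ?gens}"
      using generate.eng[of "from_coords Y" "GL ?N" ?gens "from_coords Z"] by (auto simp: from_coords_mult)
  next
    fix j s assume j: "1 \<le> j" "j < n"
    have "\<beta> (j + 1) \<in> \<beta> ` {1..n} - {\<beta> 1}" using simple_root_ne[of "j + 1"] j by auto
    then have "from_coords (root_elt n j s) \<in> ?gens" using root_elt_root_subgroup[OF j, of s] by blast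
    then show "root_elt n j s \<in> {Y. Y \<in> carrier_mat ?N ?N \<and> from_coords Y \<in> generate (GL ?N) ?gens}"
      by (auto intro: generate.incl)
  qed
  then have "A \<in> generate (GL ?N) ?gens" if "A \<in> carrier_mat ?N ?N" "to_coords A \<in> line_stab n"
    using that from_coords_to_coords[OF that(1)] by auto
  then show ?thesis unfolding P using sub by blast
qed

end

section \<open>Products of character groups\<close>

definition mult_closed :: "complex mat set \<Rightarrow> bool" where
  "mult_closed K \<longleftrightarrow> (\<forall>A\<in>K. \<forall>B\<in>K. A * B \<in> K)"

lemma regular_funs_mult:
  assumes "\<phi> \<in> regular_funs N K" "\<psi> \<in> regular_funs N K"
  shows "(\<lambda>A\<in>K. \<phi> A * \<psi> A) \<in> regular_funs N K"
proof -
  obtain p q where p: "p \<in> poly_funs N" "\<phi> = restrict p K" and q: "q \<in> poly_funs N" "\<psi> = restrict q K"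
    using assms by (auto simp: regular_funs_def)
  have "(\<lambda>A\<in>K. \<phi> A * \<psi> A) = restrict (\<lambda>A. p A * q A) K" by (rule restrict_ext) (simp add: p q)
  then show ?thesis using poly_funs.mult[OF p(1) q(1)] unfolding regular_funs_def by blast
qed

lemma charactersI:
  assumes "p \<in> poly_funs N" "\<And>A. A \<in> K \<Longrightarrow> \<phi> A = p A" "\<phi> \<in> extensional K"
    and "\<And>A. A \<in> K \<Longrightarrow> \<phi> A \<noteq> 0" "\<And>A B. A \<in> K \<Longrightarrow> B \<in> K \<Longrightarrow> \<phi> (A * B) = \<phi> A * \<phi> B"
  shows "\<phi> \<in> characters N K"
proof -
  have "\<phi> = restrict p K"
  proof
    fix A show "\<phi> A = restrict p K A" using assms(2,3) by (cases "A \<in> K") (auto simp: extensional_def)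
  qed
  then show ?thesis using assms unfolding characters_def regular_funs_def by blast
qed

lemma characters_ext: "\<phi> \<in> characters N K \<Longrightarrow> \<phi> \<in> extensional K"
  by (auto simp: characters_def regular_funs_def)

lemma char_group_comm_monoid:
  assumes K: "mult_closed K"
  shows "comm_monoid (char_group N K)"
proof (rule comm_monoidI)
  show "\<one>\<^bsub>char_group N K\<^esub> \<in> carrier (char_group N K)"
    using K unfolding char_group_def mult_closed_def
    by (auto intro!: charactersI[of "\<lambda>_. 1"] poly_funs.const)
next
  fix \<phi> \<psi> assume "\<phi> \<in> carrier (char_group N K)" "\<psi> \<in> carrier (char_group N K)"
  then have c: "\<phi> \<in> characters N K" "\<psi> \<in> characters N K" by (simp_all add: char_group_def)
  have "(\<lambda>A\<in>K. \<phi> A * \<psi> A) \<in> characters N K"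
    unfolding characters_def
    using c regular_funs_mult[of \<phi> N K \<psi>] K by (auto simp: characters_def mult_closed_def)
  then show "\<phi> \<otimes>\<^bsub>char_group N K\<^esub> \<psi> \<in> carrier (char_group N K)" by (simp add: char_group_def)
next
  fix \<phi> assume "\<phi> \<in> carrier (char_group N K)"
  then have "\<phi> \<in> extensional K" by (simp add: char_group_def characters_ext)
  then show "\<one>\<^bsub>char_group N K\<^esub> \<otimes>\<^bsub>char_group N K\<^esub> \<phi> = \<phi>"
    by (auto simp: char_group_def extensional_def)
qed (auto simp: char_group_def mult_ac)

context
  fixes N :: nat and K L :: "complex mat set"
  assumes K: "mult_closed K" and L: "mult_closed L"
begin

abbreviation (input) pair_group where "pair_group \<equiv> char_group N K \<times>\<times> char_group N L"

lemma pair_comm_monoid: "comm_monoid pair_group"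
proof -
  interpret A: comm_monoid "char_group N K" by (rule char_group_comm_monoid[OF K])
  interpret B: comm_monoid "char_group N L" by (rule char_group_comm_monoid[OF L])
  show ?thesis
  proof (rule comm_monoidI)
    fix x y assume "x \<in> carrier pair_group" "y \<in> carrier pair_group"
    then show "x \<otimes>\<^bsub>pair_group\<^esub> y = y \<otimes>\<^bsub>pair_group\<^esub> x"
      by (auto simp: DirProd_def A.m_comm B.m_comm)
  qed (auto simp: DirProd_def A.m_assoc B.m_assoc)
qed

lemma pair_mult: "x \<otimes>\<^bsub>pair_group\<^esub> y = (\<lambda>A\<in>K. fst x A * fst y A, \<lambda>A\<in>L. snd x A * snd y A)"
  by (cases x; cases y) (simp add: DirProd_def char_group_def)

lemma pair_one: "\<one>\<^bsub>pair_group\<^esub> = (\<lambda>A\<in>K. 1, \<lambda>A\<in>L. 1)"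
  by (simp add: DirProd_def char_group_def)

lemma pair_pow:
  "x [^]\<^bsub>pair_group\<^esub> (k :: nat) = (\<lambda>A\<in>K. fst x A ^ k, \<lambda>A\<in>L. snd x A ^ k)"
proof (induction k)
  case 0
  interpret comm_monoid pair_group by (rule pair_comm_monoid)
  show ?case by (simp only: nat_pow_0 pair_one power_0)
next
  case (Suc k)
  interpret comm_monoid pair_group by (rule pair_comm_monoid)
  show ?case unfolding nat_pow_Suc Suc pair_mult by (auto intro!: restrict_ext)
qed

lemma pair_finprod:
  assumes "finite I" "\<And>i. i \<in> I \<Longrightarrow> F i \<in> carrier pair_group"
  shows "finprod pair_group F I = (\<lambda>A\<in>K. \<Prod>i\<in>I. fst (F i) A, \<lambda>A\<in>L. \<Prod>i\<in>I. snd (F i) A)"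
  using assms
proof (induction I rule: finite_induct)
  case empty
  interpret comm_monoid pair_group by (rule pair_comm_monoid)
  show ?case by (simp only: finprod_empty pair_one prod.empty)
next
  case (insert i I)
  interpret comm_monoid pair_group by (rule pair_comm_monoid)
  have "finprod pair_group F (insert i I) = F i \<otimes>\<^bsub>pair_group\<^esub> finprod pair_group F I"
    by (rule finprod_insert) (use insert in auto)
  also have "\<dots> = (\<lambda>A\<in>K. \<Prod>i\<in>insert i I. fst (F i) A, \<lambda>A\<in>L. \<Prod>i\<in>insert i I. snd (F i) A)"
    using insert by (auto simp: pair_mult intro!: restrict_ext)
  finally show ?case .
qed

lemma pair_value:
  assumes "finite I" "\<And>x. x \<in> I \<Longrightarrow> x \<in> carrier pair_group"
  shows "finprod pair_group (\<lambda>x. x [^]\<^bsub>pair_group\<^esub> (a x :: nat)) I =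
    (\<lambda>A\<in>K. \<Prod>x\<in>I. fst x A ^ a x, \<lambda>A\<in>L. \<Prod>x\<in>I. snd x A ^ a x)"
proof -
  interpret comm_monoid pair_group by (rule pair_comm_monoid)
  show ?thesis
    using pair_finprod[OF assms(1) nat_pow_closed[OF assms(2)], of "\<lambda>x. x" a]
    unfolding pair_pow by (simp cong: restrict_cong)
qed

end

section \<open>The extended weight monoid\<close>

lemma std_borel_det_diag: "b \<in> std_borel N \<Longrightarrow> (\<Prod>i<N. b $$ (i, i)) = 1"
  using det_triangular[of b N] by (simp add: std_borel_def std_SL_def)

definition weight_fun :: "nat \<Rightarrow> (nat \<Rightarrow> nat) \<Rightarrow> complex mat \<Rightarrow> complex" where
  "weight_fun N c A = (\<Prod>i\<in>{1..<N}. (\<Prod>k<i. A $$ (k, k)) ^ c i)"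

text \<open>
  The last diagonal entry is the character \<open>-\<varpi>\<^sub>1\<close> of the parabolic subgroup.
\<close>

definition last_fun :: "nat \<Rightarrow> (nat \<Rightarrow> nat) \<Rightarrow> complex mat \<Rightarrow> complex" where
  "last_fun N c A = (\<Prod>i\<in>{1..<N}. (if even i then 1 else A $$ (N - 1, N - 1)) ^ c i)"

definition pfaffian_monomial :: "nat \<Rightarrow> (nat \<Rightarrow> nat) \<Rightarrow> complex mat \<Rightarrow> complex" where
  "pfaffian_monomial n c A = (\<Prod>i\<in>{1..<2 * n}. corner_pfaffian n (2 * n - i) A ^ c i)"

lemma weight_fun_poly: "weight_fun N c \<in> poly_funs N"
  unfolding weight_fun_def by (intro poly_funs_prod poly_funs_power poly_funs.entry) auto

lemma last_fun_poly: "0 < N \<Longrightarrow> last_fun N c \<in> poly_funs N"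
  unfolding last_fun_def
proof (intro poly_funs_prod poly_funs_power)
  fix i assume "0 < N"
  then show "(\<lambda>A. if even i then 1 else A $$ (N - 1, N - 1)) \<in> poly_funs N"
    by (cases "even i") (auto intro: poly_funs.const poly_funs.entry)
qed simp

lemma pfaffian_monomial_poly: "0 < n \<Longrightarrow> pfaffian_monomial n c \<in> poly_funs (2 * n)"
  unfolding pfaffian_monomial_def by (intro poly_funs_prod poly_funs_power corner_pfaffian_poly_fun) auto

lemma weight_fun_mult:
  assumes "a \<in> std_borel N" "b \<in> std_borel N"
  shows "weight_fun N c (a * b) = weight_fun N c a * weight_fun N c b"
proof -
  have "(a * b) $$ (k, k) = a $$ (k, k) * b $$ (k, k)" if "k < N" for k
    by (rule upper_mult(2)[OF _ _ _ _ that]) (use assms in \<open>auto simp: std_borel_def std_SL_def\<close>)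
  then show ?thesis
    unfolding weight_fun_def prod.distrib[symmetric] power_mult_distrib[symmetric]
    by (intro prod.cong refl arg_cong2[where f = power]) auto
qed

lemma weight_fun_nonzero: "b \<in> std_borel N \<Longrightarrow> weight_fun N c b \<noteq> 0"
proof -
  assume b: "b \<in> std_borel N"
  have "b $$ (i, i) \<noteq> 0" if "i < N" for i using std_borel_det_diag[OF b] that by (metis finite_lessThan lessThan_iff prod_zero_iff zero_neq_one)
  then show ?thesis by (auto simp: weight_fun_def)
qed

lemma line_stab_last_mult:
  assumes p: "p \<in> line_stab n" and q: "q \<in> line_stab n" and n: "0 < n"
  shows "(p * q) $$ (2 * n - 1, 2 * n - 1) = p $$ (2 * n - 1, 2 * n - 1) * q $$ (2 * n - 1, 2 * n - 1)"
proof -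
  have S: "p \<in> std_Sp n" "q \<in> std_Sp n" using p q by (auto simp: line_stab_def)
  have l: "2 * n - 1 < 2 * n" using n by linarith
  have "(p * q) $$ (2 * n - 1, 2 * n - 1) = (\<Sum>l<2 * n. p $$ (2 * n - 1, l) * q $$ (l, 2 * n - 1))"
    by (rule index_mult_sum[OF std_Sp_carrier[OF S(1)] std_Sp_carrier[OF S(2)] l l])
  also have "\<dots> = (\<Sum>l<2 * n. if l = 2 * n - 1 then p $$ (2 * n - 1, 2 * n - 1) * q $$ (2 * n - 1, 2 * n - 1) else 0)"
  proof (intro sum.cong refl)
    fix a assume "a \<in> {..<2 * n}"
    then show "p $$ (2 * n - 1, a) * q $$ (a, 2 * n - 1) =
        (if a = 2 * n - 1 then p $$ (2 * n - 1, 2 * n - 1) * q $$ (2 * n - 1, 2 * n - 1) else 0)"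
      using q by (cases "a = 2 * n - 1") (auto simp: line_stab_def)
  qed
  finally show ?thesis using l by simp
qed

lemma last_fun_mult:
  assumes "0 < n" "p \<in> line_stab n" "q \<in> line_stab n"
  shows "last_fun (2 * n) c (p * q) = last_fun (2 * n) c p * last_fun (2 * n) c q"
  unfolding last_fun_def prod.distrib[symmetric] power_mult_distrib[symmetric] line_stab_last_mult[OF assms(2,3,1)]
  by (intro prod.cong refl arg_cong2[where f = power]) simp

lemma last_fun_nonzero: "0 < n \<Longrightarrow> p \<in> line_stab n \<Longrightarrow> last_fun (2 * n) c p \<noteq> 0"
  using line_stab_last_nonzero[of p n] by (auto simp: last_fun_def)

lemma pfaffian_monomial_upper:
  assumes n: "0 < n" and b: "b \<in> std_borel (2 * n)" and g: "g \<in> carrier_mat (2 * n) (2 * n)"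
  shows "weight_fun (2 * n) c b * pfaffian_monomial n c (b * g) = pfaffian_monomial n c g"
proof -
  have "(\<Prod>k<i. b $$ (k, k)) * corner_pfaffian n (2 * n - i) (b * g) = corner_pfaffian n (2 * n - i) g" if "i \<in> {1..<2 * n}" for i
  proof -
    have "corner_pfaffian n (2 * n - i) (b * g) = (\<Prod>r\<in>{2 * n - (2 * n - i)..<2 * n}. b $$ (r, r)) * corner_pfaffian n (2 * n - i) g"
      by (rule corner_pfaffian_upper[OF n]) (use b g in \<open>auto simp: std_borel_def std_SL_def\<close>)
    also have "2 * n - (2 * n - i) = i" using that by auto
    finally have "(\<Prod>k<i. b $$ (k, k)) * corner_pfaffian n (2 * n - i) (b * g) =
        ((\<Prod>k\<in>{0..<i}. b $$ (k, k)) * (\<Prod>r\<in>{i..<2 * n}. b $$ (r, r))) * corner_pfaffian n (2 * n - i) g"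
      by (simp add: atLeast0LessThan)
    also have "(\<Prod>k\<in>{0..<i}. b $$ (k, k)) * (\<Prod>r\<in>{i..<2 * n}. b $$ (r, r)) = (\<Prod>k\<in>{0..<2 * n}. b $$ (k, k))"
      by (rule prod.atLeastLessThan_concat) (use that in auto)
    finally show ?thesis using std_borel_det_diag[OF b] by (simp add: atLeast0LessThan)
  qed
  then show ?thesis
    unfolding weight_fun_def pfaffian_monomial_def prod.distrib[symmetric] power_mult_distrib[symmetric]
    by (intro prod.cong refl) simp
qed

lemma pfaffian_monomial_line_stab:
  assumes n: "0 < n" and p: "p \<in> line_stab n" and g: "g \<in> carrier_mat (2 * n) (2 * n)"
  shows "pfaffian_monomial n c (g * p) = pfaffian_monomial n c g * last_fun (2 * n) c p"
  unfolding last_fun_def pfaffian_monomial_def prod.distrib[symmetric] power_mult_distrib[symmetric]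
proof (intro prod.cong refl arg_cong2[where f = power])
  fix i assume "i \<in> {1..<2 * n}"
  then have "even (2 * n - i) = even i" "2 * n - i \<le> 2 * n" by auto
  then show "corner_pfaffian n (2 * n - i) (g * p) = corner_pfaffian n (2 * n - i) g * (if even i then 1 else p $$ (2 * n - 1, 2 * n - 1))"
    using corner_pfaffian_line_stab[OF n _ p g, of "2 * n - i"] by simp
qed

lemma pfaffian_monomial_nonzero:
  assumes n: "0 < n"
  shows "\<exists>g\<in>std_SL (2 * n). pfaffian_monomial n c g \<noteq> 0"
proof -
  let ?N = "2 * n"
  define F where "F k = (if k = 0 then det_poly ?N else corner_pfaffian n k)" for k
  have "\<exists>A\<in>carrier_mat ?N ?N. \<forall>k\<in>{..<?N}. F k A \<noteq> 0"
  proof (rule poly_funs_nonzero_prod)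
    fix k assume k: "k \<in> {..<?N}"
    show "F k \<in> poly_funs ?N" using corner_pfaffian_poly_fun[OF n, of k] k by (auto simp: F_def)
    show "\<exists>A\<in>carrier_mat ?N ?N. F k A \<noteq> 0"
    proof (cases "k = 0")
      case True
      then show ?thesis by (intro bexI[of _ "1\<^sub>m ?N"]) (auto simp: F_def det_poly_eq)
    next
      case False
      then show ?thesis using corner_pfaffian_nonzero[OF n, of k] k by (simp add: F_def)
    qed
  qed simp
  then obtain A where A: "A \<in> carrier_mat ?N ?N" "\<And>k. k < ?N \<Longrightarrow> F k A \<noteq> 0" by blast
  have dA: "det A \<noteq> 0" using A(2)[of 0] n by (simp add: F_def det_poly_eq[OF A(1)])
  let ?d = "\<lambda>i. if i = 0 then 1 / det A else (1 :: complex)"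
  let ?D = "diagm ?N ?d"
  have "corner_pfaffian n k (?D * A) \<noteq> 0" if "1 \<le> k" "k < ?N" for k
  proof -
    have "corner_pfaffian n k (?D * A) = (\<Prod>r\<in>{?N - k..<?N}. ?D $$ (r, r)) * corner_pfaffian n k A"
      by (rule corner_pfaffian_upper[OF n]) (use that A(1) in \<open>auto simp: diagm_upper\<close>)
    moreover have "(\<Prod>r\<in>{?N - k..<?N}. ?D $$ (r, r)) \<noteq> 0" using dA by simp
    moreover have "corner_pfaffian n k A \<noteq> 0" using A(2)[OF that(2)] that(1) by (simp add: F_def)
    ultimately show ?thesis by simp
  qed
  then have "pfaffian_monomial n c (?D * A) \<noteq> 0" by (auto simp: pfaffian_monomial_def)
  moreover have "det (?D * A) = 1"
  proof -
    have "(\<Prod>i<?N. ?d i) = 1 / det A" using n by (subst prod.delta) auto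
    then show ?thesis using det_mult[OF diagm_carrier A(1), of ?d] dA by (simp add: det_diagm)
  qed
  ultimately show ?thesis using A(1) by (intro bexI[of _ "?D * A"]) (auto simp: std_SL_def)
qed

context
  fixes n :: nat and \<Omega> S Si :: "complex mat"
  assumes n: "2 \<le> n" and \<Omega>: "\<Omega> \<in> carrier_mat (2 * n) (2 * n)"
    and S: "S \<in> carrier_mat (2 * n) (2 * n)" "transpose_mat S * \<Omega> * S = bourbaki_form n"
    and Si: "Si \<in> carrier_mat (2 * n) (2 * n)" "S * Si = 1\<^sub>m (2 * n)" "Si * S = 1\<^sub>m (2 * n)"
begin

lemmas std = n \<Omega> S Si

abbreviation (input) "dim2 \<equiv> 2 * n"
abbreviation (input) "G \<equiv> SL dim2"
abbreviation (input) "H \<equiv> Sp dim2 \<Omega>"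
abbreviation (input) "T \<equiv> torus dim2 S G"
abbreviation (input) "TH \<equiv> torus dim2 S H"
abbreviation (input) "B \<equiv> borel dim2 S G"
abbreviation (input) "crd \<equiv> in_basis dim2 S"
abbreviation (input) "P \<equiv> parabolic dim2 H TH (opp_borel dim2 S H) (simple_root_C n S H ` {1..n}) {simple_root_C n S H 1}"
abbreviation (input) "D \<equiv> char_group dim2 T \<times>\<times> char_group dim2 TH"
abbreviation (input) "ext_monoid \<equiv> ext_weight_monoid dim2 G B T P TH"

definition gen :: "nat \<Rightarrow> (complex mat \<Rightarrow> complex) \<times> (complex mat \<Rightarrow> complex)" where
  "gen i = (fund_weight dim2 S G i, if even i then \<one>\<^bsub>char_group dim2 TH\<^esub>
     else inv\<^bsub>char_group dim2 TH\<^esub> (fund_weight dim2 S H 1))"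

lemma T_closed: "mult_closed T"
  unfolding mult_closed_def using TG_mult[OF std] by blast

lemma TH_closed: "mult_closed TH"
  unfolding mult_closed_def using TS_mult[OF std] by blast

lemma pull_poly:
  assumes "p \<in> poly_funs dim2"
  obtains q where "q \<in> poly_funs dim2" "\<And>A. A \<in> carrier_mat dim2 dim2 \<Longrightarrow> p (crd A) = q A"
  using poly_funs_conj[OF assms Si(1) S(1)] to_coords_eq[OF std] by auto

lemma push_poly:
  assumes "p \<in> poly_funs dim2"
  obtains q where "q \<in> poly_funs dim2" "\<And>A. A \<in> carrier_mat dim2 dim2 \<Longrightarrow> p (from_coords S Si A) = q A"
  using poly_funs_conj[OF assms S(1) Si(1)] from_coords_def[OF std] by auto

lemma fund_weight_T:
  assumes "t \<in> T" "crd t = diagm dim2 d" "i \<le> dim2"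
  shows "fund_weight dim2 S G i t = (\<Prod>k<i. d k)"
proof -
  have "fund_weight dim2 S G i t = (\<Prod>k\<in>{1..i}. d (k - 1))"
    using assms(1) unfolding fund_weight_def restrict_apply' [OF assms(1)] eps_def assms(2)
    by (intro prod.cong refl diagm_index[THEN trans]) (use assms(3) in auto)
  also have "\<dots> = (\<Prod>k<i. d k)"
    by (rule prod.reindex_bij_witness[of _ Suc "\<lambda>k. k - 1"]) auto
  finally show ?thesis .
qed

lemma T_carrier: "t \<in> T \<Longrightarrow> t \<in> carrier_mat dim2 dim2" and TH_carrier: "t \<in> TH \<Longrightarrow> t \<in> carrier_mat dim2 dim2"
  using TG_iff[OF std] TS_iff[OF std] by auto

lemma fund_weight_char:
  assumes "i \<le> dim2"
  shows "fund_weight dim2 S G i \<in> characters dim2 T"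
proof -
  have "(\<lambda>A. \<Prod>k<i. A $$ (k, k)) \<in> poly_funs dim2"
    by (intro poly_funs_prod poly_funs.entry) (use assms in auto)
  then obtain q where q: "q \<in> poly_funs dim2" "\<And>A. A \<in> carrier_mat dim2 dim2 \<Longrightarrow> (\<Prod>k<i. crd A $$ (k, k)) = q A"
    using pull_poly by blast
  show ?thesis
  proof (rule charactersI[OF q(1)])
    fix t assume t: "t \<in> T"
    then obtain d where d: "crd t = diagm dim2 d" "(\<Prod>i<dim2. d i) = 1" using TG_iff[OF std] by blast
    show "fund_weight dim2 S G i t = q t"
      using q(2)[OF T_carrier[OF t]] fund_weight_T[OF t d(1) assms] assms by (simp add: d(1))
    have "d k \<noteq> 0" if "k < dim2" for k using d(2) that by (metis finite_lessThan lessThan_iff prod_zero_iff zero_neq_one)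
    then show "fund_weight dim2 S G i t \<noteq> 0" using fund_weight_T[OF t d(1) assms] assms by simp
    fix s assume s: "s \<in> T"
    then obtain e where e: "crd s = diagm dim2 e" "(\<Prod>i<dim2. e i) = 1" using TG_iff[OF std] by blast
    have "crd (t * s) = diagm dim2 (\<lambda>i. d i * e i)"
      using to_coords_mult[OF std T_carrier[OF t] T_carrier[OF s]] by (simp add: d(1) e(1) diagm_mult)
    then show "fund_weight dim2 S G i (t * s) = fund_weight dim2 S G i t * fund_weight dim2 S G i s"
      using fund_weight_T[OF TG_mult[OF std t s] _ assms] fund_weight_T[OF t d(1) assms]
        fund_weight_T[OF s e(1) assms] by (simp add: prod.distrib)
  qed (simp add: fund_weight_def)
qed

lemma TH_diag:
  assumes "t \<in> TH"
  obtains d where "crd t = diagm dim2 d" "diagm dim2 d \<in> std_Sp n" "d 0 * d (dim2 - 1) = 1" "d 0 \<noteq> 0"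
proof -
  obtain d where d: "crd t = diagm dim2 d" "diagm dim2 d \<in> std_Sp n" using assms TS_iff[OF std] by blast
  have "0 < dim2" using n by simp
  then have "d 0 * d (dim2 - 1) = 1" using d(2) unfolding diagm_std_Sp by (metis diff_zero)
  then show ?thesis using that[OF d] by force
qed

lemma TH_entry_char:
  assumes i: "i < dim2"
  shows "(\<lambda>t\<in>TH. crd t $$ (i, i)) \<in> characters dim2 TH"
proof -
  obtain q where q: "q \<in> poly_funs dim2" "\<And>A. A \<in> carrier_mat dim2 dim2 \<Longrightarrow> crd A $$ (i, i) = q A"
    using pull_poly[OF poly_funs.entry[OF i i]] by blast
  show ?thesis
  proof (rule charactersI[OF q(1)])
    fix t assume t: "t \<in> TH"
    then obtain d where d: "crd t = diagm dim2 d" "diagm dim2 d \<in> std_Sp n" using TS_iff[OF std] by blast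
    show "(\<lambda>t\<in>TH. crd t $$ (i, i)) t = q t" using t q(2)[OF TH_carrier[OF t]] by simp
    have "d i * d (dim2 - 1 - i) = 1" using d(2) i by (simp add: diagm_std_Sp)
    then show "(\<lambda>t\<in>TH. crd t $$ (i, i)) t \<noteq> 0" using t d(1) i by auto
    fix s assume s: "s \<in> TH"
    then obtain e where e: "crd s = diagm dim2 e" using TS_iff[OF std] by blast
    have "crd (t * s) = diagm dim2 (\<lambda>i. d i * e i)"
      using to_coords_mult[OF std TH_carrier[OF t] TH_carrier[OF s]] by (simp add: d(1) e(1) diagm_mult)
    then show "(\<lambda>t\<in>TH. crd t $$ (i, i)) (t * s) = (\<lambda>t\<in>TH. crd t $$ (i, i)) t * (\<lambda>t\<in>TH. crd t $$ (i, i)) s"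
      using t s TS_mult[OF std t s] i d(1) e by simp
  qed simp
qed

lemma inv_first_weight:
  "inv\<^bsub>char_group dim2 TH\<^esub> (fund_weight dim2 S H 1) = (\<lambda>t\<in>TH. crd t $$ (dim2 - 1, dim2 - 1))"
proof -
  interpret comm_monoid "char_group dim2 TH" by (rule char_group_comm_monoid[OF TH_closed])
  have l: "0 < dim2" "dim2 - 1 < dim2" using n by auto
  have w: "fund_weight dim2 S H 1 = (\<lambda>t\<in>TH. crd t $$ (0, 0))"
    unfolding fund_weight_def by (rule restrict_ext) (simp add: eps_def)
  show ?thesis
  proof (rule comm_inv_char)
    show "fund_weight dim2 S H 1 \<in> carrier (char_group dim2 TH)"
      unfolding w using TH_entry_char[OF l(1)] by (simp add: char_group_def)
    show "(\<lambda>t\<in>TH. crd t $$ (dim2 - 1, dim2 - 1)) \<in> carrier (char_group dim2 TH)"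
      using TH_entry_char[OF l(2)] by (simp add: char_group_def)
    have "crd t $$ (0, 0) * crd t $$ (dim2 - 1, dim2 - 1) = 1" if "t \<in> TH" for t
      using TH_diag[OF that] l by (metis diagm_index)
    then show "fund_weight dim2 S H 1 \<otimes>\<^bsub>char_group dim2 TH\<^esub> (\<lambda>t\<in>TH. crd t $$ (dim2 - 1, dim2 - 1)) = \<one>\<^bsub>char_group dim2 TH\<^esub>"
      unfolding w by (auto simp: char_group_def intro!: restrict_ext)
  qed
qed

lemma snd_gen: "snd (gen i) = (\<lambda>t\<in>TH. if even i then 1 else crd t $$ (dim2 - 1, dim2 - 1))"
  unfolding gen_def snd_conv inv_first_weight by (auto simp: char_group_def intro!: restrict_ext)

lemma gen_carrier:
  assumes "i \<le> dim2"
  shows "gen i \<in> carrier D"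
proof -
  interpret comm_monoid "char_group dim2 TH" by (rule char_group_comm_monoid[OF TH_closed])
  have "dim2 - 1 < dim2" using n by simp
  then have "(\<lambda>t\<in>TH. crd t $$ (dim2 - 1, dim2 - 1)) \<in> carrier (char_group dim2 TH)"
    using TH_entry_char by (simp add: char_group_def)
  then have "snd (gen i) \<in> carrier (char_group dim2 TH)"
    unfolding gen_def inv_first_weight by simp
  moreover have "fst (gen i) \<in> carrier (char_group dim2 T)"
    using fund_weight_char[OF assms] by (simp add: gen_def char_group_def)
  ultimately show ?thesis by (auto simp: DirProd_def mem_Times_iff)
qed

text \<open>
  The coroots are dual to the fundamental weights.
\<close>

lemma coroot_point:
  assumes i: "1 \<le> i" "i < dim2"
  obtains t where "t \<in> T" "\<And>l. l \<le> dim2 \<Longrightarrow> fund_weight dim2 S G l t = (if l = i then 2 else 1)"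
proof -
  let ?d = "\<lambda>j. if j = i - 1 then 2 else if j = Suc (i - 1) then 1 / 2 else (1 :: complex)"
  have c: "coroot dim2 (i - 1) 2 \<in> std_borel dim2" by (rule coroot_std_borel) (use i in auto)
  let ?t = "from_coords S Si (coroot dim2 (i - 1) 2)"
  have b: "crd ?t = diagm dim2 ?d" by (rule trans[OF to_coords_from_coords[OF std std_borel_carrier[OF c]]]) (simp only: coroot_def)
  have "det (coroot dim2 (i - 1) 2) = (\<Prod>j<dim2. ?d j)" by (simp only: coroot_def det_diagm)
  then have "(\<Prod>j<dim2. ?d j) = 1" using c by (simp add: std_borel_def std_SL_def)
  then have t: "?t \<in> T" using b TG_iff[OF std] from_coords_carrier[OF std std_borel_carrier[OF c]] by blast
  have pr: "(\<Prod>k<l. ?d k) = (if l = i then 2 else 1)" for l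
  proof (induction l)
    case 0
    then show ?case using i by simp
  next
    case (Suc l)
    then show ?case using i by auto
  qed
  show ?thesis
    by (rule that[OF t]) (simp only: fund_weight_T[OF t b] pr)
qed

lemma gen_inj: "inj_on gen {1..<dim2}"
proof (rule inj_onI)
  fix i j assume ij: "i \<in> {1..<dim2}" "j \<in> {1..<dim2}" "gen i = gen j"
  obtain t where t: "t \<in> T" "\<And>l. l \<le> dim2 \<Longrightarrow> fund_weight dim2 S G l t = (if l = i then 2 else 1)"
    using coroot_point[of i] ij(1) by auto
  have "fund_weight dim2 S G i t = fund_weight dim2 S G j t" using ij(3) by (simp add: gen_def)
  then show "i = j" using t(2)[of i] t(2)[of j] ij by (auto split: if_splits)
qed

abbreviation (input) "gens \<equiv> gen ` {1..<dim2}"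

lemma gens_eq:
  "{(fund_weight dim2 S G (2 * i), \<one>\<^bsub>char_group dim2 TH\<^esub>) | i. 1 \<le> i \<and> i \<le> n - 1} \<union>
   {(fund_weight dim2 S G (2 * j - 1), inv\<^bsub>char_group dim2 TH\<^esub> (fund_weight dim2 S H 1)) | j. 1 \<le> j \<and> j \<le> n} = gens"
proof -
  have "(fund_weight dim2 S G (2 * i), \<one>\<^bsub>char_group dim2 TH\<^esub>) = gen (2 * i)" for i by (simp add: gen_def)
  moreover have "(fund_weight dim2 S G (2 * j - 1), inv\<^bsub>char_group dim2 TH\<^esub> (fund_weight dim2 S H 1)) = gen (2 * j - 1)" if "1 \<le> j" for j
    using that by (simp add: gen_def)
  ultimately have "{(fund_weight dim2 S G (2 * i), \<one>\<^bsub>char_group dim2 TH\<^esub>) | i. 1 \<le> i \<and> i \<le> n - 1} \<union>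
      {(fund_weight dim2 S G (2 * j - 1), inv\<^bsub>char_group dim2 TH\<^esub> (fund_weight dim2 S H 1)) | j. 1 \<le> j \<and> j \<le> n}
      = gen ` ({2 * i | i. 1 \<le> i \<and> i \<le> n - 1} \<union> {2 * j - 1 | j. 1 \<le> j \<and> j \<le> n})"
    by (auto simp: image_iff; metis)
  also have "{2 * i | i. 1 \<le> i \<and> i \<le> n - 1} \<union> {2 * j - 1 | j. 1 \<le> j \<and> j \<le> n} = {1..<dim2}"
    (is "?L = _")
  proof
    show "?L \<subseteq> {1..<dim2}" by auto
    show "{1..<dim2} \<subseteq> ?L"
    proof
      fix x assume x: "x \<in> {1..<dim2}"
      show "x \<in> ?L"
      proof (cases "even x")
        case True
        then have "x = 2 * (x div 2)" "1 \<le> x div 2" "x div 2 \<le> n - 1" using x by auto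
        then show ?thesis by blast
      next
        case False
        then have "x = 2 * ((x + 1) div 2) - 1" "1 \<le> (x + 1) div 2" "(x + 1) div 2 \<le> n" using x by (auto elim!: oddE)
        then show ?thesis by blast
      qed
    qed
  qed
  finally show ?thesis .
qed

definition weight_pair :: "(nat \<Rightarrow> nat) \<Rightarrow> (complex mat \<Rightarrow> complex) \<times> (complex mat \<Rightarrow> complex)" where
  "weight_pair c = (\<lambda>t\<in>T. weight_fun dim2 c (crd t), \<lambda>t\<in>TH. last_fun dim2 c (crd t))"

lemma finprod_gens:
  "finprod D (\<lambda>x. x [^]\<^bsub>D\<^esub> a x) gens = weight_pair (\<lambda>i. a (gen i))"
proof -
  have "finprod D (\<lambda>x. x [^]\<^bsub>D\<^esub> a x) gens =
      (\<lambda>A\<in>T. \<Prod>x\<in>gens. fst x A ^ a x, \<lambda>A\<in>TH. \<Prod>x\<in>gens. snd x A ^ a x)"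
  proof (rule pair_value[OF T_closed TH_closed])
    fix x assume "x \<in> gens"
    then obtain i where "x = gen i" "i \<in> {1..<dim2}" by blast
    then show "x \<in> carrier D" using gen_carrier[of i] by simp
  qed simp
  also have "\<dots> = weight_pair (\<lambda>i. a (gen i))"
    unfolding weight_pair_def
  proof (intro arg_cong2[where f = Pair] restrict_ext)
    fix t assume t: "t \<in> T"
    then obtain d where d: "crd t = diagm dim2 d" using TG_iff[OF std] by blast
    show "(\<Prod>x\<in>gens. fst x t ^ a x) = weight_fun dim2 (\<lambda>i. a (gen i)) (crd t)"
      unfolding prod.reindex[OF gen_inj] comp_def weight_fun_def
      by (intro prod.cong refl) (simp add: gen_def fund_weight_T[OF t d] d)
  next
    fix t assume t: "t \<in> TH"
    show "(\<Prod>x\<in>gens. snd x t ^ a x) = last_fun dim2 (\<lambda>i. a (gen i)) (crd t)"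
      unfolding prod.reindex[OF gen_inj] comp_def last_fun_def snd_gen using t by simp
  qed
  finally show ?thesis .
qed

lemma weight_pair_inj:
  assumes "weight_pair c = weight_pair c'" "i \<in> {1..<dim2}"
  shows "c i = c' i"
proof -
  obtain t where t: "t \<in> T" "\<And>l. l \<le> dim2 \<Longrightarrow> fund_weight dim2 S G l t = (if l = i then 2 else 1)"
    using coroot_point[of i] assms(2) by auto
  obtain d where d: "crd t = diagm dim2 d" using t(1) TG_iff[OF std] by blast
  have w: "weight_fun dim2 c (crd t) = 2 ^ c i" for c
  proof -
    have "weight_fun dim2 c (crd t) = (\<Prod>l\<in>{1..<dim2}. if l = i then 2 ^ c i else 1)"
      unfolding weight_fun_def d
    proof (intro prod.cong refl)
      fix l assume l: "l \<in> {1..<dim2}"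
      then have "(\<Prod>k<l. diagm dim2 d $$ (k, k)) = fund_weight dim2 S G l t" using fund_weight_T[OF t(1) d, of l] by simp
      then show "(\<Prod>k<l. diagm dim2 d $$ (k, k)) ^ c l = (if l = i then 2 ^ c i else 1)" using t(2)[of l] l by simp
    qed
    then show ?thesis using assms(2) by simp
  qed
  have "weight_fun dim2 c (crd t) = weight_fun dim2 c' (crd t)"
    using fun_cong[OF arg_cong[OF assms(1), of fst], of t] t(1) by (simp add: weight_pair_def)
  then have "(2 :: complex) ^ c i = 2 ^ c' i" by (simp add: w)
  then have "(2 :: nat) ^ c i = 2 ^ c' i" by (metis of_nat_eq_iff of_nat_numeral of_nat_power)
  then show ?thesis by simp
qed

lemma P_iff: "A \<in> P \<longleftrightarrow> A \<in> carrier_mat dim2 dim2 \<and> crd A \<in> line_stab n"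
  by (rule parabolic_iff[OF std])

lemma GL_inv_B:
  assumes "b \<in> B"
  shows "inv\<^bsub>GL dim2\<^esub> b \<in> carrier_mat dim2 dim2" "b * inv\<^bsub>GL dim2\<^esub> b = 1\<^sub>m dim2" "det (inv\<^bsub>GL dim2\<^esub> b) = 1"
proof -
  interpret group "GL dim2" by (rule GL_group)
  have b: "b \<in> carrier_mat dim2 dim2" "det b = 1" using assms borel_iff[OF std] to_coords_det[OF std, of b] by (auto simp: std_borel_def std_SL_def)
  then have c: "b \<in> carrier (GL dim2)" by (simp add: GL_carrier)
  show i: "inv\<^bsub>GL dim2\<^esub> b \<in> carrier_mat dim2 dim2" using inv_closed[OF c] by (simp add: GL_carrier)
  show e: "b * inv\<^bsub>GL dim2\<^esub> b = 1\<^sub>m dim2" using r_inv[OF c] by simp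
  show "det (inv\<^bsub>GL dim2\<^esub> b) = 1" using det_mult[OF b(1) i] e b(2) by simp
qed

lemma T_B: "t \<in> T \<Longrightarrow> t \<in> B"
  using TG_iff[OF std] borel_iff[OF std] by (auto simp: std_borel_def std_SL_def det_diagm diagm_upper)

lemma TH_P: "t \<in> TH \<Longrightarrow> t \<in> P"
proof -
  assume t: "t \<in> TH"
  then obtain d where "crd t = diagm dim2 d" "diagm dim2 d \<in> std_Sp n" using TS_iff[OF std] by blast
  then show ?thesis using diagm_line_stab[of n d] n TH_carrier[OF t] P_iff by simp
qed

lemma weight_pair_mem: "weight_pair c \<in> ext_monoid"
proof -
  have n0: "0 < n" "0 < dim2" using n by auto
  obtain w where w: "w \<in> poly_funs dim2" "\<And>A. A \<in> carrier_mat dim2 dim2 \<Longrightarrow> weight_fun dim2 c (crd A) = w A"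
    using pull_poly[OF weight_fun_poly] by blast
  obtain x where x: "x \<in> poly_funs dim2" "\<And>A. A \<in> carrier_mat dim2 dim2 \<Longrightarrow> last_fun dim2 c (crd A) = x A"
    using pull_poly[OF last_fun_poly[OF n0(2)]] by blast
  obtain f where f: "f \<in> poly_funs dim2" "\<And>A. A \<in> carrier_mat dim2 dim2 \<Longrightarrow> pfaffian_monomial n c (crd A) = f A"
    using pull_poly[OF pfaffian_monomial_poly[OF n0(1)]] by blast
  have Bc: "b \<in> carrier_mat dim2 dim2" "crd b \<in> std_borel dim2" if "b \<in> B" for b using that borel_iff[OF std] by auto
  have Pc: "p \<in> carrier_mat dim2 dim2" "crd p \<in> line_stab n" if "p \<in> P" for p using that P_iff by auto
  have Gc: "g \<in> carrier_mat dim2 dim2" "crd g \<in> std_SL dim2" if "g \<in> G" for g using that SL_iff[OF std] by auto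
  have BB: "a * b \<in> B" if "a \<in> B" "b \<in> B" for a b
    using std_borel_mult[OF Bc(2)[OF that(1)] Bc(2)[OF that(2)]] Bc(1)[OF that(1)] Bc(1)[OF that(2)]
    unfolding borel_iff[OF std] by (simp add: to_coords_mult[OF std])
  have PP: "a * b \<in> P" if "a \<in> P" "b \<in> P" for a b
    using line_stab_mult[OF Pc(2)[OF that(1)] Pc(2)[OF that(2)]] Pc(1)[OF that(1)] Pc(1)[OF that(2)]
    unfolding P_iff by (simp add: to_coords_mult[OF std])
  define \<omega> where "\<omega> = (\<lambda>b\<in>B. weight_fun dim2 c (crd b))"
  define \<chi> where "\<chi> = (\<lambda>p\<in>P. last_fun dim2 c (crd p))"
  have "\<omega> \<in> characters dim2 B"
  proof (rule charactersI[OF w(1)])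
    fix a assume a: "a \<in> B"
    show "\<omega> a = w a" "\<omega> a \<noteq> 0" using a w(2)[OF Bc(1)[OF a]] weight_fun_nonzero[OF Bc(2)[OF a]] by (auto simp: \<omega>_def)
    fix b assume b: "b \<in> B"
    show "\<omega> (a * b) = \<omega> a * \<omega> b"
      using a b BB[OF a b] weight_fun_mult[OF Bc(2)[OF a] Bc(2)[OF b]] to_coords_mult[OF std Bc(1)[OF a] Bc(1)[OF b]]
      by (simp add: \<omega>_def)
  qed (simp add: \<omega>_def)
  moreover have "\<chi> \<in> characters dim2 P"
  proof (rule charactersI[OF x(1)])
    fix a assume a: "a \<in> P"
    show "\<chi> a = x a" "\<chi> a \<noteq> 0" using a x(2)[OF Pc(1)[OF a]] last_fun_nonzero[OF n0(1) Pc(2)[OF a]] by (auto simp: \<chi>_def)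
    fix b assume b: "b \<in> P"
    show "\<chi> (a * b) = \<chi> a * \<chi> b"
      using a b PP[OF a b] last_fun_mult[OF n0(1) Pc(2)[OF a] Pc(2)[OF b]] to_coords_mult[OF std Pc(1)[OF a] Pc(1)[OF b]]
      by (simp add: \<chi>_def)
  qed (simp add: \<chi>_def)
  moreover have "restrict f G \<in> regular_funs dim2 G" using f(1) by (auto simp: regular_funs_def)
  moreover have "\<exists>g\<in>G. restrict f G g \<noteq> 0"
  proof -
    obtain g where g: "g \<in> std_SL dim2" "pfaffian_monomial n c g \<noteq> 0" using pfaffian_monomial_nonzero[OF n0(1)] by blast
    have gc: "g \<in> carrier_mat dim2 dim2" using g by (simp add: std_SL_def)
    have "from_coords S Si g \<in> G" unfolding SL_iff[OF std] using g from_coords_carrier[OF std gc] to_coords_from_coords[OF std gc] by simp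
    moreover have "f (from_coords S Si g) \<noteq> 0" using f(2)[OF from_coords_carrier[OF std gc]] to_coords_from_coords[OF std gc] g(2) by simp
    ultimately show ?thesis by (intro bexI[of _ "from_coords S Si g"]) auto
  qed
  moreover have "restrict f G (inv\<^bsub>GL dim2\<^esub> b * g * p) = \<omega> b * restrict f G g * \<chi> p"
    if b: "b \<in> B" and g: "g \<in> G" and p: "p \<in> P" for b g p
  proof -
    let ?i = "inv\<^bsub>GL dim2\<^esub> b"
    note i = GL_inv_B[OF b]
    have ic: "crd ?i \<in> carrier_mat dim2 dim2" and gc: "crd g \<in> carrier_mat dim2 dim2" and bc: "crd b \<in> carrier_mat dim2 dim2"
      using to_coords_carrier[OF std] i(1) Gc(1)[OF g] Bc(1)[OF b] by auto
    have igc: "?i * g \<in> carrier_mat dim2 dim2" by (rule mult_carrier_mat[OF i(1) Gc(1)[OF g]])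
    have igpc: "?i * g * p \<in> carrier_mat dim2 dim2" by (rule mult_carrier_mat[OF igc Pc(1)[OF p]])
    have "det (?i * g * p) = 1"
      using det_mult[OF igc Pc(1)[OF p]] det_mult[OF i(1) Gc(1)[OF g]] i(3)
        line_stab_std_SL[OF Pc(2)[OF p]] Gc(2)[OF g] to_coords_det[OF std Pc(1)[OF p]] to_coords_det[OF std Gc(1)[OF g]]
      by (simp add: std_SL_def)
    then have mem: "?i * g * p \<in> G" using igpc by (simp add: SL_def GL_carrier)
    have e: "crd (?i * g * p) = crd ?i * crd g * crd p"
      by (simp only: to_coords_mult[OF std igc Pc(1)[OF p]] to_coords_mult[OF std i(1) Gc(1)[OF g]])
    have "crd b * crd ?i = 1\<^sub>m dim2" using to_coords_mult[OF std Bc(1)[OF b] i(1)] i(2) to_coords_one[OF std] by simp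
    then have bi: "crd b * (crd ?i * crd g) = crd g"
      using assoc_mult_mat[OF bc ic gc] gc by simp
    have igb: "crd ?i * crd g \<in> carrier_mat dim2 dim2" by (rule mult_carrier_mat[OF ic gc])
    have "restrict f G (?i * g * p) = pfaffian_monomial n c (crd ?i * crd g * crd p)"
      using mem f(2)[OF igpc] by (simp only: restrict_apply if_True e)
    also have "\<dots> = pfaffian_monomial n c (crd ?i * crd g) * last_fun dim2 c (crd p)"
      by (rule pfaffian_monomial_line_stab[OF n0(1) Pc(2)[OF p] igb])
    also have "pfaffian_monomial n c (crd ?i * crd g) = weight_fun dim2 c (crd b) * pfaffian_monomial n c (crd g)"
      using pfaffian_monomial_upper[OF n0(1) Bc(2)[OF b] igb, of c] unfolding bi by (rule sym)
    also have "pfaffian_monomial n c (crd g) = f g" by (rule f(2)[OF Gc(1)[OF g]])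
    finally show ?thesis using b g p by (simp add: \<omega>_def \<chi>_def)
  qed
  ultimately have "(restrict \<omega> T, restrict \<chi> TH) \<in> ext_monoid"
    unfolding ext_weight_monoid_def by blast
  moreover have "restrict \<omega> T = fst (weight_pair c)"
    unfolding weight_pair_def fst_conv by (rule restrict_ext) (simp add: \<omega>_def T_B)
  moreover have "restrict \<chi> TH = snd (weight_pair c)"
    unfolding weight_pair_def snd_conv by (rule restrict_ext) (simp only: \<chi>_def restrict_apply TH_P if_True)
  ultimately show ?thesis by simp
qed

text \<open>
  A function and characters as in the definition of the monoid become, in the standard basis, a
  semi-invariant in the sense of \<open>semi_invariant\<close>.
\<close>

lemma mem_weight_pair:
  assumes "z \<in> ext_monoid"
  shows "\<exists>c. z = weight_pair c"
proof -
  have n0: "0 < n" "0 < dim2" using n by auto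
  obtain \<omega> \<chi> f where z: "z = (restrict \<omega> T, restrict \<chi> TH)" and w: "\<omega> \<in> characters dim2 B"
    and x: "\<chi> \<in> characters dim2 P" and f: "f \<in> regular_funs dim2 G" "\<exists>g\<in>G. f g \<noteq> 0"
    and semi: "\<And>b g p. b \<in> B \<Longrightarrow> g \<in> G \<Longrightarrow> p \<in> P \<Longrightarrow> f (inv\<^bsub>GL dim2\<^esub> b * g * p) = \<omega> b * f g * \<chi> p"
    using assms unfolding ext_weight_monoid_def by blast
  obtain w' where w': "w' \<in> poly_funs dim2" "\<omega> = restrict w' B"
    using w by (auto simp: characters_def regular_funs_def)
  obtain f' where f': "f' \<in> poly_funs dim2" "f = restrict f' G" using f(1) by (auto simp: regular_funs_def)
  obtain W where W: "W \<in> poly_funs dim2" "\<And>A. A \<in> carrier_mat dim2 dim2 \<Longrightarrow> w' (from_coords S Si A) = W A"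
    using push_poly[OF w'(1)] by blast
  obtain F where F: "F \<in> poly_funs dim2" "\<And>A. A \<in> carrier_mat dim2 dim2 \<Longrightarrow> f' (from_coords S Si A) = F A"
    using push_poly[OF f'(1)] by blast
  define X1 where "X1 A = \<chi> (from_coords S Si A)" for A
  have cB: "from_coords S Si b \<in> B" "W b = \<omega> (from_coords S Si b)" if "b \<in> std_borel dim2" for b
  proof -
    note c = std_borel_carrier[OF that]
    show B: "from_coords S Si b \<in> B" unfolding borel_iff[OF std] using that from_coords_carrier[OF std c] to_coords_from_coords[OF std c] by simp
    show "W b = \<omega> (from_coords S Si b)" using B W(2)[OF c] w'(2) by simp
  qed
  have cG: "from_coords S Si g \<in> G" "F g = f (from_coords S Si g)" if "g \<in> std_SL dim2" for g
  proof -
    have c: "g \<in> carrier_mat dim2 dim2" using that by (simp add: std_SL_def)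
    show G: "from_coords S Si g \<in> G" unfolding SL_iff[OF std] using that from_coords_carrier[OF std c] to_coords_from_coords[OF std c] by simp
    show "F g = f (from_coords S Si g)" using G F(2)[OF c] f'(2) by simp
  qed
  have cP: "from_coords S Si p \<in> P" "p \<in> carrier_mat dim2 dim2" if "p \<in> line_stab n" for p
  proof -
    show c: "p \<in> carrier_mat dim2 dim2" using that std_Sp_carrier by (auto simp: line_stab_def)
    show "from_coords S Si p \<in> P" unfolding P_iff using that from_coords_carrier[OF std c] to_coords_from_coords[OF std c] by simp
  qed
  have w_prop: "\<omega> a \<noteq> 0" "\<omega> (a * b) = \<omega> a * \<omega> b" if "a \<in> B" "b \<in> B" for a b
    using w that by (auto simp: characters_def)
  have x_prop: "\<chi> a \<noteq> 0" "\<chi> (a * b) = \<chi> a * \<chi> b" if "a \<in> P" "b \<in> P" for a b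
    using x that by (auto simp: characters_def)
  have one: "1\<^sub>m dim2 \<in> B" "1\<^sub>m dim2 \<in> P" "inv\<^bsub>GL dim2\<^esub> (1\<^sub>m dim2) = 1\<^sub>m dim2"
    using std_borel_one line_stab_one to_coords_one[OF std] GL_inv[of "1\<^sub>m dim2" dim2 "1\<^sub>m dim2"] unfolding borel_iff[OF std] P_iff by auto
  have w1: "\<omega> (1\<^sub>m dim2) = 1" by (rule mult_one[of B]) (use one(1) w_prop in auto)
  have x1: "\<chi> (1\<^sub>m dim2) = 1" by (rule mult_one[of P]) (use one(2) x_prop in auto)
  have "semi_invariant n F W X1"
    unfolding semi_invariant_def
  proof (intro conjI ballI)
    fix a b assume a: "a \<in> std_borel dim2" and b: "b \<in> std_borel dim2"
    show "W (a * b) = W a * W b"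
      using cB(2)[OF std_borel_mult[OF a b]] cB(2)[OF a] cB(2)[OF b] w_prop(2)[OF cB(1)[OF a] cB(1)[OF b]]
        from_coords_mult[OF std std_borel_carrier[OF a] std_borel_carrier[OF b]] by simp
  next
    fix b assume b: "b \<in> std_borel dim2"
    show "W b \<noteq> 0" using cB[OF b] w_prop(1) by simp
  next
    fix p q assume p: "p \<in> line_stab n" and q: "q \<in> line_stab n"
    show "X1 (p * q) = X1 p * X1 q"
      unfolding X1_def from_coords_mult[OF std cP(2)[OF p] cP(2)[OF q]] by (rule x_prop(2)[OF cP(1)[OF p] cP(1)[OF q]])
  next
    fix p assume p: "p \<in> line_stab n"
    show "X1 p \<noteq> 0" unfolding X1_def by (rule x_prop(1)[OF cP(1)[OF p] cP(1)[OF p]])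
  next
    fix b g p assume b: "b \<in> std_borel dim2" and g: "g \<in> std_SL dim2" and p: "p \<in> line_stab n"
    let ?b = "from_coords S Si b" and ?g = "from_coords S Si g" and ?p = "from_coords S Si p"
    have gc: "g \<in> carrier_mat dim2 dim2" using g by (simp add: std_SL_def)
    have c: "?b \<in> carrier_mat dim2 dim2" "?g \<in> carrier_mat dim2 dim2" "?p \<in> carrier_mat dim2 dim2"
      using from_coords_carrier[OF std] std_borel_carrier[OF b] gc cP(2)[OF p] by auto
    have bg: "b * g \<in> std_SL dim2" by (rule std_SL_mult) (use b g in \<open>auto simp: std_borel_def\<close>)
    have bgc: "?b * ?g \<in> carrier_mat dim2 dim2" by (rule mult_carrier_mat[OF c(1,2)])
    have bgG: "?b * ?g \<in> G" using cG(1)[OF bg] from_coords_mult[OF std std_borel_carrier[OF b] gc] by simp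
    \<comment> \<open>applying the relation to b g and the inverse of b avoids inverting b inside the Borel subgroup\<close>
    have ibg: "inv\<^bsub>GL dim2\<^esub> ?b * (?b * ?g) = ?g"
    proof -
      note i = GL_inv_B[OF cB(1)[OF b]]
      have "inv\<^bsub>GL dim2\<^esub> ?b * ?b = 1\<^sub>m dim2" by (rule mat_mult_left_right_inverse[OF c(1) i(1,2)])
      then show ?thesis using assoc_mult_mat[OF i(1) c(1,2)] c(2) by simp
    qed
    have "f (inv\<^bsub>GL dim2\<^esub> ?b * (?b * ?g) * 1\<^sub>m dim2) = \<omega> ?b * f (?b * ?g) * \<chi> (1\<^sub>m dim2)"
      by (rule semi[OF cB(1)[OF b] bgG one(2)])
    then have 1: "f ?g = \<omega> ?b * f (?b * ?g)" unfolding ibg x1 using c(2) by simp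
    have "f (inv\<^bsub>GL dim2\<^esub> (1\<^sub>m dim2) * (?b * ?g) * ?p) = \<omega> (1\<^sub>m dim2) * f (?b * ?g) * \<chi> ?p"
      by (rule semi[OF one(1) bgG cP(1)[OF p]])
    then have 2: "f (?b * ?g * ?p) = f (?b * ?g) * \<chi> ?p" unfolding one(3) w1 left_mult_one_mat[OF bgc] by simp
    have bgp: "b * g * p \<in> std_SL dim2" by (rule std_SL_mult[OF bg line_stab_std_SL[OF p]])
    have "from_coords S Si (b * g * p) = ?b * ?g * ?p"
      using from_coords_mult[OF std mult_carrier_mat[OF std_borel_carrier[OF b] gc] cP(2)[OF p]]
        from_coords_mult[OF std std_borel_carrier[OF b] gc] by simp
    then have "F (b * g * p) = f (?b * ?g) * \<chi> ?p" using cG(2)[OF bgp] 2 by simp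
    then show "F (b * g * p) * W b = F g * X1 p"
      using cG(2)[OF g] cB(2)[OF b] 1 by (simp add: X1_def)
  qed
  moreover obtain g0 where g0: "g0 \<in> std_SL dim2" "F g0 \<noteq> 0"
  proof -
    obtain g where g: "g \<in> G" "f g \<noteq> 0" using f(2) by blast
    have c: "g \<in> carrier_mat dim2 dim2" "crd g \<in> std_SL dim2" using g(1) SL_iff[OF std] by auto
    have "F (crd g) = f g" using cG(2)[OF c(2)] from_coords_to_coords[OF std c(1)] by simp
    then show ?thesis using that[OF c(2)] g(2) by simp
  qed
  ultimately obtain c where
    wc: "\<And>d. (\<Prod>i<dim2. d i) = 1 \<Longrightarrow> W (diagm dim2 d) = (\<Prod>i\<in>{1..<dim2}. (\<Prod>k<i. d k) ^ c i)" and
    xc: "\<And>d. diagm dim2 d \<in> std_Sp n \<Longrightarrow> X1 (diagm dim2 d) * d 0 ^ (\<Sum>i | i \<in> {1..<dim2} \<and> odd i. c i) = 1"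
    using weights_of_semi_invariant[OF n0(1) _ F(1) W(1) g0, of X1] by blast
  have "z = weight_pair c"
    unfolding z weight_pair_def
  proof (intro arg_cong2[where f = Pair] restrict_ext)
    fix t assume t: "t \<in> T"
    then obtain d where d: "crd t = diagm dim2 d" "(\<Prod>i<dim2. d i) = 1" using TG_iff[OF std] by blast
    have b: "diagm dim2 d \<in> std_borel dim2" using d(2) by (simp add: std_borel_def std_SL_def det_diagm diagm_upper)
    have "\<omega> t = W (diagm dim2 d)" using cB(2)[OF b] from_coords_to_coords[OF std T_carrier[OF t]] d(1) by simp
    also have "\<dots> = weight_fun dim2 c (crd t)"
      unfolding wc[OF d(2)] weight_fun_def d(1) by (intro prod.cong refl arg_cong2[where f = power]) simp
    finally show "\<omega> t = weight_fun dim2 c (crd t)" .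
  next
    fix t assume t: "t \<in> TH"
    obtain d where d: "crd t = diagm dim2 d" "diagm dim2 d \<in> std_Sp n" "d 0 * d (dim2 - 1) = 1" "d 0 \<noteq> 0"
      by (rule TH_diag[OF t])
    let ?s = "\<Sum>i | i \<in> {1..<dim2} \<and> odd i. c i"
    have x: "\<chi> t = X1 (diagm dim2 d)" unfolding X1_def using from_coords_to_coords[OF std TH_carrier[OF t]] d(1) by simp
    have dd: "d 0 ^ ?s * d (dim2 - 1) ^ ?s = 1"
      using d(3) by (simp only: power_mult_distrib[symmetric] power_one)
    have "\<chi> t = \<chi> t * (d 0 ^ ?s * d (dim2 - 1) ^ ?s)" by (simp only: dd mult_1_right)
    also have "\<dots> = (X1 (diagm dim2 d) * d 0 ^ ?s) * d (dim2 - 1) ^ ?s" by (simp only: x mult.assoc)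
    also have "\<dots> = d (dim2 - 1) ^ ?s" by (simp only: xc[OF d(2)] mult_1_left)
    finally have 1: "\<chi> t = d (dim2 - 1) ^ ?s" .
    have l: "dim2 - 1 < dim2" using n by simp
    have "last_fun dim2 c (crd t) = (\<Prod>i\<in>{1..<dim2}. if odd i then d (dim2 - 1) ^ c i else 1)"
      unfolding last_fun_def d(1) diagm_index[OF l l] by (intro prod.cong refl) simp
    also have "\<dots> = (\<Prod>i | i \<in> {1..<dim2} \<and> odd i. d (dim2 - 1) ^ c i)"
      by (rule prod.inter_filter[symmetric]) simp
    also have "\<dots> = d (dim2 - 1) ^ ?s" by (simp only: power_sum)
    finally show "\<chi> t = last_fun dim2 c (crd t)" by (simp only: 1)
  qed
  then show ?thesis by blast
qed

lemma freely_generated: "freely_generated_by D ext_monoid gens"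
  unfolding freely_generated_by_def
proof (intro conjI)
  show "finite gens" by simp
  show "gens \<subseteq> carrier D"
  proof
    fix x assume "x \<in> gens"
    then obtain i where "x = gen i" "i \<in> {1..<dim2}" by blast
    then show "x \<in> carrier D" using gen_carrier[of i] by simp
  qed
  show "bij_betw (\<lambda>a. finprod D (\<lambda>x. x [^]\<^bsub>D\<^esub> a x) gens) (gens \<rightarrow>\<^sub>E (UNIV :: nat set)) ext_monoid"
    unfolding finprod_gens
  proof (rule bij_betwI')
    fix a a' :: "(complex mat \<Rightarrow> complex) \<times> (complex mat \<Rightarrow> complex) \<Rightarrow> nat"
    assume a: "a \<in> gens \<rightarrow>\<^sub>E UNIV" "a' \<in> gens \<rightarrow>\<^sub>E UNIV"
    show "(weight_pair (\<lambda>i. a (gen i)) = weight_pair (\<lambda>i. a' (gen i))) = (a = a')"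
    proof
      assume e: "weight_pair (\<lambda>i. a (gen i)) = weight_pair (\<lambda>i. a' (gen i))"
      show "a = a'"
      proof (rule PiE_ext[OF a])
        fix x assume "x \<in> gens"
        then obtain i where "x = gen i" "i \<in> {1..<dim2}" by blast
        then show "a x = a' x" using weight_pair_inj[OF e] by simp
      qed
    qed simp
  next
    fix a :: "(complex mat \<Rightarrow> complex) \<times> (complex mat \<Rightarrow> complex) \<Rightarrow> nat"
    show "weight_pair (\<lambda>i. a (gen i)) \<in> ext_monoid" by (rule weight_pair_mem)
  next
    fix z assume "z \<in> ext_monoid"
    then obtain c where c: "z = weight_pair c" using mem_weight_pair by blast
    define a where "a = (\<lambda>x\<in>gens. c (the_inv_into {1..<dim2} gen x))"
    have "a (gen i) = c i" if "i \<in> {1..<dim2}" for i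
      using that the_inv_into_f_f[OF gen_inj that] by (simp add: a_def)
    then have "weight_pair (\<lambda>i. a (gen i)) = weight_pair c"
      unfolding weight_pair_def weight_fun_def last_fun_def by (intro arg_cong2[where f = Pair] restrict_ext prod.cong refl) simp_all
    then show "\<exists>a\<in>gens \<rightarrow>\<^sub>E UNIV. z = weight_pair (\<lambda>i. a (gen i))"
      by (intro bexI[of _ a]) (auto simp: a_def c)
  qed
qed

end

theorem mainTheorem3:
  fixes n :: nat and \<Omega> S :: "complex mat"
    and G H B T TH BHm P :: "complex mat set"
    and \<omega> \<omega>H \<beta> :: "nat \<Rightarrow> complex mat \<Rightarrow> complex"
  assumes "n \<ge> 3"
    and "\<Omega> \<in> carrier_mat (2 * n) (2 * n)"
    and "S \<in> carrier_mat (2 * n) (2 * n)"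
    and "transpose_mat S * \<Omega> * S = bourbaki_form n"
    and "G = SL (2 * n)" and "H = Sp (2 * n) \<Omega>"
    and "T = torus (2 * n) S G" and "B = borel (2 * n) S G"
    and "TH = torus (2 * n) S H" and "BHm = opp_borel (2 * n) S H"
    and "\<omega> = fund_weight (2 * n) S G" and "\<omega>H = fund_weight (2 * n) S H"
    and "\<beta> = simple_root_C n S H"
    and "P = parabolic (2 * n) H TH BHm (\<beta> ` {1..n}) {\<beta> 1}"
  shows "freely_generated_by (char_group (2 * n) T \<times>\<times> char_group (2 * n) TH)
           (ext_weight_monoid (2 * n) G B T P TH)
           ({(\<omega> (2 * i), \<one>\<^bsub>char_group (2 * n) TH\<^esub>) | i. 1 \<le> i \<and> i \<le> n - 1} \<union>
            {(\<omega> (2 * j - 1), inv\<^bsub>char_group (2 * n) TH\<^esub> (\<omega>H 1)) | j. 1 \<le> j \<and> j \<le> n})"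
proof -
  let ?N = "2 * n"
  have c: "transpose_mat S * \<Omega> \<in> carrier_mat ?N ?N" using assms(2,3) by auto
  have "det (transpose_mat S * \<Omega>) * det S = det (bourbaki_form n)"
    using det_mult[OF c assms(3)] assms(4) by simp
  then have "det S \<noteq> 0" using det_bourbaki_form[of n] by auto
  then obtain Si where Si: "Si \<in> carrier_mat ?N ?N" "S * Si = 1\<^sub>m ?N" "Si * S = 1\<^sub>m ?N"
    using mat_inverse_exists[OF assms(3)] by blast
  have n: "2 \<le> n" using assms(1) by simp
  show ?thesis
    unfolding assms(5-14) gens_eq[OF n assms(2-4) Si]
    by (rule freely_generated[OF n assms(2-4) Si])
qed

end
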